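(* Let $X_m^{(\kappa)}\neq A_{2r}^{(2)}$ be a twisted affine type, let $\overline\lambda=\sum_{a\in I_r}\ell_a\overline\omega_a$ be a dominant integral weight of $\mathfrak g^\sigma$, and let $\mathbf n=(n_{a,i})_{a\in I_r,i\in\mathbb N}$ be a vector of nonnegative integers with finitely many nonzero entries. Then $$M_{\overline\lambda,\mathbf n}(q^{-1})=\tilde M_{\overline\lambda,\mathbf n}(q^{-1}).$$
   Context: $\mathbb N=\{1,2,\dots\}$. Let $\mathfrak g$ be a simply-laced simple complex Lie algebra of type $X_m\ne A_{2r}$, $\sigma$ the automorphism induced by a nontrivial Dynkin diagram automorphism, $\kappa>1$ its order, and $\mathfrak g^\sigma$ the fixed-point subalgebra. The cases are $X_m^{(\kappa)}=A_{2r-1}^{(2)},D_{r+1}^{(2)},E_6^{(2)},D_4^{(3)}$, with $\mathfrak g^\sigma$ of type $C_r,B_r,F_4,G_2$ respectively. $I_r=\{1,\dots,r\}$ is the set of simple root labels of $\mathfrak g^\sigma$, $\overline\omega_a$ ($a\in I_r$) are its fundamental weights, and $\overline C$ is its Cartan matrix, $\overline C_{ab}=\overline\alpha_b(\overline\alpha_a^\vee)$. The integers $t_a^\vee$ ($a\in I_r$) are determined by $\min_a t_a^\vee=1$ and $t_a^\vee\overline C_{ab}=t_b^\vee\overline C_{ba}$ for all $a,b$ (so $t_a^\vee=\kappa$ if $\overline\alpha_a$ is long, $1$ if short). Put $q_a=q^{t_a^\vee}$. For $\mathbf m=(m_{a,i})_{a\in I_r,i\in\mathbb N}$ a vector of nonnegative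 integers with finitely many nonzero entries, put $$q_{a,0}=\ell_a+\sum_{j\in\mathbb N}\sum_{b\in I_r}j(\overline C_{ab}m_{b,j}-\delta_{ab}n_{b,j}),\qquad p_{a,i}=\sum_{j\in\mathbb N}\sum_{b\in I_r}\min(i,j)(\delta_{ab}n_{b,j}-\overline C_{ab}m_{b,j}),$$ $$Q(\mathbf m,\mathbf n)=\tfrac12\sum_{i,j\in\mathbb N}\sum_{a,b\in I_r}t_a^\vee\min(i,j)\,m_{a,i}(\overline C_{ab}m_{b,j}-2\delta_{ab}n_{b,j}).$$ For $m\in\mathbb Z_{\ge0}$, $p\in\mathbb Z$, $$\begin{bmatrix} m+p \\ m \end{bmatrix}_v=\frac{(v^{p+1};v)_\infty(v^{m+1};v)_\infty}{(v;v)_\infty(v^{p+m+1};v)_\infty},\quad (a;v)_\infty=\prod_{j\ge0}(1-av^j),$$ understood as $\prod_{j=1}^m\frac{1-v^{p+j}}{1-v^j}$ (also for negative $p$). Then $$M_{\overline\lambda,\mathbf n}(q^{-1})=\sum_{\substack{\mathbf m\ge\mathbf 0 \\ q_{a,0}=0,\ p_{a,i}\ge0}}q^{Q(\mathbf m,\mathbf n)}\prod_{i\in\mathbb N}\prod_{a\in I_r}\begin{bmatrix} m_{a,i}+p_{a,i} \\ m_{a,i} \end{bmatrix}_{q_a},$$ $$\tilde M_{\overline\lambda,\mathbf n}(q^{-1})=\sum_{\substack{\mathbf m\ge\mathbf 0 \\ q_{a,0}=0}}q^{Q(\mathbf m,\mathbf n)}\prod_{i\in\mathbb N}\prod_{a\in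 I_r}\begin{bmatrix} m_{a,i}+p_{a,i} \\ m_{a,i} \end{bmatrix}_{q_a},$$ where the constraint $q_{a,0}=0$ is for all $a\in I_r$ and $p_{a,i}\ge0$ is for all $a\in I_r$, $i\in\mathbb N$. (In the paper $\mathbf n$ parameterizes a finite set of Kirillov–Reshetikhin modules, $n_{a,i}$ being the number of type $(a,i)$.) *)

theory Defs
  imports
    "HOL-Library.Groups_Big_Fun"
    "HOL-Library.FuncSet"
    "HOL-Computational_Algebra.Computational_Algebra"
begin

section \<open>Twisted affine types and the fixed-point subalgebra\<close>

text \<open>
  The argument of \<open>A_odd_2\<close> and \<open>D_2\<close> is the rank \<open>r\<close> of the fixed-point subalgebra, so that
  \<open>A_odd_2 r\<close> is \<open>A\<^bsub>2r-1\<^esub>\<^bsup>(2)\<^esup>\<close> and \<open>D_2 r\<close> is \<open>D\<^bsub>r+1\<^esub>\<^bsup>(2)\<^esup>\<close>.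
\<close>

datatype twisted_type = A_odd_2 nat | D_2 nat | E6_2 | D4_3

text \<open>
  For \<open>r = 1\<close> there is no such type: the diagram of \<open>A\<^sub>1\<close> has no nontrivial automorphism, and
  \<open>D\<^sub>2\<close> is not simple. For \<open>r = 2\<close> the underlying algebra is \<open>A\<^sub>3 = D\<^sub>3\<close> in both series.
\<close>

fun is_twisted_type :: "twisted_type \<Rightarrow> bool" where
  "is_twisted_type (A_odd_2 r) \<longleftrightarrow> r \<ge> 2"
| "is_twisted_type (D_2 r) \<longleftrightarrow> r \<ge> 2"
| "is_twisted_type E6_2 \<longleftrightarrow> True"
| "is_twisted_type D4_3 \<longleftrightarrow> True"

fun rk :: "twisted_type \<Rightarrow> nat" where
  "rk (A_odd_2 r) = r"
| "rk (D_2 r) = r"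
| "rk E6_2 = 4"
| "rk D4_3 = 2"

definition I_r :: "twisted_type \<Rightarrow> nat set" where
  "I_r X = {1..rk X}"

fun kappa :: "twisted_type \<Rightarrow> nat" where
  "kappa (A_odd_2 r) = 2"
| "kappa (D_2 r) = 2"
| "kappa E6_2 = 2"
| "kappa D4_3 = 3"

text \<open>
  The fixed-point subalgebra is of type \<open>C\<^sub>r\<close>, \<open>B\<^sub>r\<close>, \<open>F\<^sub>4\<close>, \<open>G\<^sub>2\<close> respectively, with simple roots in
  Bourbaki's order. Its Dynkin diagram is then a chain \<open>1 - 2 - \<dots> - r\<close> with exactly one multiple
  bond; \<open>mult_bond X = (s, l)\<close> gives its short end \<open>s\<close> and its long end \<open>l\<close>.
\<close>

fun mult_bond :: "twisted_type \<Rightarrow> nat \<times> nat" where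
  "mult_bond (A_odd_2 r) = (r - 1, r)"
| "mult_bond (D_2 r) = (r, r - 1)"
| "mult_bond E6_2 = (3, 2)"
| "mult_bond D4_3 = (1, 2)"

text \<open>
  \<open>cartan X a b\<close> is the value of the simple root \<open>b\<close> on the simple coroot \<open>a\<close>, so the entry
  different from \<open>0, -1, 2\<close> has the short root as its row index and the long root as its column
  index.
\<close>

definition cartan :: "twisted_type \<Rightarrow> nat \<Rightarrow> nat \<Rightarrow> int" where
  "cartan X a b =
    (if a = b then 2
     else if (a, b) = mult_bond X then - int (kappa X)
     else if b = Suc a \<or> a = Suc b then -1
     else 0)"

text \<open>The value \<open>0\<close> outside \<open>I_r X\<close> is only there to make the description definite.\<close>

definition t_vee :: "twisted_type \<Rightarrow> nat \<Rightarrow> int" where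
  "t_vee X = (THE t.
     (MIN a\<in>I_r X. t a) = 1 \<and>
     (\<forall>a\<in>I_r X. \<forall>b\<in>I_r X. t a * cartan X a b = t b * cartan X b a) \<and>
     (\<forall>a. a \<notin> I_r X \<longrightarrow> t a = 0))"

section \<open>Fermionic sums\<close>

text \<open>
  A vector of nonnegative integers indexed by \<open>I_r X\<close> and the positive integers, with finitely many
  nonzero entries, is represented by its extension by zero.
\<close>

definition fin_vecs :: "twisted_type \<Rightarrow> (nat \<Rightarrow> nat \<Rightarrow> nat) set" where
  "fin_vecs X = {m. finite {(a, i). m a i \<noteq> 0} \<and> (\<forall>a i. m a i \<noteq> 0 \<longrightarrow> a \<in> I_r X \<and> i \<ge> 1)}"

text \<open>
  Infinite sums and products with finitely many nontrivial terms are \<open>Sum_any\<close> and \<open>Prod_any\<close>. In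
  all of them the index \<open>0\<close> contributes trivially.
\<close>

definition q_zero ::
  "twisted_type \<Rightarrow> (nat \<Rightarrow> nat) \<Rightarrow> (nat \<Rightarrow> nat \<Rightarrow> nat) \<Rightarrow> (nat \<Rightarrow> nat \<Rightarrow> nat) \<Rightarrow> nat \<Rightarrow> int" where
  "q_zero X l m n a = int (l a) +
     Sum_any (\<lambda>j. \<Sum>b\<in>I_r X.
       int j * (cartan X a b * int (m b j) - of_bool (a = b) * int (n b j)))"

definition p_vac ::
  "twisted_type \<Rightarrow> (nat \<Rightarrow> nat \<Rightarrow> nat) \<Rightarrow> (nat \<Rightarrow> nat \<Rightarrow> nat) \<Rightarrow> nat \<Rightarrow> nat \<Rightarrow> int" where
  "p_vac X m n a i =
     Sum_any (\<lambda>j. \<Sum>b\<in>I_r X.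
       int (min i j) * (of_bool (a = b) * int (n b j) - cartan X a b * int (m b j)))"

definition Q_dbl ::
  "twisted_type \<Rightarrow> (nat \<Rightarrow> nat \<Rightarrow> nat) \<Rightarrow> (nat \<Rightarrow> nat \<Rightarrow> nat) \<Rightarrow> int" where
  "Q_dbl X m n =
     Sum_any (\<lambda>i. Sum_any (\<lambda>j. \<Sum>a\<in>I_r X. \<Sum>b\<in>I_r X.
       t_vee X a * int (min i j) * int (m a i) *
         (cartan X a b * int (m b j) - 2 * of_bool (a = b) * int (n b j))))"

text \<open>The division is exact, see \<open>even_Q_dbl\<close> below.\<close>

definition Q_form ::
  "twisted_type \<Rightarrow> (nat \<Rightarrow> nat \<Rightarrow> nat) \<Rightarrow> (nat \<Rightarrow> nat \<Rightarrow> nat) \<Rightarrow> int" where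
  "Q_form X m n = Q_dbl X m n div 2"

text \<open>The \<open>v\<close>-binomial coefficient of \<open>m + p\<close> over \<open>m\<close>.\<close>

definition v_binom :: "'k::field \<Rightarrow> nat \<Rightarrow> int \<Rightarrow> 'k" where
  "v_binom v m p = (\<Prod>j=1..m. (1 - v powi (p + int j)) / (1 - v ^ j))"

definition fermionic_term ::
  "twisted_type \<Rightarrow> (nat \<Rightarrow> nat \<Rightarrow> nat) \<Rightarrow> (nat \<Rightarrow> nat \<Rightarrow> nat) \<Rightarrow> 'k::field \<Rightarrow> 'k" where
  "fermionic_term X m n q = q powi Q_form X m n *
     Prod_any (\<lambda>i. \<Prod>a\<in>I_r X. v_binom (q powi t_vee X a) (m a i) (p_vac X m n a i))"

text \<open>
  Both sums are defined through their values at \<open>q\<^bsup>-1\<^esup>\<close>, hence the \<open>inverse\<close> below.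
  They range over finite sets, see \<open>finite_weight_set\<close>.
\<close>

definition fermionic_M ::
  "twisted_type \<Rightarrow> (nat \<Rightarrow> nat) \<Rightarrow> (nat \<Rightarrow> nat \<Rightarrow> nat) \<Rightarrow> 'k::field \<Rightarrow> 'k" where
  "fermionic_M X l n z =
     (\<Sum>m | m \<in> fin_vecs X \<and> (\<forall>a\<in>I_r X. q_zero X l m n a = 0) \<and>
            (\<forall>a\<in>I_r X. \<forall>i\<ge>1. p_vac X m n a i \<ge> 0).
        fermionic_term X m n (inverse z))"

definition fermionic_M_tilde ::
  "twisted_type \<Rightarrow> (nat \<Rightarrow> nat) \<Rightarrow> (nat \<Rightarrow> nat \<Rightarrow> nat) \<Rightarrow> 'k::field \<Rightarrow> 'k" where
  "fermionic_M_tilde X l n z =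
     (\<Sum>m | m \<in> fin_vecs X \<and> (\<forall>a\<in>I_r X. q_zero X l m n a = 0).
        fermionic_term X m n (inverse z))"

text \<open>The indeterminate of the field of rational functions over the rationals.\<close>

definition q_var :: "rat poly fract" where
  "q_var = Fract [:0, 1:] 1"

section \<open>Well-definedness\<close>

text \<open>Explicitly, \<open>t_vee X a\<close> is \<open>kappa X\<close> on long and \<open>1\<close> on short simple roots.\<close>

fun is_long :: "twisted_type \<Rightarrow> nat \<Rightarrow> bool" where
  "is_long (A_odd_2 r) a \<longleftrightarrow> a = r"
| "is_long (D_2 r) a \<longleftrightarrow> a < r"
| "is_long E6_2 a \<longleftrightarrow> a \<le> 2"
| "is_long D4_3 a \<longleftrightarrow> a = 2"

definition t_expl :: "twisted_type \<Rightarrow> nat \<Rightarrow> int" where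
  "t_expl X a = (if a \<in> I_r X then if is_long X a then int (kappa X) else 1 else 0)"

lemma finite_I_r [simp]: "finite (I_r X)"
  by (simp add: I_r_def)

lemma cartan_diag [simp]: "cartan X a a = 2"
  by (simp add: cartan_def)

lemma cartan_Suc_ne:
  assumes "is_twisted_type X"
  shows "cartan X a (Suc a) \<noteq> 0" "cartan X (Suc a) a \<noteq> 0"
  using assms by (cases X; auto simp: cartan_def)+

lemma t_expl_sym:
  assumes "is_twisted_type X" "a \<in> I_r X" "b \<in> I_r X"
  shows "t_expl X a * cartan X a b = t_expl X b * cartan X b a"
  using assms by (cases X) (auto simp: t_expl_def cartan_def I_r_def)

lemma t_expl_Min:
  assumes "is_twisted_type X"
  shows "(MIN a\<in>I_r X. t_expl X a) = 1"
proof -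
  have "\<exists>a\<in>I_r X. t_expl X a = 1"
  proof (cases X)
    case (A_odd_2 r)
    then show ?thesis using assms by (intro bexI[of _ 1]) (auto simp: t_expl_def I_r_def)
  next
    case (D_2 r)
    then show ?thesis using assms by (intro bexI[of _ r]) (auto simp: t_expl_def I_r_def)
  next
    case E6_2
    then show ?thesis by (intro bexI[of _ 3]) (auto simp: t_expl_def I_r_def)
  next
    case D4_3
    then show ?thesis by (intro bexI[of _ 1]) (auto simp: t_expl_def I_r_def)
  qed
  moreover have "t_expl X a \<ge> 1" if "a \<in> I_r X" for a
    using that by (cases X) (auto simp: t_expl_def)
  ultimately show ?thesis
    by (intro Min_eqI) force+
qed

theorem t_vee_eq:
  assumes X: "is_twisted_type X"
  shows "t_vee X = t_expl X"
  unfolding t_vee_def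
proof (rule the_equality, goal_cases)
  case 1
  show ?case
    using t_expl_Min[OF X] t_expl_sym[OF X] by (auto simp: t_expl_def)
next
  case (2 t)
  let ?s = "t_expl X"
  have ne: "I_r X \<noteq> {}" "1 \<in> I_r X"
    using X by (cases X; auto simp: I_r_def)+
  have chain: "t a * ?s 1 = t 1 * ?s a" if "a \<in> I_r X" for a
    using that
  proof (induction a)
    case 0
    then show ?case by (simp add: I_r_def)
  next
    case (Suc a)
    show ?case
    proof (cases "a = 0")
      case False
      then have a: "a \<in> I_r X" using Suc.prems by (auto simp: I_r_def)
      let ?c = "cartan X a (Suc a)" and ?d = "cartan X (Suc a) a"
      have t: "t (Suc a) * ?d = t a * ?c" and s: "?s (Suc a) * ?d = ?s a * ?c"
        using 2 a Suc.prems t_expl_sym[OF X] by metis+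
      have "(t (Suc a) * ?s 1) * ?d = (t a * ?s 1) * ?c"
        using t by (simp add: mult_ac)
      also have "\<dots> = (t 1 * ?s (Suc a)) * ?d"
        using Suc.IH[OF a] s by (simp add: mult_ac)
      finally show ?thesis using cartan_Suc_ne[OF X] by simp
    qed simp
  qed
  have pos: "u b \<ge> 1" if "(MIN a\<in>I_r X. u a) = (1::int)" "b \<in> I_r X" for u b
    using Min_le[of "u ` I_r X" "u b"] that by simp
  obtain x where x: "x \<in> I_r X" "t x = 1"
    using Min_in[of "t ` I_r X"] 2 ne by fastforce
  obtain y where y: "y \<in> I_r X" "?s y = 1"
    using Min_in[of "?s ` I_r X"] t_expl_Min[OF X] ne by fastforce
  have t1: "t 1 \<ge> 1" and s1: "?s 1 \<ge> 1"
    using pos 2 t_expl_Min[OF X] ne by blast+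
  have "?s 1 = t 1 * ?s x" "t y * ?s 1 = t 1"
    using chain[OF x(1)] chain[OF y(1)] x y by auto
  moreover have "?s x \<ge> 1" "t y \<ge> 1"
    using pos 2 t_expl_Min[OF X] x y by blast+
  ultimately have "t 1 \<le> ?s 1" "?s 1 \<le> t 1"
    using t1 s1 mult_left_mono[of 1 "?s x" "t 1"] mult_right_mono[of 1 "t y" "?s 1"] by linarith+
  then have "t 1 = ?s 1" by simp
  then have "t a = ?s a" if "a \<in> I_r X" for a
    using chain[OF that] s1 by (simp add: mult.commute)
  then show ?case using 2 by (auto simp: t_expl_def)
qed

lemma fin_vecs_bound:
  assumes "m \<in> fin_vecs X"
  obtains N where "\<And>a i. m a i \<noteq> 0 \<Longrightarrow> i \<le> N"
proof -
  have "finite (snd ` {(a, i). m a i \<noteq> 0})"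
    using assms by (auto simp: fin_vecs_def)
  then obtain N where "\<forall>i\<in>snd ` {(a, i). m a i \<noteq> 0}. i \<le> N"
    using finite_nat_set_iff_bounded_le by blast
  then show thesis by (intro that[of N]) force
qed

lemma even_symmetric_sum:
  fixes F :: "'a \<Rightarrow> 'a \<Rightarrow> int"
  assumes "finite K" "\<And>x y. x \<in> K \<Longrightarrow> y \<in> K \<Longrightarrow> F x y = F y x" "\<And>x. x \<in> K \<Longrightarrow> even (F x x)"
  shows "even (\<Sum>x\<in>K. \<Sum>y\<in>K. F x y)"
  using assms
proof (induction K rule: finite_induct)
  case (insert z K)
  have "(\<Sum>x\<in>K. F x z) = (\<Sum>y\<in>K. F z y)"
    using insert.prems by (intro sum.cong) auto
  then have "(\<Sum>x\<in>insert z K. \<Sum>y\<in>insert z K. F x y) =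
      F z z + 2 * (\<Sum>y\<in>K. F z y) + (\<Sum>x\<in>K. \<Sum>y\<in>K. F x y)"
    using insert.hyps by (simp add: sum.distrib)
  then show ?case using insert by simp
qed simp

theorem even_Q_dbl:
  assumes X: "is_twisted_type X" and m: "m \<in> fin_vecs X" and n: "n \<in> fin_vecs X"
  shows "even (Q_dbl X m n)"
proof -
  obtain N1 N2 where "\<And>a i. m a i \<noteq> 0 \<Longrightarrow> i \<le> N1" "\<And>a i. n a i \<noteq> 0 \<Longrightarrow> i \<le> N2"
    using fin_vecs_bound[OF m] fin_vecs_bound[OF n] by metis
  then have "m a i \<noteq> 0 \<Longrightarrow> i \<le> max N1 N2" "n a i \<noteq> 0 \<Longrightarrow> i \<le> max N1 N2" for a i
    by (simp_all add: le_max_iff_disj)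
  then obtain N where "\<And>a i. m a i \<noteq> 0 \<Longrightarrow> i \<le> N" "\<And>a i. n a i \<noteq> 0 \<Longrightarrow> i \<le> N"
    by blast
  then have zero: "m a i = 0" "n a i = 0" if "i > N" for a i
    using that by (metis leD)+
  let ?I = "I_r X"
  have prod_sum: "(\<Sum>i\<le>N. \<Sum>a\<in>?I. G i a) = (\<Sum>x\<in>{..N} \<times> ?I. G (fst x) (snd x))"
    for G :: "nat \<Rightarrow> nat \<Rightarrow> int"
    by (simp add: sum.cartesian_product case_prod_beta)
  define f where "f i j a b = t_vee X a * int (min i j) * int (m a i) * (cartan X a b * int (m b j))"
    for i j a b
  define g where "g i j a b = t_vee X a * int (min i j) * int (m a i) * (of_bool (a = b) * int (n b j))"
    for i j a b
  have "Q_dbl X m n = Sum_any (\<lambda>i. Sum_any (\<lambda>j. \<Sum>a\<in>?I. \<Sum>b\<in>?I. f i j a b - 2 * g i j a b))"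
    unfolding Q_dbl_def f_def g_def by (simp add: algebra_simps)
  also have "\<dots> = Sum_any (\<lambda>i. \<Sum>j\<le>N. \<Sum>a\<in>?I. \<Sum>b\<in>?I. f i j a b - 2 * g i j a b)"
  proof (intro arg_cong[where f = Sum_any] ext Sum_any.expand_superset)
    fix i
    show "{j. (\<Sum>a\<in>?I. \<Sum>b\<in>?I. f i j a b - 2 * g i j a b) \<noteq> 0} \<subseteq> {..N}"
      by (intro subsetI, rule ccontr) (auto simp: f_def g_def zero not_le)
  qed auto
  also have "\<dots> = (\<Sum>i\<le>N. \<Sum>j\<le>N. \<Sum>a\<in>?I. \<Sum>b\<in>?I. f i j a b - 2 * g i j a b)"
  proof (intro Sum_any.expand_superset)
    show "{i. (\<Sum>j\<le>N. \<Sum>a\<in>?I. \<Sum>b\<in>?I. f i j a b - 2 * g i j a b) \<noteq> 0} \<subseteq> {..N}"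
      by (intro subsetI, rule ccontr) (auto simp: f_def g_def zero not_le)
  qed auto
  also have "\<dots> = (\<Sum>i\<le>N. \<Sum>j\<le>N. \<Sum>a\<in>?I. \<Sum>b\<in>?I. f i j a b) -
      2 * (\<Sum>i\<le>N. \<Sum>j\<le>N. \<Sum>a\<in>?I. \<Sum>b\<in>?I. g i j a b)"
    by (simp add: sum_subtractf sum_distrib_left)
  also have "(\<Sum>i\<le>N. \<Sum>j\<le>N. \<Sum>a\<in>?I. \<Sum>b\<in>?I. f i j a b) =
      (\<Sum>i\<le>N. \<Sum>a\<in>?I. \<Sum>j\<le>N. \<Sum>b\<in>?I. f i j a b)"
    by (intro sum.cong refl sum.swap)
  also have "\<dots> = (\<Sum>x\<in>{..N} \<times> ?I. \<Sum>y\<in>{..N} \<times> ?I. f (fst x) (fst y) (snd x) (snd y))"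
    by (simp only: prod_sum)
  finally have Q: "Q_dbl X m n = \<dots> - 2 * (\<Sum>i\<le>N. \<Sum>j\<le>N. \<Sum>a\<in>?I. \<Sum>b\<in>?I. g i j a b)" .
  have "even (\<Sum>x\<in>{..N} \<times> ?I. \<Sum>y\<in>{..N} \<times> ?I. f (fst x) (fst y) (snd x) (snd y))"
  proof (intro even_symmetric_sum)
    fix x y assume "x \<in> {..N} \<times> ?I" "y \<in> {..N} \<times> ?I"
    then have "t_vee X (snd x) * cartan X (snd x) (snd y) = t_vee X (snd y) * cartan X (snd y) (snd x)"
      using t_expl_sym[OF X] t_vee_eq[OF X] by auto
    then have "(t_vee X (snd x) * cartan X (snd x) (snd y)) *
          (int (min (fst x) (fst y)) * int (m (snd x) (fst x)) * int (m (snd y) (fst y))) =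
        (t_vee X (snd y) * cartan X (snd y) (snd x)) *
          (int (min (fst x) (fst y)) * int (m (snd x) (fst x)) * int (m (snd y) (fst y)))"
      by simp
    then show "f (fst x) (fst y) (snd x) (snd y) = f (fst y) (fst x) (snd y) (snd x)"
      by (simp add: f_def mult_ac min.commute)
  qed (auto simp: f_def)
  then show ?thesis using Q by simp
qed

lemma cartan_row:
  fixes x :: "nat \<Rightarrow> int"
  assumes X: "is_twisted_type X" and a: "a \<in> I_r X"
  shows "(\<Sum>b\<in>I_r X. cartan X a b * x b) =
    2 * x a + (if a > 1 then cartan X a (a - 1) * x (a - 1) else 0)
      + (if a < rk X then cartan X a (Suc a) * x (Suc a) else 0)"
proof -
  have nil: "cartan X a b = 0" if "b \<notin> {a - 1, a, Suc a}" for b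
    using that X a by (cases X) (auto simp: cartan_def I_r_def)
  have "(\<Sum>b\<in>I_r X. cartan X a b * x b) = (\<Sum>b\<in>I_r X \<inter> {a - 1, a, Suc a}. cartan X a b * x b)"
    using nil by (intro sum.mono_neutral_right) auto
  also have "I_r X \<inter> {a - 1, a, Suc a} =
      insert a ((if a > 1 then {a - 1} else {}) \<union> (if a < rk X then {Suc a} else {}))"
    using a by (auto simp: I_r_def)
  finally show ?thesis using a by (auto simp: I_r_def)
qed

lemma cartan_kernel:
  fixes x :: "nat \<Rightarrow> int"
  assumes X: "is_twisted_type X" and 0: "\<And>a. a \<in> I_r X \<Longrightarrow> (\<Sum>b\<in>I_r X. cartan X a b * x b) = 0"
    and b: "b \<in> I_r X"
  shows "x b = 0"
proof -
  have row: "2 * x a + (if a > 1 then cartan X a (a - 1) * x (a - 1) else 0)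
      + (if a < rk X then cartan X a (Suc a) * x (Suc a) else 0) = 0" if "a \<in> I_r X" for a
    using 0 cartan_row[OF X] that by simp
  show ?thesis
  proof (cases X)
    case X': (A_odd_2 r)
    have r: "r \<ge> 2" using X X' by simp
    then obtain k where k: "r = Suc (Suc k)" by (metis add_2_eq_Suc le_Suc_ex)
    have "a < r \<longrightarrow> x a = int a * x 1 \<and> (a \<ge> 1 \<longrightarrow> x (a - 1) = (int a - 1) * x 1 \<or> a = 1)"
      if "a \<ge> 1" for a
      using that
    proof (induction a rule: dec_induct)
      case (step a)
      show ?case
      proof
        assume "Suc a < r"
        then show "x (Suc a) = int (Suc a) * x 1 \<and>
            (Suc a \<ge> 1 \<longrightarrow> x (Suc a - 1) = (int (Suc a) - 1) * x 1 \<or> Suc a = 1)"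
          using row[of a] step by (auto simp: X' I_r_def cartan_def algebra_simps split: if_splits)
      qed
    qed simp
    then have lin: "x a = int a * x 1" if "a \<ge> 1" "a < r" for a using that by blast
    have e1: "2 * x r - x (r - 1) = 0"
      using row[of r] by (auto simp: X' k I_r_def cartan_def)
    have e2: "2 * x (r - 1) - (if r > 2 then x (r - 2) else 0) - 2 * x r = 0"
      using row[of "r - 1"]
      by (auto simp: X' k I_r_def cartan_def numeral_2_eq_2 split: if_splits)
    have "(if r > 2 then x (r - 2) else 0) = (int r - 2) * x 1" "x (r - 1) = (int r - 1) * x 1"
      using lin[of "r - 1"] lin[of "r - 2"] r by (auto simp: of_nat_diff)
    then have "x 1 = 0" using e1 e2 by (simp add: algebra_simps)
    then show ?thesis using lin[of b] e1 lin[of "r - 1"] b r by (cases "b = r") (auto simp: X' I_r_def)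
  next
    case X': (D_2 r)
    have r: "r \<ge> 2" using X X' by simp
    then obtain k where k: "r = Suc (Suc k)" by (metis add_2_eq_Suc le_Suc_ex)
    have "a \<le> r \<longrightarrow> x a = int a * x 1 \<and> (a \<ge> 1 \<longrightarrow> x (a - 1) = (int a - 1) * x 1 \<or> a = 1)"
      if "a \<ge> 1" for a
      using that
    proof (induction a rule: dec_induct)
      case (step a)
      show ?case
      proof
        assume "Suc a \<le> r"
        then show "x (Suc a) = int (Suc a) * x 1 \<and>
            (Suc a \<ge> 1 \<longrightarrow> x (Suc a - 1) = (int (Suc a) - 1) * x 1 \<or> Suc a = 1)"
          using row[of a] step by (auto simp: X' I_r_def cartan_def algebra_simps split: if_splits)
      qed
    qed simp
    then have lin: "x a = int a * x 1" if "a \<ge> 1" "a \<le> r" for a using that by blast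
    have "2 * x r - 2 * x (r - 1) = 0"
      using row[of r] by (auto simp: X' k I_r_def cartan_def)
    moreover have "x (r - 1) = (int r - 1) * x 1" "x r = int r * x 1"
      using lin[of "r - 1"] lin[of r] r by (auto simp: of_nat_diff)
    ultimately have "x 1 = 0" by (simp add: algebra_simps)
    then show ?thesis using lin[of b] b by (auto simp: X' I_r_def)
  next
    case X': E6_2
    have "2 * x 1 - x 2 = 0" "2 * x 2 - x 1 - x 3 = 0" "2 * x 3 - 2 * x 2 - x 4 = 0" "2 * x 4 - x 3 = 0"
      using row[of 1] row[of 2] row[of 3] row[of 4]
      by (auto simp: X' I_r_def cartan_def numeral_eq_Suc)
    moreover have "b = 1 \<or> b = 2 \<or> b = 3 \<or> b = 4" using b by (auto simp: X' I_r_def)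
    ultimately show ?thesis by auto
  next
    case X': D4_3
    have "2 * x 1 - 3 * x 2 = 0" "2 * x 2 - x 1 = 0"
      using row[of 1] row[of 2] by (auto simp: X' I_r_def cartan_def numeral_eq_Suc)
    moreover have "b = 1 \<or> b = 2" using b by (auto simp: X' I_r_def)
    ultimately show ?thesis by auto
  qed
qed

lemma q_zero_eq:
  assumes m: "m \<in> fin_vecs X" and n: "n \<in> fin_vecs X" and a: "a \<in> I_r X"
  shows "q_zero X l m n a = int (l a)
    + (\<Sum>b\<in>I_r X. cartan X a b * Sum_any (\<lambda>j. int j * int (m b j)))
    - Sum_any (\<lambda>j. int j * int (n a j))"
proof -
  obtain N1 N2 where "\<And>a i. m a i \<noteq> 0 \<Longrightarrow> i \<le> N1" "\<And>a i. n a i \<noteq> 0 \<Longrightarrow> i \<le> N2"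
    using fin_vecs_bound[OF m] fin_vecs_bound[OF n] by metis
  then have "m a i \<noteq> 0 \<Longrightarrow> i \<le> max N1 N2" "n a i \<noteq> 0 \<Longrightarrow> i \<le> max N1 N2" for a i
    by (simp_all add: le_max_iff_disj)
  then obtain N where N: "\<And>a i. m a i \<noteq> 0 \<Longrightarrow> i \<le> N" "\<And>a i. n a i \<noteq> 0 \<Longrightarrow> i \<le> N"
    by blast
  then have zero: "m a i = 0" "n a i = 0" if "i > N" for a i
    using that by (metis leD)+
  have 1: "Sum_any (\<lambda>j. int j * int (m b j)) = (\<Sum>j\<le>N. int j * int (m b j))" for b
    using N by (intro Sum_any.expand_superset) auto
  have 2: "Sum_any (\<lambda>j. int j * int (n a j)) = (\<Sum>j\<le>N. int j * int (n a j))"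
    using N by (intro Sum_any.expand_superset) auto
  have "Sum_any (\<lambda>j. \<Sum>b\<in>I_r X.
      int j * (cartan X a b * int (m b j) - of_bool (a = b) * int (n b j))) =
    (\<Sum>j\<le>N. \<Sum>b\<in>I_r X. int j * (cartan X a b * int (m b j) - of_bool (a = b) * int (n b j)))"
    (is "Sum_any ?h = _")
  proof (intro Sum_any.expand_superset)
    show "{j. ?h j \<noteq> 0} \<subseteq> {..N}"
      by (intro subsetI, rule ccontr) (auto simp: zero not_le)
  qed auto
  also have "\<dots> = (\<Sum>j\<le>N. \<Sum>b\<in>I_r X. cartan X a b * (int j * int (m b j))) -
      (\<Sum>j\<le>N. \<Sum>b\<in>I_r X. if a = b then int j * int (n b j) else 0)"
    unfolding sum_subtractf[symmetric] by (intro sum.cong) (auto simp: algebra_simps)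
  also have "(\<Sum>j\<le>N. \<Sum>b\<in>I_r X. cartan X a b * (int j * int (m b j))) =
      (\<Sum>b\<in>I_r X. cartan X a b * (\<Sum>j\<le>N. int j * int (m b j)))"
    by (subst sum.swap) (simp add: sum_distrib_left)
  also have "(\<Sum>j\<le>N. \<Sum>b\<in>I_r X. if a = b then int j * int (n b j) else 0) =
      (\<Sum>j\<le>N. int j * int (n a j))"
    using a by simp
  finally show ?thesis by (simp add: q_zero_def 1 2)
qed

theorem finite_weight_set:
  assumes X: "is_twisted_type X" and n: "n \<in> fin_vecs X"
  shows "finite {m \<in> fin_vecs X. \<forall>a\<in>I_r X. q_zero X l m n a = 0}" (is "finite ?W")
proof (cases "?W = {}")
  case False
  define wt where "wt m b = Sum_any (\<lambda>j. int j * int (m b j))" for m :: "nat \<Rightarrow> nat \<Rightarrow> nat" and b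
  from False obtain m0 where m0: "m0 \<in> ?W" by blast
  have wt_eq: "wt m b = wt m0 b" if m: "m \<in> ?W" and b: "b \<in> I_r X" for m b
  proof -
    have "(\<Sum>b\<in>I_r X. cartan X a b * (wt m b - wt m0 b)) = 0" if "a \<in> I_r X" for a
      using q_zero_eq[of m X n a l] q_zero_eq[of m0 X n a l] m m0 n that
      by (simp add: wt_def right_diff_distrib sum_subtractf)
    from cartan_kernel[OF X this b] show ?thesis by simp
  qed
  define B where "B = nat (\<Sum>b\<in>I_r X. \<bar>wt m0 b\<bar>)"
  have bound: "j * m b j \<le> B" if m: "m \<in> ?W" and b: "b \<in> I_r X" for m b j
  proof -
    obtain N where N: "\<And>a i. m a i \<noteq> 0 \<Longrightarrow> i \<le> N"
      using fin_vecs_bound m by blast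
    have "int j * int (m b j) \<le> (\<Sum>k\<in>insert j {..N}. int k * int (m b k))"
      by (intro member_le_sum) auto
    also have "\<dots> = wt m b"
      unfolding wt_def using N by (intro Sum_any.expand_superset[symmetric]) auto
    also have "\<dots> \<le> \<bar>wt m0 b\<bar>" using wt_eq[OF m b] by simp
    also have "\<dots> \<le> (\<Sum>b\<in>I_r X. \<bar>wt m0 b\<bar>)"
      using b by (intro member_le_sum) auto
    finally show ?thesis by (simp add: B_def nat_le_iff le_nat_iff flip: of_nat_mult)
  qed
  define S where "S = {g :: nat \<Rightarrow> nat. \<forall>i. (i \<in> {..B} \<longrightarrow> g i \<in> {..B}) \<and> (i \<notin> {..B} \<longrightarrow> g i = 0)}"
  have "?W \<subseteq> {m. \<forall>a. (a \<in> I_r X \<longrightarrow> m a \<in> S) \<and> (a \<notin> I_r X \<longrightarrow> m a = (\<lambda>_. 0))}"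
  proof
    fix m assume m: "m \<in> ?W"
    have nz: "a \<in> I_r X \<and> i \<ge> 1" if "m a i \<noteq> 0" for a i
      using m that by (simp add: fin_vecs_def)
    have le: "m a i \<le> B \<and> i \<le> B" if "m a i \<noteq> 0" for a i
    proof -
      have "1 \<le> i" "1 \<le> m a i" "i * m a i \<le> B"
        using nz[OF that] that bound[OF m] by auto
      then show ?thesis
        using mult_le_mono1[of 1 i "m a i"] mult_le_mono2[of 1 "m a i" i] by linarith
    qed
    have "m a \<in> S" for a
      unfolding S_def using le[of a] by (force simp: not_le)
    moreover have "m a = (\<lambda>_. 0)" if "a \<notin> I_r X" for a
      using nz that by blast
    ultimately show "m \<in> {m. \<forall>a. (a \<in> I_r X \<longrightarrow> m a \<in> S) \<and> (a \<notin> I_r X \<longrightarrow> m a = (\<lambda>_. 0))}"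
      by blast
  qed
  moreover have "finite S"
    unfolding S_def by (intro finite_set_of_finite_funs) auto
  ultimately show ?thesis
    by (elim finite_subset) (intro finite_set_of_finite_funs, auto)
qed (simp only: finite.emptyI)

end

theory Submission
  imports Defs "HOL-Library.Function_Algebras"
begin

text \<open>
  The two sums differ by the vectors \<open>m\<close> for which some vacancy number \<open>p\<^bsub>a,i\<^esub>\<close> is negative, and
  these terms have to cancel. When \<open>q\<^bsub>a,0\<^esub> = 0\<close> for all \<open>a\<close>, the vacancy numbers are determined from
  above: they are \<open>\<ge> 0\<close> at high levels, and \<open>p\<^bsub>i-1\<^esub> = 2 p\<^bsub>i\<^esub> - p\<^bsub>i+1\<^esub> - n\<^bsub>i\<^esub> + C m\<^bsub>i\<^esub>\<close>. Group the bad
  \<open>m\<close> by the last level \<open>i\<close> with a negative vacancy number and by the \<open>m\<^bsub>j\<^esub>\<close> with \<open>j > i\<close>. In such a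
  group \<open>\<alpha> = p\<^bsub>i\<^esub>\<close> and \<open>\<beta> = p\<^bsub>i+1\<^esub>\<close> are fixed, with \<open>\<beta> \<ge> 0\<close> and \<open>\<alpha>\<^sub>a < 0\<close> for some \<open>a\<close>, so that
  it is enough to see that the partial sum over the levels \<open>1, \<dots>, i\<close> vanishes for such \<open>\<alpha>\<close>, \<open>\<beta>\<close>
  (\<open>vacuum_coeff_vanishing\<close>).

  The partial sum is a matrix coefficient for the quantum Q-system, a family of invertible operators
  \<open>Q\<^bsub>a,i\<^esub>\<close> with
  \<open>Q\<^bsub>a,i+1\<^esub> Q\<^bsub>a,i-1\<^esub> = q\<^sup>x (Q\<^bsub>a,i\<^esub>\<^sup>2 - q\<^sup>y \<Prod>\<^bsub>b\<noteq>a\<^esub> Q\<^bsub>b,i\<^esub>\<^bsup>-C(b,a)\<^esup>)\<close> for suitable exponents \<open>x\<close>, \<open>y\<close>,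
  in which the \<open>Q\<^bsub>a,i\<^esub>\<close>, \<open>Q\<^bsub>b,i+1\<^esub>\<close> of two adjacent levels commute up to powers of \<open>q\<close>. By the
  \<open>q\<close>-binomial theorem, the ordered monomial \<open>E i \<alpha> \<beta>\<close>, standing for
  \<open>Q\<^bsub>i\<^esub>\<^bsup>\<beta>\<^esup> Q\<^bsub>i+1\<^esub>\<^bsup>-\<alpha>\<^esup>\<close>, is the sum over \<open>m\<close> of \<open>q\<close>-binomial coefficients times
  \<open>E (i - 1) (2\<alpha> - \<beta> + C m) \<alpha>\<close>: this is the recursion of the vacancy numbers, with the coefficients
  of the fermionic sum. Hence the partial sum is the coefficient of \<open>\<Prod>\<^bsub>a\<^esub> Q\<^bsub>a,1\<^esub>\<^bsup>-1\<^esup>\<close> in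
  \<open>E i (\<alpha> + 1) (\<beta> + 1) Q\<^bsub>i\<^esub>\<^bsup>n\<^sub>i\<^esup> \<dots> Q\<^bsub>1\<^esub>\<^bsup>n\<^sub>1\<^esup>\<close> applied to a vacuum on which the \<open>Q\<^bsub>a,0\<^esub>\<close> act by
  scalars (\<open>vacuum_coeff_Suc\<close>, \<open>vacuum_coeff_unroll\<close>).

  If \<open>\<alpha>\<^sub>a < 0 \<le> \<beta>\<^sub>a\<close>, this operator contains the \<open>Q\<^bsub>a,j\<^esub>\<close>, \<open>j \<ge> 0\<close>, with nonnegative exponents only.
  The coefficient at exponent \<open>-1\<close> of \<open>Q\<^bsub>a,1\<^esub>\<close> therefore vanishes as soon as \<open>Q\<^bsub>a,j\<^esub>\<close> and the
  \<open>Q\<^bsub>b,j\<^esub>\<^bsup>\<plusminus>1\<^esup>\<close> with \<open>b \<noteq> a\<close> never create negative powers of \<open>Q\<^bsub>a,1\<^esub>\<close>. This polynomiality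
  (\<open>polynomiality\<close>) is a form of the Laurent phenomenon. It starts from \<open>Q\<^bsub>a,-1\<^esub>\<close>, which acts as a
  \<open>q\<close>-difference operator that kills the power \<open>0\<close> of \<open>Q\<^bsub>a,1\<^esub>\<close>, and it propagates because
  \<open>Q\<^bsub>a,k+2\<^esub>\<^sup>2 - q\<^sup>y \<Prod>\<^bsub>b\<noteq>a\<^esub> Q\<^bsub>b,k+2\<^esub>\<^bsup>-C(b,a)\<^esup>\<close> is divisible by \<open>Q\<^bsub>a,k+1\<^esub>\<close> (\<open>exchange_step\<close>). Singling
  out one index \<open>a\<close> and allowing denominators in all others is what makes this division explicit:
  up to factors that are invertible, it is a computation in rank one.

  Two devices keep everything algebraic. A central variable \<open>z\<close>, weighted by \<open>i\<close> at level \<open>i\<close>, turns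
  the infinite expansions of negative powers into power series over a ring of operators; its exponent
  in a term of the fermionic sum is \<open>\<Sum> j m\<^bsub>a,j\<^esub>\<close>. The commutation exponents are entries of an
  inverse Cartan matrix, so the computation takes place over \<open>s\<close> with \<open>s\<^sup>4 = q\<close>, and the substitution
  \<open>q \<mapsto> q\<^sup>4\<close> brings the identity back.
\<close>

section \<open>Linear operators and power series over them\<close>

type_synonym wt = "nat \<Rightarrow> int"

text \<open>
  The operators act on series in the variables \<open>Q\<^bsub>a,1\<^esub>\<close>, encoded as functions of the exponent vector.
\<close>

definition linear_op :: "((wt \<Rightarrow> 'k::field) \<Rightarrow> (wt \<Rightarrow> 'k)) \<Rightarrow> bool" where
  "linear_op f \<longleftrightarrow> (\<forall>g h. f (g + h) = f g + f h) \<and> (\<forall>c g. f (\<lambda>\<gamma>. c * g \<gamma>) = (\<lambda>\<gamma>. c * f g \<gamma>))"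

typedef (overloaded) 'k linop = "{f :: (wt \<Rightarrow> 'k::field) \<Rightarrow> (wt \<Rightarrow> 'k). linear_op f}"
  morphisms app Linop
  by (rule exI[of _ "\<lambda>g. g"]) (simp add: linear_op_def)

setup_lifting type_definition_linop

instantiation linop :: (field) ring_1
begin

lift_definition zero_linop :: "'a linop" is "\<lambda>g. 0"
  by (auto simp: linear_op_def)

lift_definition one_linop :: "'a linop" is "\<lambda>g. g"
  by (auto simp: linear_op_def)

lift_definition plus_linop :: "'a linop \<Rightarrow> 'a linop \<Rightarrow> 'a linop" is "\<lambda>A B g. A g + B g"
  by (auto simp: linear_op_def algebra_simps fun_eq_iff)

lift_definition uminus_linop :: "'a linop \<Rightarrow> 'a linop" is "\<lambda>A g. - A g"
  by (auto simp: linear_op_def algebra_simps fun_eq_iff)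

lift_definition minus_linop :: "'a linop \<Rightarrow> 'a linop \<Rightarrow> 'a linop" is "\<lambda>A B g. A g - B g"
  by (auto simp: linear_op_def algebra_simps fun_eq_iff)

lift_definition times_linop :: "'a linop \<Rightarrow> 'a linop \<Rightarrow> 'a linop" is "\<lambda>A B g. A (B g)"
  by (auto simp: linear_op_def)

instance
proof
  show "(0::'a linop) \<noteq> 1"
  proof
    assume "(0::'a linop) = 1"
    then have "app (0::'a linop) (\<lambda>_. 1) = app 1 (\<lambda>_. 1)" by simp
    then show False by (simp add: zero_linop.rep_eq one_linop.rep_eq fun_eq_iff)
  qed
qed (transfer; auto simp: linear_op_def fun_eq_iff algebra_simps; fail)+

end

lemma app_sum: "app (sum A S) g = (\<Sum>x\<in>S. app (A x) g)"
  by (induction S rule: infinite_finite_induct) (simp_all add: zero_linop.rep_eq plus_linop.rep_eq)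

lemma sum_fun_apply: "(\<Sum>x\<in>S. f x) \<gamma> = (\<Sum>x\<in>S. f x \<gamma>)"
  by (induction S rule: infinite_finite_induct) simp_all

lift_definition scalar_op :: "'k::field \<Rightarrow> 'k linop" is "\<lambda>c g \<gamma>. c * g \<gamma>"
  by (auto simp: linear_op_def algebra_simps fun_eq_iff)

text \<open>
  Scalars are central in the ring of power series over the operators. Negative powers of variables
  are expanded in the variable of these series, which is called \<open>z\<close> in comments.
\<close>

definition sc :: "'k::field \<Rightarrow> 'k linop fps" where
  "sc c = fps_const (scalar_op c)"

lemma sc_0 [simp]: "sc (0::'k::field) = 0"
  and sc_1 [simp]: "sc (1::'k) = 1"
  and sc_mult: "sc (c * d :: 'k) = sc c * sc d"
  and sc_add: "sc (c + d :: 'k) = sc c + sc d"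
  and sc_minus: "sc (- c :: 'k) = - sc c"
proof -
  have "scalar_op 0 = (0 :: 'k linop)" "scalar_op 1 = (1 :: 'k linop)"
    "scalar_op (c * d) = scalar_op c * scalar_op d"
    "scalar_op (c + d) = scalar_op c + scalar_op d"
    "scalar_op (- c) = - scalar_op c"
    by (transfer; auto simp: fun_eq_iff algebra_simps)+
  then show "sc (0::'k) = 0" "sc (1::'k) = 1" "sc (c * d) = sc c * sc d" "sc (c + d) = sc c + sc d"
    "sc (- c) = - sc c"
    by (simp_all add: sc_def)
qed

lemma scalar_op_central: "A * scalar_op c = scalar_op c * A"
  by transfer (auto simp: linear_op_def)

lemma sc_central: "f * sc c = sc c * f"
  by (rule fps_ext) (simp add: sc_def scalar_op_central)

lemma sc_left: "f * (sc c * g) = sc c * (f * g)"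
  by (metis sc_central mult.assoc)

lemma sc_sc: "sc c * (sc d * f) = sc (c * d) * f"
  by (simp add: sc_mult mult.assoc)

lemma sc_sum: "sc (sum c S) = (\<Sum>x\<in>S. sc (c x))"
  by (induction S rule: infinite_finite_induct) (simp_all add: sc_add)

lemma app_sc_mult_nth: "app ((sc c * f) $ N) g \<gamma> = c * app (f $ N) g \<gamma>"
  by (simp add: sc_def times_linop.rep_eq scalar_op.rep_eq)

abbreviation zz :: "nat \<Rightarrow> 'k::field linop fps" where
  "zz k \<equiv> fps_X ^ k"

lemma zz_central: "f * zz k = zz k * (f :: 'k::field linop fps)"
  by (induction k) (simp_all add: fps_mult_fps_X_commute[symmetric] mult.assoc flip: power_Suc2, metis fps_mult_fps_X_commute mult.assoc)

lemma zz_left: "f * (zz k * g) = zz k * (f * (g :: 'k::field linop fps))"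
  by (metis zz_central mult.assoc)

lemma zz_nth: "(zz k * f) $ N = (if N < k then 0 else (f :: 'k::field linop fps) $ (N - k))"
  by (rule fps_X_power_mult_nth)

section \<open>Formal sums over vectors of multiplicities\<close>

definition vecs :: "nat set \<Rightarrow> nat \<Rightarrow> (nat \<Rightarrow> nat) set" where
  "vecs I N = {m. (\<forall>b. b \<notin> I \<longrightarrow> m b = 0) \<and> sum m I \<le> N}"

lemma finite_vecs: 
  assumes "finite I"
  shows "finite (vecs I N)"
proof (rule finite_subset)
  show "vecs I N \<subseteq> {m. \<forall>b. (b \<in> I \<longrightarrow> m b \<in> {..N}) \<and> (b \<notin> I \<longrightarrow> m b = 0)}"
  proof (intro subsetI CollectI allI conjI impI)
    fix m b assume m: "m \<in> vecs I N"
    assume b: "b \<in> I"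
    have "m b \<le> sum m I" using b assms by (intro member_le_sum) auto
    then show "m b \<in> {..N}" using m by (simp add: vecs_def)
  qed (simp add: vecs_def)
  show "finite {m :: nat \<Rightarrow> nat. \<forall>b. (b \<in> I \<longrightarrow> m b \<in> {..N}) \<and> (b \<notin> I \<longrightarrow> m b = 0)}"
    using assms by (intro finite_set_of_finite_funs) auto
qed

text \<open>
  The formal sum of \<open>z\<^bsup>w |m|\<^esup> F m\<close> over all vectors \<open>m\<close> of nonnegative integers supported in \<open>I\<close>. For
  \<open>w > 0\<close> each coefficient is a finite sum.
\<close>

definition msum :: "nat set \<Rightarrow> nat \<Rightarrow> ((nat \<Rightarrow> nat) \<Rightarrow> 'k::field linop fps) \<Rightarrow> 'k linop fps" where
  "msum I w F = Abs_fps (\<lambda>N. \<Sum>m\<in>vecs I N. (zz (w * sum m I) * F m) $ N)"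

lemma msum_nth:
  assumes "finite I" "w > 0" "N \<le> K"
  shows "msum I w F $ N = (\<Sum>m\<in>vecs I K. (zz (w * sum m I) * F m) $ N)"
proof -
  have "(zz (w * sum m I) * F m) $ N = 0" if "m \<in> vecs I K - vecs I N" for m
  proof -
    have "sum m I > N" using that by (auto simp: vecs_def)
    moreover have "sum m I \<le> w * sum m I" using assms by simp
    ultimately have "N < w * sum m I" by linarith
    then show ?thesis by (simp add: zz_nth)
  qed
  then show ?thesis
    unfolding msum_def using assms by (simp, intro sum.mono_neutral_left finite_vecs) (auto simp: vecs_def)
qed

lemma mult_msum:
  assumes "finite I" "w > 0"
  shows "G * msum I w F = msum I w (\<lambda>m. G * F m)"
proof (rule fps_ext)
  fix N
  have "(G * msum I w F) $ N = (\<Sum>i=0..N. \<Sum>m\<in>vecs I N. G $ i * (zz (w * sum m I) * F m) $ (N - i))"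
    by (simp add: fps_mult_nth msum_nth[OF assms, where K = N] sum_distrib_left del: fps_X_power_mult_nth)
  also have "\<dots> = (\<Sum>m\<in>vecs I N. \<Sum>i=0..N. G $ i * (zz (w * sum m I) * F m) $ (N - i))"
    by (rule sum.swap)
  also have "\<dots> = (\<Sum>m\<in>vecs I N. (G * (zz (w * sum m I) * F m)) $ N)"
    by (simp only: fps_mult_nth)
  finally show "(G * msum I w F) $ N = msum I w (\<lambda>m. G * F m) $ N"
    by (simp only: msum_nth[OF assms order_refl] zz_left)
qed

lemma msum_mult:
  assumes "finite I" "w > 0"
  shows "msum I w F * G = msum I w (\<lambda>m. F m * G)"
proof (rule fps_ext)
  fix N
  have "(msum I w F * G) $ N = (\<Sum>i=0..N. \<Sum>m\<in>vecs I N. (zz (w * sum m I) * F m) $ i * G $ (N - i))"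
    by (simp add: fps_mult_nth msum_nth[OF assms, where K = N] sum_distrib_right del: fps_X_power_mult_nth)
  also have "\<dots> = (\<Sum>m\<in>vecs I N. \<Sum>i=0..N. (zz (w * sum m I) * F m) $ i * G $ (N - i))"
    by (rule sum.swap)
  also have "\<dots> = (\<Sum>m\<in>vecs I N. ((zz (w * sum m I) * F m) * G) $ N)"
    by (simp only: fps_mult_nth)
  finally show "(msum I w F * G) $ N = msum I w (\<lambda>m. F m * G) $ N"
    by (simp only: msum_nth[OF assms order_refl] mult.assoc)
qed

lemma msum_cong:
  assumes "\<And>m. (\<And>b. b \<notin> I \<Longrightarrow> m b = 0) \<Longrightarrow> F m = G m"
  shows "msum I w F = msum I w G"
  unfolding msum_def by (rule arg_cong[where f = Abs_fps], rule ext, rule sum.cong)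
    (use assms in \<open>auto simp: vecs_def simp del: fps_X_power_mult_nth\<close>)

lemma msum_add:
  assumes "finite I" "w > 0"
  shows "msum I w (\<lambda>m. F m + G m) = msum I w F + msum I w G"
  by (rule fps_ext) (simp add: msum_nth[OF assms order_refl] ring_distribs sum.distrib del: fps_X_power_mult_nth)

lemma msum_finite_support:
  assumes "finite I" "w > 0" "finite S" "\<And>m. m \<notin> S \<Longrightarrow> F m = 0" "\<And>m b. m \<in> S \<Longrightarrow> b \<notin> I \<Longrightarrow> m b = 0"
  shows "msum I w F = (\<Sum>m\<in>S. zz (w * sum m I) * F m)"
proof (rule fps_ext)
  fix N
  define K where "K = max N (Max ((\<lambda>m. sum m I) ` S))"
  have "msum I w F $ N = (\<Sum>m\<in>vecs I K. (zz (w * sum m I) * F m) $ N)"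
    by (rule msum_nth[OF assms(1,2)]) (simp add: K_def)
  also have "\<dots> = (\<Sum>m\<in>S. (zz (w * sum m I) * F m) $ N)"
  proof (rule sum.mono_neutral_right[OF finite_vecs[OF assms(1)]])
    show "S \<subseteq> vecs I K"
      using assms by (auto simp: vecs_def K_def le_max_iff_disj)
  qed (use assms in auto)
  finally show "msum I w F $ N = (\<Sum>m\<in>S. zz (w * sum m I) * F m) $ N"
    by (simp add: fps_sum_nth)
qed

lemma msum_split_zero:
  assumes "finite I" "w > 0"
  shows "msum I w F = F (\<lambda>_. 0) + msum I w (\<lambda>m. if m = (\<lambda>_. 0) then 0 else F m)"
proof -
  have "msum I w F = msum I w (\<lambda>m. (if m = (\<lambda>_. 0) then F m else 0) + (if m = (\<lambda>_. 0) then 0 else F m))"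
    by (rule msum_cong) auto
  also have "\<dots> = msum I w (\<lambda>m. (if m = (\<lambda>_. 0) then F m else 0)) + msum I w (\<lambda>m. if m = (\<lambda>_. 0) then 0 else F m)"
    by (rule msum_add[OF assms])
  also have "msum I w (\<lambda>m. (if m = (\<lambda>_. 0) then F m else 0)) = (\<Sum>m\<in>{\<lambda>_. 0}. zz (w * sum m I) * (if m = (\<lambda>_. 0) then F m else 0))"
    using assms by (intro msum_finite_support) auto
  finally show ?thesis by simp
qed

lemma msum_only_zero:
  assumes "finite I" "w > 0" "\<And>m. m \<noteq> (\<lambda>_. 0) \<Longrightarrow> (\<And>b. b \<notin> I \<Longrightarrow> m b = 0) \<Longrightarrow> F m = 0"
  shows "msum I w F = F (\<lambda>_. 0)"
proof -
  have "msum I w F = msum I w (\<lambda>m. if m = (\<lambda>_. 0) then F m else 0)"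
    using assms(3) by (intro msum_cong) auto
  also have "\<dots> = (\<Sum>m\<in>{\<lambda>_. 0}. zz (w * sum m I) * (if m = (\<lambda>_. 0) then F m else 0))"
    using assms by (intro msum_finite_support) auto
  finally show ?thesis by simp
qed

text \<open>
  Collecting a double sum by \<open>M = m + m'\<close>; the inner coefficient is what a Vandermonde convolution
  evaluates.
\<close>

lemma msum_double:
  assumes "finite I" "w > 0"
  shows "msum I w (\<lambda>m. msum I w (\<lambda>m'. sc (c m m') * G (m + m'))) =
    msum I w (\<lambda>M. sc (\<Sum>m\<in>{m. m \<le> M}. c m (M - m)) * G M)"
proof (rule fps_ext)
  fix N
  have fin: "finite {m. m \<le> M}" if "M \<in> vecs I N" for M
  proof (rule finite_subset[OF _ finite_vecs[OF assms(1)]])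
    show "{m. m \<le> M} \<subseteq> vecs I N"
    proof (safe)
      fix m assume "m \<le> M"
      then have "sum m I \<le> sum M I" by (intro sum_mono) (simp add: le_fun_def)
      moreover have "m b = 0" if "b \<notin> I" for b
        using \<open>m \<le> M\<close> \<open>M \<in> vecs I N\<close> that by (simp add: le_fun_def vecs_def) (metis le_zero_eq)
      ultimately show "m \<in> vecs I N" using \<open>M \<in> vecs I N\<close> by (auto simp: vecs_def)
    qed
  qed
  define h where "h m m' = (zz (w * sum (m + m') I) * (sc (c m m') * G (m + m'))) $ N" for m m'
  have h0: "h m m' = 0" if "sum m I + sum m' I > N" for m m'
  proof -
    have "1 * sum (m + m') I \<le> w * sum (m + m') I" using assms by (intro mult_le_mono1) simp
    moreover have "N < sum (m + m') I" using that by (simp add: sum.distrib)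
    ultimately have "N < w * sum (m + m') I" by (metis less_le_trans mult_1)
    then show ?thesis unfolding h_def zz_nth by simp
  qed
  have "msum I w (\<lambda>m. msum I w (\<lambda>m'. sc (c m m') * G (m + m'))) $ N =
      (\<Sum>m\<in>vecs I N. msum I w (\<lambda>m'. zz (w * sum m I) * (sc (c m m') * G (m + m'))) $ N)"
    by (simp only: msum_nth[OF assms order_refl, of "\<lambda>m. msum I w (\<lambda>m'. sc (c m m') * G (m + m'))"] mult_msum[OF assms])
  also have "\<dots> = (\<Sum>m\<in>vecs I N. \<Sum>m'\<in>vecs I N. h m m')"
  proof (rule sum.cong[OF refl])
    fix m
    have "zz (w * sum m' I) * (zz (w * sum m I) * (sc (c m m') * G (m + m'))) =
        zz (w * sum (m + m') I) * (sc (c m m') * G (m + m'))" for m'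
    proof -
      have "w * sum (m + m') I = w * sum m' I + w * sum m I"
        by (simp add: sum.distrib algebra_simps)
      then show ?thesis by (simp only: power_add mult.assoc)
    qed
    then show "msum I w (\<lambda>m'. zz (w * sum m I) * (sc (c m m') * G (m + m'))) $ N = (\<Sum>m'\<in>vecs I N. h m m')"
      by (simp only: msum_nth[OF assms order_refl] h_def)
  qed
  also have "\<dots> = (\<Sum>x\<in>vecs I N \<times> vecs I N. h (fst x) (snd x))"
    by (simp add: sum.cartesian_product case_prod_beta)
  also have "\<dots> = (\<Sum>x\<in>{x \<in> vecs I N \<times> vecs I N. fst x + snd x \<in> vecs I N}. h (fst x) (snd x))"
  proof (rule sum.mono_neutral_right)
    show "finite (vecs I N \<times> vecs I N)" using finite_vecs[OF assms(1)] by blast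
    show "\<forall>x\<in>vecs I N \<times> vecs I N - {x \<in> vecs I N \<times> vecs I N. fst x + snd x \<in> vecs I N}. h (fst x) (snd x) = 0"
    proof
      fix x assume x: "x \<in> vecs I N \<times> vecs I N - {x \<in> vecs I N \<times> vecs I N. fst x + snd x \<in> vecs I N}"
      then have "fst x \<in> vecs I N" "snd x \<in> vecs I N" "fst x + snd x \<notin> vecs I N" by auto
      then have "sum (fst x) I + sum (snd x) I > N"
        by (auto simp: vecs_def sum.distrib)
      then show "h (fst x) (snd x) = 0" by (rule h0)
    qed
  qed auto
  also have "\<dots> = (\<Sum>x\<in>Sigma (vecs I N) (\<lambda>M. {m. m \<le> M}). h (snd x) (fst x - snd x))"
  proof (rule sum.reindex_bij_witness[of _ "\<lambda>x. (snd x, fst x - snd x)" "\<lambda>x. (fst x + snd x, fst x)"])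
    fix x assume "x \<in> {x \<in> vecs I N \<times> vecs I N. fst x + snd x \<in> vecs I N}"
    then have x: "fst x + snd x \<in> vecs I N" by simp
    have eq: "fst x + snd x - fst x = snd x" by (simp add: fun_eq_iff)
    show "(snd (fst x + snd x, fst x), fst (fst x + snd x, fst x) - snd (fst x + snd x, fst x)) = x"
      by (simp add: eq)
    show "(fst x + snd x, fst x) \<in> Sigma (vecs I N) (\<lambda>M. {m. m \<le> M})"
      using x by (simp add: le_fun_def)
    show "h (snd (fst x + snd x, fst x)) (fst (fst x + snd x, fst x) - snd (fst x + snd x, fst x)) = h (fst x) (snd x)"
      by (simp add: eq)
  next
    fix x assume x: "x \<in> Sigma (vecs I N) (\<lambda>M. {m. m \<le> M})"
    then have le: "snd x \<le> fst x" and M: "fst x \<in> vecs I N" by auto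
    have eq: "snd x + (fst x - snd x) = fst x" using le by (simp add: le_fun_def fun_eq_iff)
    show "(fst (snd x, fst x - snd x) + snd (snd x, fst x - snd x), fst (snd x, fst x - snd x)) = x"
      by (simp add: eq)
    have "sum (snd x) I \<le> sum (fst x) I" "sum (fst x - snd x) I \<le> sum (fst x) I"
      using le by (auto intro!: sum_mono simp: le_fun_def)
    moreover have "snd x b = 0" if "b \<notin> I" for b
      using le M that by (metis (mono_tags, lifting) le_fun_def le_zero_eq mem_Collect_eq vecs_def)
    ultimately show "(snd x, fst x - snd x) \<in> {x \<in> vecs I N \<times> vecs I N. fst x + snd x \<in> vecs I N}"
      using M by (simp add: eq) (simp add: vecs_def)
  qed
  also have "\<dots> = (\<Sum>M\<in>vecs I N. \<Sum>m\<in>{m. m \<le> M}. h m (M - m))"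
    by (subst sum.Sigma) (simp_all add: finite_vecs[OF assms(1)] fin case_prod_beta)
  also have "\<dots> = (\<Sum>M\<in>vecs I N. (zz (w * sum M I) * (sc (\<Sum>m\<in>{m. m \<le> M}. c m (M - m)) * G M)) $ N)"
  proof (rule sum.cong[OF refl])
    fix M
    have "h m (M - m) = (zz (w * sum M I) * (sc (c m (M - m)) * G M)) $ N" if "m \<le> M" for m
    proof -
      have "m + (M - m) = M" using that by (auto simp: le_fun_def fun_eq_iff)
      then show ?thesis by (simp only: h_def)
    qed
    then show "(\<Sum>m\<in>{m. m \<le> M}. h m (M - m)) = (zz (w * sum M I) * (sc (\<Sum>m\<in>{m. m \<le> M}. c m (M - m)) * G M)) $ N"
      by (simp add: sc_sum sum_distrib_left sum_distrib_right fps_sum_nth del: fps_X_power_mult_nth)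
  qed
  finally show "msum I w (\<lambda>m. msum I w (\<lambda>m'. sc (c m m') * G (m + m'))) $ N =
    msum I w (\<lambda>M. sc (\<Sum>m\<in>{m. m \<le> M}. c m (M - m)) * G M) $ N"
    by (simp only: msum_nth[OF assms order_refl])
qed

section \<open>Symmetric q-binomial coefficients\<close>

definition qint :: "'k::field \<Rightarrow> int \<Rightarrow> 'k" where
  "qint v k = v powi k - v powi (- k)"

text \<open>
  With \<open>v\<^sup>2 = q\<close> this is, up to a power of \<open>v\<close>, the \<open>q\<close>-binomial coefficient of \<open>m + x - 1\<close> over \<open>m\<close>,
  that is, the coefficient of \<open>X\<^sup>m\<close> in the \<open>q\<close>-analogue of \<open>(1 - X)\<^bsup>-x\<^esup>\<close>, for every integer \<open>x\<close>. The
  normalization makes it invariant under \<open>v \<mapsto> v\<^bsup>-1\<^esup>\<close>.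
\<close>

definition qbin :: "'k::field \<Rightarrow> nat \<Rightarrow> int \<Rightarrow> 'k" where
  "qbin v m x = (\<Prod>j=1..m. qint v (x - 1 + int j) / qint v (int j))"

lemma qbin_0 [simp]: "qbin v 0 x = 1"
  by (simp add: qbin_def)

lemma qbin_Suc: "qbin v (Suc m) x = qbin v m x * (qint v (x + int m) / qint v (int (Suc m)))"
  by (simp add: qbin_def add.commute)

lemma qint_0 [simp]: "qint v 0 = 0"
  by (simp add: qint_def)

lemma qint_uminus: "qint v (- k) = - qint v k"
  by (simp add: qint_def)

lemma qbin_eq_0:
  assumes "x \<le> 0" "int m > - x"
  shows "qbin v m x = 0"
proof -
  have "nat (1 - x) \<in> {1..m}" using assms by auto
  moreover have "qint v (x - 1 + int (nat (1 - x))) / qint v (int (nat (1 - x))) = 0"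
    using assms by simp
  ultimately have "\<exists>j\<in>{1..m}. qint v (x - 1 + int j) / qint v (int j) = 0"
    by (rule bexI[rotated])
  then show ?thesis unfolding qbin_def by (intro prod_zero) auto
qed

locale generic_element =
  fixes v :: "'k::field"
  assumes nonzero: "v \<noteq> 0" and not_root: "\<And>k. k > 0 \<Longrightarrow> v ^ k \<noteq> 1"
begin

lemma qint_nonzero:
  assumes "k > 0"
  shows "qint v (int k) \<noteq> 0"
proof
  assume "qint v (int k) = 0"
  then have "v powi int k * v powi int k = v powi (- int k) * v powi int k"
    by (simp add: qint_def)
  then have "v ^ (k + k) = 1"
    using nonzero by (simp add: power_int_minus power_add)
  then show False using not_root[of "k + k"] assms by simp
qed

lemma qint_add: "qint v (x + y) = qint v x * v powi y + v powi (- x) * qint v y"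
proof -
  have "v powi (x + y) = v powi x * v powi y" "v powi (- (x + y)) = v powi (- x) * v powi (- y)"
    using nonzero power_int_add[of v x y] power_int_add[of v "- x" "- y"] by simp_all
  then show ?thesis unfolding qint_def by (simp only:) (simp add: algebra_simps)
qed

lemma qbin_step: "qint v (int (Suc m)) * qbin v (Suc m) x = qint v (x + int m) * qbin v m x"
  using qint_nonzero[of "Suc m"] by (simp add: qbin_Suc del: of_nat_Suc)

lemma qbin_one: "qbin v m 1 = 1"
  using qint_nonzero by (simp add: qbin_def)

lemma qbin_minus_one: "qbin v m (- 1) = (if m = 0 then 1 else if m = 1 then - 1 else 0)"
  using qint_nonzero[of 1] qint_uminus[of v 1] qbin_eq_0[of "-1" m v] by (auto simp: qbin_def)

text \<open>
  This is \<open>(1 - X)\<^bsup>-x\<^esup> (1 - X)\<^bsup>-y\<^esup> = (1 - X)\<^bsup>-x-y\<^esup>\<close> for \<open>q\<close>-analogues. Both sides satisfy the recursion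
  of \<open>qbin_step\<close> in \<open>M\<close>: splitting \<open>[M]\<close> as \<open>[m + m']\<close> by \<open>qint_add\<close> lowers one of the two factors,
  and the two contributions recombine to \<open>[x + y + M - 1]\<close> by the same rule.
\<close>

lemma qbin_vandermonde:
  "(\<Sum>m\<le>M. qbin v m x * qbin v (M - m) y * v powi (int m * y - int (M - m) * x)) = qbin v M (x + y)"
proof (induction M)
  case (Suc M)
  let ?f = "\<lambda>m m'. v powi (int m * y - int m' * x)"
  let ?S = "\<Sum>m\<le>Suc M. qbin v m x * qbin v (Suc M - m) y * ?f m (Suc M - m)"
  let ?A = "\<lambda>m m'. qbin v m x * qbin v m' y * ?f m m'"
  have split: "qint v (int (Suc M)) = qint v (int m) * v powi int (Suc M - m) + v powi (- int m) * qint v (int (Suc M - m))"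
    if "m \<le> Suc M" for m
    using qint_add[of "int m" "int (Suc M - m)"] that by (simp add: of_nat_diff del: of_nat_Suc)
  have "qint v (int (Suc M)) * ?S = (\<Sum>m\<le>Suc M. qint v (int (Suc M)) * ?A m (Suc M - m))"
    by (simp add: sum_distrib_left del: sum.atMost_Suc of_nat_Suc)
  also have "\<dots> = (\<Sum>m\<le>Suc M. qint v (int m) * v powi int (Suc M - m) * ?A m (Suc M - m)) +
      (\<Sum>m\<le>Suc M. v powi (- int m) * qint v (int (Suc M - m)) * ?A m (Suc M - m))"
    unfolding sum.distrib[symmetric] by (rule sum.cong[OF refl]) (simp only: atMost_iff split distrib_right)
  also have "(\<Sum>m\<le>Suc M. qint v (int m) * v powi int (Suc M - m) * ?A m (Suc M - m)) =
      (\<Sum>m\<le>M. qint v (int (Suc m)) * v powi int (M - m) * ?A (Suc m) (M - m))"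
    by (subst sum.atMost_Suc_shift) simp
  also have "\<dots> = (\<Sum>m\<le>M. ?A m (M - m) * (qint v (x + int m) * v powi (int (M - m) + y)))"
  proof (rule sum.cong[OF refl])
    fix m
    have "?f (Suc m) (M - m) = v powi y * ?f m (M - m)"
      using nonzero by (simp add: power_int_add[symmetric] algebra_simps)
    then have "qint v (int (Suc m)) * v powi int (M - m) * ?A (Suc m) (M - m) =
      (qint v (int (Suc m)) * qbin v (Suc m) x) * v powi int (M - m) * qbin v (M - m) y * (v powi y * ?f m (M - m))"
      by (simp add: mult_ac)
    also have "\<dots> = ?A m (M - m) * (qint v (x + int m) * v powi (int (M - m) + y))"
      using nonzero by (simp only: qbin_step) (simp add: power_int_add mult_ac)
    finally show "qint v (int (Suc m)) * v powi int (M - m) * ?A (Suc m) (M - m) =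
      ?A m (M - m) * (qint v (x + int m) * v powi (int (M - m) + y))" .
  qed
  also have "(\<Sum>m\<le>Suc M. v powi (- int m) * qint v (int (Suc M - m)) * ?A m (Suc M - m)) =
      (\<Sum>m\<le>M. v powi (- int m) * qint v (int (Suc (M - m))) * ?A m (Suc (M - m)))"
    by (simp only: sum.atMost_Suc[of _ M] diff_self_eq_0 of_nat_0 qint_0 mult_zero_right mult_zero_left add_0_right)
      (rule sum.cong[OF refl], simp only: atMost_iff Suc_diff_le)
  also have "\<dots> = (\<Sum>m\<le>M. ?A m (M - m) * (v powi (- (x + int m)) * qint v (int (M - m) + y)))"
  proof (rule sum.cong[OF refl])
    fix m
    have "?f m (Suc (M - m)) = v powi (- x) * ?f m (M - m)"
      using nonzero by (simp add: power_int_add[symmetric] algebra_simps)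
    then have "v powi (- int m) * qint v (int (Suc (M - m))) * ?A m (Suc (M - m)) =
      (qint v (int (Suc (M - m))) * qbin v (Suc (M - m)) y) * qbin v m x * v powi (- int m) * (v powi (- x) * ?f m (M - m))"
      by (simp add: mult_ac)
    also have "\<dots> = ?A m (M - m) * (v powi (- x + - int m) * qint v (int (M - m) + y))"
    proof -
      have "v powi (- x + - int m) = v powi (- x) * v powi (- int m)"
        using nonzero by (intro power_int_add) simp
      then show ?thesis by (simp only: qbin_step) (simp add: mult_ac add.commute)
    qed
    finally show "v powi (- int m) * qint v (int (Suc (M - m))) * ?A m (Suc (M - m)) =
      ?A m (M - m) * (v powi (- (x + int m)) * qint v (int (M - m) + y))" by simp
  qed
  also have "(\<Sum>m\<le>M. ?A m (M - m) * (qint v (x + int m) * v powi (int (M - m) + y))) +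
      (\<Sum>m\<le>M. ?A m (M - m) * (v powi (- (x + int m)) * qint v (int (M - m) + y))) =
      (\<Sum>m\<le>M. ?A m (M - m) * qint v (x + y + int M))"
    unfolding sum.distrib[symmetric] distrib_left[symmetric] qint_add[symmetric]
    by (rule sum.cong[OF refl]) (simp add: of_nat_diff algebra_simps)
  also have "\<dots> = qbin v M (x + y) * qint v (x + y + int M)"
    by (simp only: Suc.IH sum_distrib_right[symmetric])
  also have "\<dots> = qint v (int (Suc M)) * qbin v (Suc M) (x + y)"
    by (simp only: qbin_step mult.commute)
  finally show ?case
    using qint_nonzero[of "Suc M"] by (simp only: mult_cancel_left) blast
qed simp

end

lemma prod_sum_le_fun:
  fixes f :: "nat \<Rightarrow> nat \<Rightarrow> 'k::comm_ring_1"
  assumes "finite I" "\<And>b. b \<notin> I \<Longrightarrow> M b = (0::nat)"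
  shows "(\<Prod>b\<in>I. \<Sum>k\<le>M b. f b k) = (\<Sum>m\<in>{m. m \<le> M}. \<Prod>b\<in>I. f b (m b))"
proof -
  have "(\<Prod>b\<in>I. \<Sum>k\<le>M b. f b k) = (\<Sum>g\<in>PiE I (\<lambda>b. {..M b}). \<Prod>b\<in>I. f b (g b))"
    using assms by (intro prod_sum_PiE) auto
  also have "\<dots> = (\<Sum>m\<in>{m. m \<le> M}. \<Prod>b\<in>I. f b (m b))"
  proof (rule sum.reindex_bij_witness[of _ "\<lambda>m. restrict m I" "\<lambda>g b. if b \<in> I then g b else 0"])
    fix m assume m: "m \<in> {m. m \<le> M}"
    then have z: "m b = 0" if "b \<notin> I" for b
      using assms(2)[OF that] by (simp add: le_fun_def) (metis le_zero_eq)
    show "(\<lambda>b. if b \<in> I then restrict m I b else 0) = m" using z by (auto simp: fun_eq_iff)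
    show "restrict m I \<in> PiE I (\<lambda>b. {..M b})" using m by (auto simp: le_fun_def)
  next
    fix g assume g: "g \<in> PiE I (\<lambda>b. {..M b})"
    then show "restrict (\<lambda>b. if b \<in> I then g b else 0) I = g" by (auto simp: fun_eq_iff PiE_def extensional_def)
    show "(\<lambda>b. if b \<in> I then g b else 0) \<in> {m. m \<le> M}" using g by (auto simp: le_fun_def)
  qed auto
  finally show ?thesis .
qed

section \<open>The quantum Q-system\<close>

lift_definition wshift :: "(wt \<Rightarrow> 'k::field) \<Rightarrow> wt \<Rightarrow> 'k linop" is
  "\<lambda>c \<alpha> g \<gamma>. c \<gamma> * g (\<gamma> + \<alpha>)"
  by (auto simp: linear_op_def algebra_simps fun_eq_iff)

lemma wshift_mult: "wshift c \<alpha> * wshift c' \<alpha>' = wshift (\<lambda>\<gamma>. c \<gamma> * c' (\<gamma> + \<alpha>)) (\<alpha> + \<alpha>')"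
  by transfer (simp add: fun_eq_iff algebra_simps)

lemma scalar_wshift: "scalar_op c * wshift c' \<alpha> = wshift (\<lambda>\<gamma>. c * c' \<gamma>) \<alpha>"
  by transfer (simp add: fun_eq_iff algebra_simps)

locale qsystem =
  fixes I :: "nat set" and C L :: "nat \<Rightarrow> nat \<Rightarrow> int" and d :: "nat \<Rightarrow> int" and s :: "'k::field"
  assumes fin: "finite I"
    and C_diag: "a \<in> I \<Longrightarrow> C a a = 2"
    and C_nonpos: "a \<noteq> b \<Longrightarrow> C a b \<le> 0"
    and C_zero: "C a b = 0 \<Longrightarrow> C b a = 0"
    and C_outside: "a \<notin> I \<or> b \<notin> I \<Longrightarrow> C a b = 0"
    and L_sym: "L a b = L b a"
    and C_L: "a \<in> I \<Longrightarrow> b \<in> I \<Longrightarrow> (\<Sum>c\<in>I. C c a * L c b) = (if a = b then d a else 0)"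
    and d_pos: "a \<in> I \<Longrightarrow> d a > 0"
    and s_nonzero: "s \<noteq> 0" and s_generic: "k > 0 \<Longrightarrow> s ^ k \<noteq> 1"
begin

text \<open>
  In the application \<open>L = 2 t C\<^bsup>-1\<^esup>\<close> and \<open>d = 2 t\<close>, and \<open>v a\<^sup>2 = s\<^bsup>4 t(a)\<^esup>\<close> is the \<open>q\<^sub>a\<close> of the fermionic
  sums.
\<close>

abbreviation v :: "nat \<Rightarrow> 'k" where
  "v a \<equiv> s powi d a"

lemma generic_v: "a \<in> I \<Longrightarrow> generic_element (v a)"
proof (unfold_locales, goal_cases)
  case (2 k)
  have "v a ^ k = s ^ (nat (d a) * k)"
    using d_pos[OF 2(1)] by (simp add: power_mult power_int_def)
  then show ?case using s_generic[of "nat (d a) * k"] d_pos[OF 2(1)] 2 by simp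
qed (use s_nonzero in simp)

lemma powi_add: "s powi (x + y) = s powi x * s powi y"
  using s_nonzero by (simp add: power_int_add)

definition lam :: "wt \<Rightarrow> wt \<Rightarrow> int" where
  "lam \<alpha> \<beta> = (\<Sum>a\<in>I. \<Sum>b\<in>I. L a b * \<alpha> a * \<beta> b)"

lemma lam_add_left: "lam (\<alpha> + \<alpha>') \<beta> = lam \<alpha> \<beta> + lam \<alpha>' \<beta>"
  and lam_add_right: "lam \<alpha> (\<beta> + \<beta>') = lam \<alpha> \<beta> + lam \<alpha> \<beta>'"
  and lam_diff_left: "lam (\<alpha> - \<alpha>') \<beta> = lam \<alpha> \<beta> - lam \<alpha>' \<beta>"
  and lam_diff_right: "lam \<alpha> (\<beta> - \<beta>') = lam \<alpha> \<beta> - lam \<alpha> \<beta>'"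
  and lam_minus_left: "lam (- \<alpha>) \<beta> = - lam \<alpha> \<beta>"
  and lam_minus_right: "lam \<alpha> (- \<beta>) = - lam \<alpha> \<beta>"
  and lam_zero_left: "lam 0 \<beta> = 0"
  and lam_zero_right: "lam \<alpha> 0 = 0"
  by (simp_all add: lam_def algebra_simps sum.distrib sum_subtractf sum_negf)

lemma lam_sym: "lam \<alpha> \<beta> = lam \<beta> \<alpha>"
  unfolding lam_def by (subst sum.swap) (simp add: L_sym mult_ac)

lemmas lam_simps = lam_add_left lam_add_right lam_diff_left lam_diff_right lam_minus_left
  lam_minus_right lam_zero_left lam_zero_right

text \<open>
  The commutation exponent of two monomials with exponents \<open>(\<alpha>, \<beta>)\<close> and \<open>(\<alpha>', \<beta>')\<close>. It is preserved
  by \<open>(\<alpha>, \<beta>) \<mapsto> (2\<alpha> - \<beta>, \<alpha>)\<close>, the change of exponents from one level to the next.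
\<close>

definition om :: "wt \<Rightarrow> wt \<Rightarrow> wt \<Rightarrow> wt \<Rightarrow> int" where
  "om \<alpha> \<beta> \<alpha>' \<beta>' = lam \<alpha> \<beta>' - lam \<beta> \<alpha>'"

definition Cv :: "(nat \<Rightarrow> nat) \<Rightarrow> wt" where
  "Cv m = (\<lambda>b. \<Sum>c\<in>I. C b c * int (m c))"

lemma Cv_add: "Cv (m + m') = Cv m + Cv m'"
  by (simp add: Cv_def fun_eq_iff algebra_simps sum.distrib)

lemma Cv_zero [simp]: "Cv (\<lambda>_. 0) = 0"
  by (simp add: Cv_def fun_eq_iff)

lemma lam_Cv: "lam (Cv m) \<beta> = (\<Sum>a\<in>I. d a * int (m a) * \<beta> a)"
proof -
  have "lam (Cv m) \<beta> = (\<Sum>b\<in>I. \<Sum>b'\<in>I. \<Sum>c\<in>I. int (m c) * \<beta> b' * (C b c * L b b'))"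
    by (simp add: lam_def Cv_def sum_distrib_left sum_distrib_right mult_ac)
  also have "\<dots> = (\<Sum>b\<in>I. \<Sum>c\<in>I. \<Sum>b'\<in>I. int (m c) * \<beta> b' * (C b c * L b b'))"
    by (rule sum.cong[OF refl], rule sum.swap)
  also have "\<dots> = (\<Sum>c\<in>I. \<Sum>b\<in>I. \<Sum>b'\<in>I. int (m c) * \<beta> b' * (C b c * L b b'))"
    by (rule sum.swap)
  also have "\<dots> = (\<Sum>c\<in>I. \<Sum>b'\<in>I. \<Sum>b\<in>I. int (m c) * \<beta> b' * (C b c * L b b'))"
    by (rule sum.cong[OF refl], rule sum.swap)
  also have "\<dots> = (\<Sum>c\<in>I. \<Sum>b'\<in>I. int (m c) * \<beta> b' * (if c = b' then d c else 0))"
    by (intro sum.cong refl) (simp add: C_L sum_distrib_left[symmetric])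
  also have "\<dots> = (\<Sum>c\<in>I. d c * int (m c) * \<beta> c)"
  proof (rule sum.cong[OF refl])
    fix c assume "c \<in> I"
    then show "(\<Sum>b'\<in>I. int (m c) * \<beta> b' * (if c = b' then d c else 0)) = d c * int (m c) * \<beta> c"
      using fin by (simp add: if_distrib[of "\<lambda>x. _ * x"] sum.delta' mult_ac cong: if_cong)
  qed
  finally show ?thesis .
qed

lemma lam_Cv_right: "lam \<beta> (Cv m) = (\<Sum>a\<in>I. d a * int (m a) * \<beta> a)"
  using lam_Cv lam_sym by metis

abbreviation qbins :: "(nat \<Rightarrow> nat) \<Rightarrow> wt \<Rightarrow> 'k" where
  "qbins m \<alpha> \<equiv> (\<Prod>b\<in>I. qbin (v b) (m b) (\<alpha> b))"

text \<open>
  \<open>E i \<alpha> \<beta>\<close> is the symmetrically ordered monomial \<open>\<Prod>\<^bsub>a\<^esub> Q\<^bsub>a,i\<^esub>\<^bsup>\<beta>(a)\<^esup> Q\<^bsub>a,i+1\<^esub>\<^bsup>-\<alpha>(a)\<^esup>\<close>. At level \<open>0\<close>,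
  \<open>Q\<^bsub>a,1\<^esub>\<close> shifts \<open>\<gamma>\<close> and \<open>Q\<^bsub>a,0\<^esub>\<close> rescales by a power of \<open>s\<close> linear in \<open>\<gamma>\<close>; the summand \<open>1\<close> in that
  exponent fixes the eigenvalues of \<open>Q\<^bsub>a,0\<^esub>\<close> on the vacuum. The recursion is the \<open>q\<close>-binomial expansion
  of the powers of \<open>Q\<^bsub>a,i+2\<^esub> = Q\<^bsub>a,i\<^esub>\<^bsup>-1\<^esup> Q\<^bsub>a,i+1\<^esub>\<^sup>2 (1 - z\<^bsup>i+1\<^esup> \<Prod>\<^bsub>b\<^esub> Q\<^bsub>b,i+1\<^esub>\<^bsup>-C(b,a)\<^esup>)\<close> in the variables of
  level \<open>i\<close>, up to powers of \<open>s\<close>.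
\<close>

primrec E :: "nat \<Rightarrow> wt \<Rightarrow> wt \<Rightarrow> 'k linop fps" where
  "E 0 = (\<lambda>\<alpha> \<beta>. fps_const (wshift (\<lambda>\<gamma>. s powi lam \<beta> (\<gamma> + \<gamma> + \<alpha> + 1)) \<alpha>))"
| "E (Suc i) = (\<lambda>\<alpha> \<beta>. msum I (Suc i) (\<lambda>m. sc (qbins m \<alpha>) * E i (\<alpha> + \<alpha> - \<beta> + Cv m) \<alpha>))"

lemma E_0: "E 0 \<alpha> \<beta> = fps_const (wshift (\<lambda>\<gamma>. s powi lam \<beta> (\<gamma> + \<gamma> + \<alpha> + 1)) \<alpha>)"
  and E_Suc: "E (Suc i) \<alpha> \<beta> = msum I (Suc i) (\<lambda>m. sc (qbins m \<alpha>) * E i (\<alpha> + \<alpha> - \<beta> + Cv m) \<alpha>)"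
  by simp_all

declare E.simps [simp del]

lemma qbins_vandermonde:
  assumes "\<And>b. b \<notin> I \<Longrightarrow> M b = 0"
  shows "(\<Sum>m\<in>{m. m \<le> M}. qbins m \<alpha> * qbins (M - m) \<alpha>' * s powi (lam (Cv m) \<alpha>' - lam \<alpha> (Cv (M - m))))
    = qbins M (\<alpha> + \<alpha>')"
proof -
  have prod_le: "(\<Prod>b\<in>I. \<Sum>k\<le>M b. f b k) = (\<Sum>m\<in>{m. m \<le> M}. \<Prod>b\<in>I. f b (m b))"
    for f :: "nat \<Rightarrow> nat \<Rightarrow> 'k"
    by (rule prod_sum_le_fun[OF fin]) (rule assms)
  have "qbins m \<alpha> * qbins (M - m) \<alpha>' * s powi (lam (Cv m) \<alpha>' - lam \<alpha> (Cv (M - m))) =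
    (\<Prod>b\<in>I. qbin (v b) (m b) (\<alpha> b) * qbin (v b) (M b - m b) (\<alpha>' b) *
        v b powi (int (m b) * \<alpha>' b - int (M b - m b) * \<alpha> b))" for m
  proof -
    have M: "(M - m) b = M b - m b" for b by simp
    have "s powi (lam (Cv m) \<alpha>' - lam \<alpha> (Cv (M - m))) =
        s powi (\<Sum>b\<in>I. d b * (int (m b) * \<alpha>' b - int (M b - m b) * \<alpha> b))"
      unfolding lam_Cv lam_Cv_right sum_subtractf[symmetric] M
      by (rule arg_cong[of _ _ "\<lambda>x. s powi x"], rule sum.cong[OF refl]) (simp only: right_diff_distrib mult.assoc)
    also have "\<dots> = (\<Prod>b\<in>I. v b powi (int (m b) * \<alpha>' b - int (M b - m b) * \<alpha> b))"
      using fin s_nonzero by (induction I rule: finite_induct) (simp_all add: power_int_add power_int_mult)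
    finally show ?thesis by (simp only: prod.distrib M)
  qed
  then have "(\<Sum>m\<in>{m. m \<le> M}. qbins m \<alpha> * qbins (M - m) \<alpha>' * s powi (lam (Cv m) \<alpha>' - lam \<alpha> (Cv (M - m)))) =
     (\<Prod>b\<in>I. \<Sum>k\<le>M b. qbin (v b) k (\<alpha> b) * qbin (v b) (M b - k) (\<alpha>' b) *
        v b powi (int k * \<alpha>' b - int (M b - k) * \<alpha> b))"
    by (simp only: prod_le)
  also have "\<dots> = qbins M (\<alpha> + \<alpha>')"
    by (rule prod.cong[OF refl]) (simp only: generic_element.qbin_vandermonde[OF generic_v] plus_fun_apply)
  finally show ?thesis .
qed

text \<open>
  By induction on the level. The factors \<open>s\<^bsup>om\<^esup>\<close> that arise from reordering are those of the
  Vandermonde convolution times the commutation factor of the leading terms, which does not depend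
  on the level.
\<close>

theorem E_mult: "E i \<alpha> \<beta> * E i \<alpha>' \<beta>' = sc (s powi om \<alpha> \<beta> \<alpha>' \<beta>') * E i (\<alpha> + \<alpha>') (\<beta> + \<beta>')"
proof (induction i arbitrary: \<alpha> \<beta> \<alpha>' \<beta>')
  case 0
  have "lam \<beta> (\<gamma> + \<gamma> + \<alpha> + 1) + lam \<beta>' (\<gamma> + \<alpha> + (\<gamma> + \<alpha>) + \<alpha>' + 1) =
    om \<alpha> \<beta> \<alpha>' \<beta>' + lam (\<beta> + \<beta>') (\<gamma> + \<gamma> + (\<alpha> + \<alpha>') + 1)" for \<gamma>
    unfolding om_def lam_simps using lam_sym[of \<beta>' \<alpha>] by simp
  then have "s powi lam \<beta> (\<gamma> + \<gamma> + \<alpha> + 1) * s powi lam \<beta>' (\<gamma> + \<alpha> + (\<gamma> + \<alpha>) + \<alpha>' + 1) =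
    s powi om \<alpha> \<beta> \<alpha>' \<beta>' * s powi lam (\<beta> + \<beta>') (\<gamma> + \<gamma> + (\<alpha> + \<alpha>') + 1)" for \<gamma>
    by (metis powi_add)
  then show ?case
    by (simp only: E_0 sc_def fps_const_mult wshift_mult scalar_wshift)
next
  case (Suc i)
  let ?F = "\<lambda>\<alpha> \<beta> m. sc (qbins m \<alpha>) * E i (\<alpha> + \<alpha> - \<beta> + Cv m) \<alpha>"
  let ?G = "\<lambda>M. E i ((\<alpha> + \<alpha>') + (\<alpha> + \<alpha>') - (\<beta> + \<beta>') + Cv M) (\<alpha> + \<alpha>')"
  let ?c = "\<lambda>m m'. qbins m \<alpha> * qbins m' \<alpha>' * s powi (lam (Cv m) \<alpha>' - lam \<alpha> (Cv m'))"
  have "?F \<alpha> \<beta> m * ?F \<alpha>' \<beta>' m' = sc (s powi om \<alpha> \<beta> \<alpha>' \<beta>') * (sc (?c m m') * ?G (m + m'))" for m m'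
  proof -
    have om: "om (\<alpha> + \<alpha> - \<beta> + Cv m) \<alpha> (\<alpha>' + \<alpha>' - \<beta>' + Cv m') \<alpha>' = om \<alpha> \<beta> \<alpha>' \<beta>' + (lam (Cv m) \<alpha>' - lam \<alpha> (Cv m'))"
      unfolding om_def lam_simps by simp
    have eq: "\<alpha> + \<alpha> - \<beta> + Cv m + (\<alpha>' + \<alpha>' - \<beta>' + Cv m') = \<alpha> + \<alpha>' + (\<alpha> + \<alpha>') - (\<beta> + \<beta>') + Cv (m + m')"
      unfolding Cv_add by (simp only: diff_conv_add_uminus minus_add_distrib ac_simps)
    have "?F \<alpha> \<beta> m * ?F \<alpha>' \<beta>' m' = sc (qbins m \<alpha>) * (sc (qbins m' \<alpha>') *
        (E i (\<alpha> + \<alpha> - \<beta> + Cv m) \<alpha> * E i (\<alpha>' + \<alpha>' - \<beta>' + Cv m') \<alpha>'))"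
      unfolding mult.assoc by (subst sc_left) (rule refl)
    also have "\<dots> = sc (qbins m \<alpha> * (qbins m' \<alpha>' * (s powi om \<alpha> \<beta> \<alpha>' \<beta>' * s powi (lam (Cv m) \<alpha>' - lam \<alpha> (Cv m'))))) * ?G (m + m')"
      by (simp only: Suc.IH om eq sc_sc powi_add)
    also have "\<dots> = sc (s powi om \<alpha> \<beta> \<alpha>' \<beta>') * (sc (?c m m') * ?G (m + m'))"
      unfolding sc_sc by (rule arg_cong2[where f = "\<lambda>x y. sc x * y", OF _ refl]) (simp only: mult_ac)
    finally show ?thesis .
  qed
  note FF = this
  have "E (Suc i) \<alpha> \<beta> * E (Suc i) \<alpha>' \<beta>' = msum I (Suc i) (\<lambda>m. ?F \<alpha> \<beta> m * E (Suc i) \<alpha>' \<beta>')"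
    unfolding E_Suc[of i \<alpha> \<beta>] by (rule msum_mult[OF fin zero_less_Suc])
  also have "\<dots> = msum I (Suc i) (\<lambda>m. msum I (Suc i) (\<lambda>m'. ?F \<alpha> \<beta> m * ?F \<alpha>' \<beta>' m'))"
    by (simp only: E_Suc[of i \<alpha>' \<beta>'] mult_msum[OF fin zero_less_Suc])
  also have "\<dots> = sc (s powi om \<alpha> \<beta> \<alpha>' \<beta>') * msum I (Suc i) (\<lambda>m. msum I (Suc i) (\<lambda>m'. sc (?c m m') * ?G (m + m')))"
    by (simp only: FF mult_msum[OF fin zero_less_Suc])
  also have "msum I (Suc i) (\<lambda>m. msum I (Suc i) (\<lambda>m'. sc (?c m m') * ?G (m + m'))) =
    msum I (Suc i) (\<lambda>M. sc (\<Sum>m\<in>{m. m \<le> M}. ?c m (M - m)) * ?G M)"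
    by (rule msum_double[OF fin]) simp
  also have "\<dots> = msum I (Suc i) (\<lambda>M. sc (qbins M (\<alpha> + \<alpha>')) * ?G M)"
    by (rule msum_cong, rule arg_cong2[where f = "\<lambda>x y. sc x * y", OF _ refl], rule qbins_vandermonde)
  finally show ?case by (simp only: E_Suc)
qed

end

section \<open>Polynomiality of the cluster variables\<close>

lemma zz_sc: "zz k * (sc c * f) = sc c * (zz k * f)"
  by (rule sc_left)

lemma zz_zz: "zz k * (zz j * f) = zz (k + j) * (f :: 'k::field linop fps)"
  by (simp add: power_add mult.assoc)

text \<open>
  The division that carries polynomiality on. Here \<open>x\<^sub>0, x\<^sub>1, x\<^sub>2\<close> are \<open>Q\<^bsub>a,k\<^esub>, Q\<^bsub>a,k+1\<^esub>, Q\<^bsub>a,k+2\<^esub>\<close>, \<open>Y\<close> is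
  \<open>Q\<^bsub>a,k-1\<^esub>\<close>, and \<open>T\<^sub>j\<close> is \<open>\<Prod>\<^bsub>b\<noteq>a\<^esub> Q\<^bsub>b,k+j\<^esub>\<^bsup>-C(b,a)\<^esup>\<close>. Modulo left multiples of \<open>x\<^sub>1\<close> and up
  to central factors, the exchange relation A replaces \<open>T\<^sub>0\<close> by \<open>x\<^sub>0\<^sup>2\<close>, C replaces \<open>x\<^sub>0 x\<^sub>2\<close> by \<open>-T\<^sub>1\<close>, and F replaces \<open>T\<^sub>0 T\<^sub>2\<close> by \<open>T\<^sub>1\<^sup>2\<close>, so that
  \<open>T\<^sub>0 x\<^sub>2\<^sup>2\<close> and \<open>T\<^sub>0 T\<^sub>2\<close> cancel. The condition on the scalars says that the powers of \<open>q\<close> match.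
\<close>

lemma exchange_step:
  fixes x0 x1 x2 T0 T1 T2 Y e :: "'k::field linop fps"
  assumes A: "Y * x1 = sc l * (x0 * x0) - sc (l * c) * (zz k * T0)"
    and B: "x1 * x2 = sc l * (x2 * x1)"
    and C: "x0 * x2 = sc l * (x1 * x1) - sc (l * c) * (zz (Suc k) * T1)"
    and D: "T1 * x2 = sc g * (x2 * T1)"
    and E: "x1 * T1 = T1 * x1"
    and F: "T0 * T2 = sc f * (T1 * T1) + e * x1"
    and scalars: "c2 * f = l * l * g * c"
  shows "sc (l * c) * (zz k * (T0 * (x2 * x2 - sc c2 * (zz (Suc (Suc k)) * T2)))) =
    (sc (l ^ 4) * (x0 * (x2 * x1)) - sc (l ^ 3 * g * c) * (zz (Suc k) * (T1 * x1))
      - sc (l ^ 2) * (Y * (x2 * x2)) - sc (l * c * c2) * (zz (k + Suc (Suc k)) * e)) * x1"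
proof -
  have B': "x1 * (x2 * y) = sc l * (x2 * (x1 * y))" for y
    using B by (metis mult.assoc)
  have C': "x0 * (x2 * y) = sc l * (x1 * (x1 * y)) - sc (l * c) * (zz (Suc k) * (T1 * y))" for y
    using arg_cong[OF C, of "\<lambda>u. u * y"] by (simp add: mult.assoc left_diff_distrib)
  have D': "T1 * (x2 * y) = sc g * (x2 * (T1 * y))" for y
    using D by (metis mult.assoc)
  have E': "x1 * (T1 * y) = T1 * (x1 * y)" for y
    using E by (metis mult.assoc)
  note sc1 = sc_left[of x0] sc_left[of x1] sc_left[of x2] sc_left[of T0] sc_left[of T1] sc_left[of Y]
  note zz1 = zz_left[of x0] zz_left[of x1] zz_left[of x2] zz_left[of T0] zz_left[of T1] zz_left[of Y]
  note nf = mult.assoc left_diff_distrib right_diff_distrib sc1 zz1 zz_sc sc_sc zz_zz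
  have xx: "x1 * (x2 * x2) = sc (l * l) * (x2 * (x2 * x1))"
    by (simp only: B B' nf)
  have w: "x0 * (x0 * (x2 * x2)) = sc (l * l * l) * (x0 * (x2 * (x1 * x1)))
      - sc (l * l * c * g) * (zz (Suc k) * (T1 * (x1 * x1)))
      + sc (l * l * c * c * g) * (zz (Suc k + Suc k) * (T1 * T1))"
  proof -
    have "x0 * (x0 * (x2 * x2)) = sc l * (x0 * (x1 * (x1 * x2))) - sc (l * c) * (zz (Suc k) * (x0 * (T1 * x2)))"
      by (simp only: C' nf)
    also have "x0 * (x1 * (x1 * x2)) = sc (l * l) * (x0 * (x2 * (x1 * x1)))"
      by (simp only: B B' nf)
    also have "x0 * (T1 * x2) = sc g * (x0 * (x2 * T1))"
      by (simp only: D nf)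
    also have "x0 * (x2 * T1) = sc l * (T1 * (x1 * x1)) - sc (l * c) * (zz (Suc k) * (T1 * T1))"
      by (simp only: C' E E')
    finally show ?thesis
      by (simp only: nf mult_ac) (simp add: algebra_simps)
  qed
  have "sc (l * c) * (zz k * (T0 * (x2 * x2))) = (sc l * (x0 * x0) - Y * x1) * (x2 * x2)"
    by (simp add: A mult.assoc)
  also have "\<dots> = sc l * (x0 * (x0 * (x2 * x2))) - Y * (x1 * (x2 * x2))"
    by (simp only: left_diff_distrib mult.assoc)
  also have "\<dots> = sc (l * l * l * l) * (x0 * (x2 * (x1 * x1)))
      - sc (l * l * l * c * g) * (zz (Suc k) * (T1 * (x1 * x1)))
      + sc (l * l * l * c * c * g) * (zz (Suc k + Suc k) * (T1 * T1)) - sc (l * l) * (Y * (x2 * (x2 * x1)))"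
    unfolding w xx by (simp only: distrib_left nf mult_ac)
  finally have 1: "sc (l * c) * (zz k * (T0 * (x2 * x2))) = \<dots>" .
  have "sc (l * c) * (zz k * (T0 * (sc c2 * (zz (Suc (Suc k)) * T2)))) =
      sc (l * c * c2) * (zz (k + Suc (Suc k)) * (T0 * T2))"
    by (simp only: nf)
  also have "\<dots> = sc (l * c * (c2 * f)) * (zz (k + Suc (Suc k)) * (T1 * T1)) + sc (l * c * c2) * (zz (k + Suc (Suc k)) * (e * x1))"
    unfolding F by (simp only: distrib_left nf)
  also have "l * c * (c2 * f) = l * l * l * c * c * g"
    unfolding scalars by (simp only: mult_ac)
  finally have 2: "sc (l * c) * (zz k * (T0 * (sc c2 * (zz (Suc (Suc k)) * T2)))) =
    sc (l * l * l * c * c * g) * (zz (Suc k + Suc k) * (T1 * T1)) + sc (l * c * c2) * (zz (k + Suc (Suc k)) * (e * x1))"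
    by simp
  have 3: "l ^ 4 = l * l * l * l" "l ^ 3 * g * c = l * l * l * c * g" "l ^ 2 = l * l"
    by (simp_all add: power_def mult_ac numeral_eq_Suc)
  show ?thesis
    unfolding 3 right_diff_distrib 1 2 by (simp only: left_diff_distrib mult.assoc) (simp only: algebra_simps)
qed

text \<open>
  Telescoping of a geometric series in the direction of \<open>a\<close>.
\<close>

lemma msum_shift:
  assumes "finite I" "w > 0" "a \<in> I" "\<And>m. m \<noteq> (\<lambda>_. 0) \<Longrightarrow> m a = 0 \<Longrightarrow> F m = 0"
  shows "msum I w F = F (\<lambda>_. 0) + zz w * msum I w (\<lambda>m. F (m(a := Suc (m a))))"
proof -
  let ?up = "\<lambda>m::nat \<Rightarrow> nat. m(a := Suc (m a))"
  have sum_up: "sum (?up m) I = Suc (sum m I)" for m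
    using assms(1,3) by (simp add: sum.remove[of I a])
  have "msum I w (\<lambda>m. if m = (\<lambda>_. 0) then 0 else F m) = zz w * msum I w (\<lambda>m. F (?up m))"
  proof (rule fps_ext)
    fix N
    let ?F = "\<lambda>m. if m = (\<lambda>_. 0) then 0 else F m"
    have "msum I w ?F $ N = (\<Sum>m\<in>vecs I (Suc N). (zz (w * sum m I) * ?F m) $ N)"
      by (rule msum_nth[OF assms(1,2)]) simp
    also have "\<dots> = (\<Sum>m\<in>{m \<in> vecs I (Suc N). m a \<noteq> 0}. (zz (w * sum m I) * F m) $ N)"
      by (rule sum.mono_neutral_cong_right[OF finite_vecs[OF assms(1)]]) (use assms(4) in \<open>auto simp del: fps_X_power_mult_nth\<close>)
    also have "\<dots> = (\<Sum>m\<in>vecs I N. (zz (w * sum (?up m) I) * F (?up m)) $ N)"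
    proof (rule sum.reindex_bij_witness[of _ ?up "\<lambda>m. m(a := m a - 1)"])
      fix m assume m: "m \<in> {m \<in> vecs I (Suc N). m a \<noteq> 0}"
      have up: "?up (m(a := m a - 1)) = m" using m by auto
      then show "(m(a := m a - 1))(a := Suc ((m(a := m a - 1)) a)) = m" .
      have "Suc (sum (m(a := m a - 1)) I) = sum m I" using sum_up[of "m(a := m a - 1)"] unfolding up by (rule sym)
      then show "m(a := m a - 1) \<in> vecs I N" using m by (auto simp: vecs_def)
      show "(zz (w * sum ((m(a := m a - 1))(a := Suc ((m(a := m a - 1)) a))) I) *
          F ((m(a := m a - 1))(a := Suc ((m(a := m a - 1)) a)))) $ N = (zz (w * sum m I) * F m) $ N"
        unfolding up by (rule refl)
    next
      fix m assume m: "m \<in> vecs I N"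
      show "(?up m)(a := ?up m a - 1) = m" by auto
      show "?up m \<in> {m \<in> vecs I (Suc N). m a \<noteq> 0}" using m sum_up[of m] assms(3) by (auto simp: vecs_def)
    qed
    also have "\<dots> = (zz w * msum I w (\<lambda>m. F (?up m))) $ N"
      by (simp only: mult_msum[OF assms(1,2)] msum_nth[OF assms(1,2) order_refl] sum_up mult_Suc_right
          zz_left[of "zz w"] zz_zz add.commute[of w])
    finally show "msum I w ?F $ N = (zz w * msum I w (\<lambda>m. F (?up m))) $ N" .
  qed
  then show ?thesis using msum_split_zero[OF assms(1,2), of F] by simp
qed

text \<open>
  Series in the variables of level \<open>1\<close> without negative powers of \<open>Q\<^bsub>a,1\<^esub>\<close>.
\<close>

definition supported :: "nat \<Rightarrow> (wt \<Rightarrow> 'k::field) set" where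
  "supported a = {g. \<forall>\<gamma>. \<gamma> a < 0 \<longrightarrow> g \<gamma> = 0}"

definition preserving :: "nat \<Rightarrow> 'k::field linop fps set" where
  "preserving a = {f. \<forall>N. \<forall>g\<in>supported a. app (f $ N) g \<in> supported a}"

lemma preservingD: "f \<in> preserving a \<Longrightarrow> g \<in> supported a \<Longrightarrow> app (f $ N) g \<in> supported a"
  by (simp add: preserving_def)

lemma supported_add: "g \<in> supported a \<Longrightarrow> h \<in> supported a \<Longrightarrow> g + h \<in> supported a"
  by (simp add: supported_def)

lemma supported_sum: "(\<And>x. x \<in> S \<Longrightarrow> g x \<in> supported a) \<Longrightarrow> (\<Sum>x\<in>S. g x) \<in> supported a"
  by (induction S rule: infinite_finite_induct) (auto simp: supported_def)

lemma preserving_add: "f \<in> preserving a \<Longrightarrow> g \<in> preserving a \<Longrightarrow> f + g \<in> preserving a"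
  by (simp add: preserving_def plus_linop.rep_eq supported_add)

lemma preserving_mult: "f \<in> preserving a \<Longrightarrow> g \<in> preserving a \<Longrightarrow> f * g \<in> preserving a"
  by (auto simp: preserving_def fps_mult_nth app_sum times_linop.rep_eq intro!: supported_sum)

lemma preserving_sc: "f \<in> preserving a \<Longrightarrow> sc c * f \<in> preserving a"
  by (auto simp: preserving_def supported_def app_sc_mult_nth)

lemma preserving_diff: "f \<in> preserving a \<Longrightarrow> g \<in> preserving a \<Longrightarrow> f - g \<in> preserving a"
  using preserving_add[of f a "sc (- 1) * g"] preserving_sc[of g a "- 1"] by (simp add: sc_minus)

lemma preserving_zz: "zz k * f \<in> preserving a \<longleftrightarrow> f \<in> preserving a"
proof
  assume *: "zz k * f \<in> preserving a"
  have "app (f $ N) g \<in> supported a" if "g \<in> supported a" for N g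
    using preservingD[OF * that, of "N + k"] by (simp add: zz_nth)
  then show "f \<in> preserving a" by (simp add: preserving_def)
next
  assume "f \<in> preserving a"
  then show "zz k * f \<in> preserving a"
    by (auto simp: preserving_def zz_nth zero_linop.rep_eq supported_def)
qed

lemma preserving_msum:
  assumes "\<And>m. (\<And>b. b \<notin> I \<Longrightarrow> m b = 0) \<Longrightarrow> F m \<in> preserving a"
  shows "msum I w F \<in> preserving a"
proof -
  have "zz (w * sum m I) * F m \<in> preserving a" if "m \<in> vecs I N" for m N
    using assms that by (simp add: preserving_zz vecs_def)
  then show ?thesis
    by (auto simp: preserving_def msum_def app_sum simp del: fps_X_power_mult_nth intro!: supported_sum)
qed

lemma preserving_of_mult:
  assumes "x \<in> preserving a" "y \<in> preserving a" "x * y = sc c * z" "c \<noteq> 0"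
  shows "z \<in> preserving a"
proof -
  have "sc (inverse c) * (x * y) \<in> preserving a"
    using assms by (intro preserving_sc preserving_mult)
  then show ?thesis using assms(3,4) by (simp add: sc_sc)
qed

lemma wshift_preserving:
  assumes "\<alpha> a \<le> 0"
  shows "fps_const (wshift c \<alpha>) \<in> preserving a"
  using assms by (auto simp: preserving_def supported_def wshift.rep_eq zero_linop.rep_eq)

abbreviation unit_nat :: "nat \<Rightarrow> nat \<Rightarrow> nat" where
  "unit_nat a \<equiv> (\<lambda>b. of_bool (b = a))"

abbreviation unit_int :: "nat \<Rightarrow> wt" where
  "unit_int a \<equiv> (\<lambda>b. of_bool (b = a))"

context qsystem
begin

lemma Cv_unit: "a \<in> I \<Longrightarrow> Cv (unit_nat a) b = C b a"
proof -
  assume a: "a \<in> I"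
  have "C b c * int (unit_nat a c) = (if c = a then C b c else 0)" for c by simp
  then show ?thesis using fin a by (simp add: Cv_def)
qed

lemma lam_Cv_unit: "a \<in> I \<Longrightarrow> lam (Cv (unit_nat a)) \<beta> = d a * \<beta> a"
proof -
  assume a: "a \<in> I"
  have "d c * int (unit_nat a c) * \<beta> c = (if c = a then d c * \<beta> c else 0)" for c by simp
  then show ?thesis using fin a by (simp add: lam_Cv)
qed

lemma qbins_zero [simp]: "qbins (\<lambda>_. 0) \<alpha> = 1"
  by simp

lemma qbins_eq_0:
  assumes "b \<in> I" "\<alpha> b \<le> 0" "int (m b) > - \<alpha> b"
  shows "qbins m \<alpha> = 0"
  using assms fin qbin_eq_0 by (intro prod_zero bexI[of _ b]) auto

lemma qbins_at_0:
  assumes "m \<noteq> (\<lambda>_. 0)" "\<And>b. b \<notin> I \<Longrightarrow> m b = 0"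
  shows "qbins m 0 = 0"
proof -
  from assms(1) obtain b where b: "m b \<noteq> 0" by (auto simp: fun_eq_iff)
  have "b \<in> I" using assms(2)[of b] b by metis
  then show ?thesis using b by (intro qbins_eq_0[of b 0 m]) simp_all
qed

lemma E_Suc_0: "E (Suc i) 0 \<beta> = E i (- \<beta>) 0"
proof -
  have "E (Suc i) 0 \<beta> = sc (qbins (\<lambda>_. 0) 0) * E i (0 + 0 - \<beta> + Cv (\<lambda>_. 0)) 0"
    unfolding E_Suc by (rule msum_only_zero[OF fin zero_less_Suc], subst qbins_at_0) simp_all
  then show ?thesis by simp
qed

lemma E_0_0: "E i 0 0 = 1"
proof (induction i)
  case 0
  have "wshift (\<lambda>_. 1) 0 = (1 :: 'k linop)"
    by transfer (simp add: fun_eq_iff)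
  then show ?case by (simp only: E_0 lam_zero_left power_int_0_right fps_const_1_eq_1)
qed (simp only: E_Suc_0 minus_zero)

lemma E_inverse: "E i \<alpha> \<beta> * E i (- \<alpha>) (- \<beta>) = 1"
  unfolding E_mult by (simp add: om_def lam_simps lam_sym E_0_0)

text \<open>
  For exponent \<open>-1\<close> the binomial expansion has two terms, and the recursion becomes the exchange
  relation for \<open>Q\<^bsub>a,i+2\<^esub>\<close>.
\<close>

lemma E_Suc_minus_unit:
  assumes a: "a \<in> I"
  shows "E (Suc i) (- unit_int a) \<beta> = E i (- unit_int a - unit_int a - \<beta>) (- unit_int a) -
    zz (Suc i) * E i (- unit_int a - unit_int a - \<beta> + Cv (unit_nat a)) (- unit_int a)"
proof -
  let ?e = "unit_int a" and ?u = "unit_nat a"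
  let ?F = "\<lambda>m. sc (qbins m (- ?e)) * E i (- ?e + - ?e - \<beta> + Cv m) (- ?e)"
  have cf0: "qbins m (- ?e) = 0" if m: "\<And>b. b \<notin> I \<Longrightarrow> m b = 0" "m \<noteq> (\<lambda>_. 0)" "m \<noteq> ?u" for m
  proof -
    have "\<exists>b. m b > of_bool (b = a)"
    proof (rule ccontr)
      assume *: "\<not> ?thesis"
      then have "m b \<le> of_bool (b = a)" for b by (simp add: not_less)
      then have "m b = 0" if "b \<noteq> a" for b using that by (metis le_zero_eq of_bool_eq(1))
      moreover have "m a = 0 \<or> m a = 1" using \<open>m a \<le> of_bool (a = a)\<close> by auto
      ultimately have "m = (\<lambda>b. if b = a then 0 else 0) \<or> m = (\<lambda>b. if b = a then 1 else 0)"
        unfolding fun_eq_iff by (metis (full_types))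
      then have "m = (\<lambda>_. 0) \<or> m = ?u" by (auto simp: fun_eq_iff)
      then show False using that by blast
    qed
    then obtain b where b: "m b > of_bool (b = a)" by blast
    then have "b \<in> I" using m(1) by (metis not_less_zero)
    then show ?thesis using b by (intro qbins_eq_0[of b]) auto
  qed
  have "E (Suc i) (- ?e) \<beta> = msum I (Suc i) (\<lambda>m. if m \<in> {\<lambda>_. 0, ?u} then ?F m else 0)"
    unfolding E_Suc by (rule msum_cong) (use cf0 in auto)
  also have "\<dots> = (\<Sum>m\<in>{\<lambda>_. 0, ?u}. zz (Suc i * sum m I) * (if m \<in> {\<lambda>_. 0, ?u} then ?F m else 0))"
    by (rule msum_finite_support[OF fin]) (use a in auto)
  also have "\<dots> = ?F (\<lambda>_. 0) + zz (Suc i) * ?F ?u"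
  proof -
    have ne: "(\<lambda>_. 0) \<noteq> ?u" by (auto simp: fun_eq_iff)
    have "sum ?u I = 1" using a fin by (simp add: of_bool_def)
    then show ?thesis using ne by (simp del: fps_X_power_mult_nth)
  qed
  also have "qbins ?u (- ?e) = - 1"
  proof -
    have "qbins ?u (- ?e) = qbin (v a) (?u a) ((- ?e) a) * (\<Prod>b\<in>I - {a}. qbin (v b) (?u b) ((- ?e) b))"
      using a fin by (simp add: prod.remove)
    also have "(\<Prod>b\<in>I - {a}. qbin (v b) (?u b) ((- ?e) b)) = 1"
      by (rule prod.neutral) auto
    finally show ?thesis
      using generic_element.qbin_minus_one[OF generic_v[OF a], of 1] by simp
  qed
  finally show ?thesis
    by (simp only: qbins_zero sc_1 sc_minus mult_1_left Cv_zero add_0_right mult_minus_left mult_minus_right add_uminus_conv_diff)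
qed

text \<open>
  The exchange relation solved for \<open>Q\<^bsub>a,i\<^esub>\<close>: the left-hand side is
  \<open>(Q\<^bsub>a,i+1\<^esub>\<^sup>2 - \<dots>) Q\<^bsub>a,i+2\<^esub>\<^bsup>-1\<^esup>\<close>. Expanding \<open>Q\<^bsub>a,i+2\<^esub>\<^bsup>-1\<^esup>\<close> gives a geometric series, which telescopes.
\<close>

lemma E_Suc_unit:
  assumes a: "a \<in> I"
  shows "E (Suc i) (unit_int a) (unit_int a + unit_int a) -
    zz (Suc i) * E (Suc i) (unit_int a) (unit_int a + unit_int a - Cv (unit_nat a)) = E i 0 (unit_int a)"
proof -
  let ?e = "unit_int a" and ?u = "unit_nat a"
  let ?F = "\<lambda>m. sc (qbins m ?e) * E i (Cv m) ?e"
  have cf0: "qbins m ?e = 0" if "\<And>b. b \<notin> I \<Longrightarrow> m b = 0" "b \<noteq> a" "m b \<noteq> 0" for m b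
  proof -
    have "b \<in> I" using that(1)[of b] that(3) by metis
    then show ?thesis using that(2,3) by (intro qbins_eq_0[of b]) auto
  qed
  have cf1: "qbins m ?e = 1" if "\<And>b. b \<noteq> a \<Longrightarrow> m b = 0" for m
  proof (rule prod.neutral, rule ballI)
    fix b assume "b \<in> I"
    then show "qbin (v b) (m b) (?e b) = 1"
      using that generic_element.qbin_one[OF generic_v] by (cases "b = a") auto
  qed
  let ?F' = "\<lambda>m. if \<forall>b. b \<noteq> a \<longrightarrow> m b = 0 then ?F m else 0"
  have "E (Suc i) ?e (?e + ?e) = msum I (Suc i) ?F"
    by (simp add: E_Suc)
  also have "\<dots> = msum I (Suc i) ?F'"
  proof (rule msum_cong)
    fix m :: "nat \<Rightarrow> nat" assume m: "\<And>b. b \<notin> I \<Longrightarrow> m b = 0"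
    show "?F m = ?F' m"
    proof (cases "\<forall>b. b \<noteq> a \<longrightarrow> m b = 0")
      case False
      then obtain b where "b \<noteq> a" "m b \<noteq> 0" by auto
      then have "qbins m ?e = 0" using cf0 m by blast
      then show ?thesis using False by simp
    qed simp
  qed
  also have "\<dots> = ?F' (\<lambda>_. 0) + zz (Suc i) * msum I (Suc i) (\<lambda>m. ?F' (m(a := Suc (m a))))"
  proof (rule msum_shift[OF fin zero_less_Suc a])
    fix m :: "nat \<Rightarrow> nat" assume m: "m \<noteq> (\<lambda>_. 0)" "m a = 0"
    then obtain b where "m b \<noteq> 0" by auto
    then have "\<not> (\<forall>b. b \<noteq> a \<longrightarrow> m b = 0)" using m(2) by (cases "b = a") auto
    then show "?F' m = 0" by (simp only: if_False)
  qed
  also have "msum I (Suc i) (\<lambda>m. ?F' (m(a := Suc (m a)))) = msum I (Suc i) (\<lambda>m. sc (qbins m ?e) * E i (?e + ?e - (?e + ?e - Cv ?u) + Cv m) ?e)"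
  proof (rule msum_cong)
    fix m :: "nat \<Rightarrow> nat" assume m: "\<And>b. b \<notin> I \<Longrightarrow> m b = 0"
    have up: "m(a := Suc (m a)) = ?u + m" by (auto simp: fun_eq_iff)
    have eq: "?e + ?e - (?e + ?e - Cv ?u) + Cv m = Cv (m(a := Suc (m a)))"
      unfolding up Cv_add by simp
    show "?F' (m(a := Suc (m a))) = sc (qbins m ?e) * E i (?e + ?e - (?e + ?e - Cv ?u) + Cv m) ?e"
    proof (cases "\<forall>b. b \<noteq> a \<longrightarrow> m b = 0")
      case True
      then have "qbins m ?e = 1" "qbins (m(a := Suc (m a))) ?e = 1" by (intro cf1; simp)+
      then show ?thesis unfolding eq using True by simp
    next
      case False
      then obtain b where b: "b \<noteq> a" "m b \<noteq> 0" by auto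
      then have "qbins m ?e = 0" using cf0 m by blast
      moreover have "\<not> (\<forall>b. b \<noteq> a \<longrightarrow> (m(a := Suc (m a))) b = 0)" using b by auto
      ultimately show ?thesis by (simp only: if_False sc_0 mult_zero_left)
    qed
  qed
  also have "\<dots> = E (Suc i) ?e (?e + ?e - Cv ?u)"
    by (simp only: E_Suc)
  finally have "E (Suc i) ?e (?e + ?e) = ?F' (\<lambda>_. 0) + zz (Suc i) * E (Suc i) ?e (?e + ?e - Cv ?u)" .
  moreover have "?F' (\<lambda>_. 0) = E i 0 ?e"
    by (simp only: qbins_zero sc_1 mult_1_left Cv_zero simp_thms if_True)
  ultimately show ?thesis by (simp only: add_diff_cancel_right')
qed

text \<open>
  The monomials of level \<open>i\<close> in the \<open>Q\<^bsub>b\<^esub>\<^bsup>\<plusminus>1\<^esup>\<close> with \<open>b \<noteq> a\<close>, then \<open>Q\<^bsub>a,i\<^esub>\<close>, \<open>Q\<^bsub>a,i+1\<^esub>\<close> and \<open>Q\<^bsub>a,i-1\<^esub>\<close>. The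
  last one is written in terms of level \<open>i\<close>, so that it makes sense for \<open>i = 0\<close>.
\<close>

definition seed_polynomial :: "nat \<Rightarrow> nat \<Rightarrow> bool" where
  "seed_polynomial a i \<longleftrightarrow>
    (\<forall>\<alpha> \<beta>. \<alpha> a = 0 \<longrightarrow> \<beta> a = 0 \<longrightarrow> E i \<alpha> \<beta> \<in> preserving a) \<and>
    E i 0 (unit_int a) \<in> preserving a \<and> E i (- unit_int a) 0 \<in> preserving a \<and>
    E i (unit_int a) (unit_int a + unit_int a) -
      zz i * E i (unit_int a) (unit_int a + unit_int a - Cv (unit_nat a)) \<in> preserving a"

lemma E_preserving:
  assumes P: "seed_polynomial a i" and "\<alpha> a \<le> 0" "\<beta> a \<ge> 0"
  shows "E i \<alpha> \<beta> \<in> preserving a"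
proof -
  let ?e = "unit_int a"
  have 1: "E i \<alpha> \<beta> \<in> preserving a" if "\<alpha> a = - int n" "\<beta> a = 0" for n \<alpha> \<beta>
    using that
  proof (induction n arbitrary: \<alpha> \<beta>)
    case 0
    then show ?case using P by (simp add: seed_polynomial_def)
  next
    case (Suc n)
    have "E i (\<alpha> + ?e) \<beta> \<in> preserving a" using Suc.prems by (intro Suc.IH) simp_all
    moreover have "E i (- ?e) 0 \<in> preserving a" using P by (simp add: seed_polynomial_def)
    moreover have "E i (\<alpha> + ?e) \<beta> * E i (- ?e) 0 = sc (s powi om (\<alpha> + ?e) \<beta> (- ?e) 0) * E i \<alpha> \<beta>"
      unfolding E_mult by simp
    ultimately show ?case using s_nonzero by (auto intro: preserving_of_mult)
  qed
  have 2: "E i \<alpha> \<beta> \<in> preserving a" if "\<alpha> a \<le> 0" "\<beta> a = int n" for n \<alpha> \<beta>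
    using that
  proof (induction n arbitrary: \<alpha> \<beta>)
    case 0
    then show ?case using 1[of \<alpha> "nat (- \<alpha> a)" \<beta>] by simp
  next
    case (Suc n)
    have "E i \<alpha> (\<beta> - ?e) \<in> preserving a" using Suc.prems by (intro Suc.IH) simp_all
    moreover have "E i 0 ?e \<in> preserving a" using P by (simp add: seed_polynomial_def)
    moreover have "E i \<alpha> (\<beta> - ?e) * E i 0 ?e = sc (s powi om \<alpha> (\<beta> - ?e) 0 ?e) * E i \<alpha> \<beta>"
      unfolding E_mult by simp
    ultimately show ?case using s_nonzero by (auto intro: preserving_of_mult)
  qed
  from 2[of \<alpha> \<beta> "nat (\<beta> a)"] assms show ?thesis by simp
qed

lemma E_0_preserving: "\<alpha> a \<le> 0 \<Longrightarrow> E 0 \<alpha> \<beta> \<in> preserving a"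
  unfolding E_0 by (rule wshift_preserving)

lemma zero_preserving: "0 \<in> preserving a"
  by (simp add: preserving_def zero_linop.rep_eq supported_def)

text \<open>
  The point is \<open>Q\<^bsub>a,-1\<^esub>\<close>. It lowers the exponent of \<open>Q\<^bsub>a,1\<^esub>\<close> by one and multiplies by the difference of
  two powers of \<open>s\<close>, whose exponents agree when the exponent \<open>0\<close> is lowered to \<open>-1\<close>. This is where the
  eigenvalues of \<open>Q\<^bsub>a,0\<^esub>\<close> on the vacuum matter.
\<close>

lemma seed_polynomial_0:
  assumes a: "a \<in> I"
  shows "seed_polynomial a 0"
proof -
  let ?e = "unit_int a" and ?u = "unit_nat a"
  let ?c = "\<lambda>\<beta> \<gamma>. s powi lam \<beta> (\<gamma> + \<gamma> + ?e + 1)"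
  let ?Y = "E 0 ?e (?e + ?e) - E 0 ?e (?e + ?e - Cv ?u)"
  have "app (?Y $ N) g \<in> supported a" if g: "g \<in> supported a" for g N
  proof (cases "N = 0")
    case True
    have "app (?Y $ 0) g \<gamma> = 0" if \<gamma>: "\<gamma> a < 0" for \<gamma>
    proof -
      have eq: "app (?Y $ 0) g \<gamma> = (?c (?e + ?e) \<gamma> - ?c (?e + ?e - Cv ?u) \<gamma>) * g (\<gamma> + ?e)"
        unfolding E_0 by (simp only: fps_sub_nth fps_nth_fps_const if_True minus_linop.rep_eq wshift.rep_eq minus_apply left_diff_distrib refl)
      show ?thesis
      proof (cases "\<gamma> a = - 1")
        case True
        then have "lam (?e + ?e) (\<gamma> + \<gamma> + ?e + 1) = lam (?e + ?e - Cv ?u) (\<gamma> + \<gamma> + ?e + 1)"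
          unfolding lam_diff_left lam_Cv_unit[OF a] by simp
        then show ?thesis unfolding eq by simp
      next
        case False
        then have "g (\<gamma> + ?e) = 0" using g \<gamma> by (simp add: supported_def)
        then show ?thesis unfolding eq by simp
      qed
    qed
    then show ?thesis using True by (simp add: supported_def)
  next
    case False
    then show ?thesis by (simp add: E_0 supported_def zero_linop.rep_eq)
  qed
  then have "?Y \<in> preserving a" by (simp add: preserving_def)
  then show ?thesis unfolding seed_polynomial_def using E_0_preserving by simp
qed

lemma Cv_nonpos:
  assumes "m a = 0"
  shows "Cv m a \<le> 0"
  unfolding Cv_def
proof (rule sum_nonpos)
  fix c assume "c \<in> I"
  show "C a c * int (m c) \<le> 0"
    using assms C_nonpos[of a c] by (cases "c = a") (auto simp: mult_nonpos_nonneg)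
qed

text \<open>
  For \<open>b \<noteq> a\<close> the expansion of \<open>Q\<^bsub>b,i+2\<^esub>\<^bsup>\<plusminus>1\<^esup>\<close> involves \<open>Q\<^bsub>a,i+1\<^esub>\<close> with nonnegative exponents only, as
  the off-diagonal Cartan integers are \<open>\<le> 0\<close>. Thus \<open>Q\<^bsub>a,i+2\<^esub>\<close> is the only generator to be checked.
\<close>

lemma seed_polynomial_Suc:
  assumes a: "a \<in> I" and P: "seed_polynomial a i" and new: "E (Suc i) (- unit_int a) 0 \<in> preserving a"
  shows "seed_polynomial a (Suc i)"
proof -
  let ?e = "unit_int a"
  have "E (Suc i) \<alpha> \<beta> \<in> preserving a" if "\<alpha> a = 0" "\<beta> a = 0" for \<alpha> \<beta>
    unfolding E_Suc
  proof (rule preserving_msum)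
    fix m :: "nat \<Rightarrow> nat"
    show "sc (qbins m \<alpha>) * E i (\<alpha> + \<alpha> - \<beta> + Cv m) \<alpha> \<in> preserving a"
    proof (cases "m a = 0")
      case True
      then show ?thesis using that Cv_nonpos[of m a] by (intro preserving_sc E_preserving[OF P]) simp_all
    next
      case False
      then have "qbins m \<alpha> = 0" using a that by (intro qbins_eq_0[of a]) auto
      then show ?thesis by (simp add: zero_preserving)
    qed
  qed
  moreover have "E (Suc i) 0 ?e \<in> preserving a" using P by (simp add: E_Suc_0 seed_polynomial_def)
  ultimately show ?thesis
    using P new unfolding seed_polynomial_def E_Suc_unit[OF a] by blast
qed

lemma seed_polynomial_1:
  assumes a: "a \<in> I"
  shows "seed_polynomial a (Suc 0)"
proof -
  have "E (Suc 0) (- unit_int a) 0 \<in> preserving a"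
    unfolding E_Suc_minus_unit[OF a]
    by (intro preserving_diff preserving_zz[THEN iffD2] E_0_preserving) (simp_all add: Cv_unit C_diag a)
  then show ?thesis using seed_polynomial_Suc[OF a seed_polynomial_0[OF a]] by simp
qed


lemma E_mult_eq:
  assumes "om \<alpha> \<beta> \<alpha>' \<beta>' = x" "\<alpha> + \<alpha>' = \<alpha>''" "\<beta> + \<beta>' = \<beta>''"
  shows "E i \<alpha> \<beta> * E i \<alpha>' \<beta>' = sc (s powi x) * E i \<alpha>'' \<beta>''"
  unfolding E_mult assms by (rule refl)

text \<open>
  The relations of \<open>exchange_step\<close> hold by \<open>E_mult\<close>, applied at level \<open>k\<close> or \<open>k + 1\<close>, and the
  quotient it produces preserves polynomiality. Cancelling the invertible \<open>Q\<^bsub>a,k+1\<^esub>\<close>, the unit \<open>T\<^sub>0\<close>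
  and the power of \<open>z\<close> leaves \<open>Q\<^bsub>a,k+3\<^esub>\<close>.
\<close>

lemma new_variable_preserving:
  assumes a: "a \<in> I" and P: "seed_polynomial a k" and P': "seed_polynomial a (Suc k)"
  shows "E (Suc (Suc k)) (- unit_int a) 0 \<in> preserving a"
proof -
  define e where "e = unit_int a"
  define Ce where "Ce = Cv (unit_nat a)"
  define \<alpha> where "\<alpha> = Ce - e - e"
  define D where "D = d a"
  define \<Lambda> where "\<Lambda> = lam e e"
  have e_a: "e a = 1" by (simp add: e_def)
  have \<alpha>_a: "\<alpha> a = 0" by (simp add: \<alpha>_def Ce_def e_def Cv_unit[OF a] C_diag[OF a])
  have Ce_e: "lam Ce e = D" "lam e Ce = D"
    using lam_Cv_unit[OF a, of e] lam_sym[of e Ce] by (simp_all add: Ce_def D_def e_a)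
  have "lam Ce \<alpha> = 0" using lam_Cv_unit[OF a, of \<alpha>] \<alpha>_a by (simp add: Ce_def)
  then have \<alpha>\<alpha>: "lam \<alpha> \<alpha> = 4 * \<Lambda> - 2 * D"
    using Ce_e lam_sym[of e Ce] unfolding \<alpha>_def lam_simps \<Lambda>_def by linarith
  have \<alpha>e: "lam \<alpha> e = D - 2 * \<Lambda>" "lam e \<alpha> = D - 2 * \<Lambda>"
    using Ce_e unfolding \<alpha>_def lam_simps \<Lambda>_def by simp_all
  define x0 where "x0 = E k 0 e"
  define x1 where "x1 = E (Suc k) 0 e"
  define x2 where "x2 = E (Suc k) (- e) 0"
  define T0 where "T0 = E k 0 (- \<alpha>)"
  define T1 where "T1 = E (Suc k) 0 (- \<alpha>)"
  define T2 where "T2 = E (Suc k) \<alpha> 0"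
  define Y where "Y = E k e (e + e) - zz k * E k e (e + e - Ce)"
  have x1: "x1 = E k (- e) 0" by (simp only: x1_def E_Suc_0)
  have T1: "T1 = E k \<alpha> 0" by (simp only: T1_def E_Suc_0 minus_minus)
  have exp2: "x2 = E k (- e - e) (- e) - zz (Suc k) * E k \<alpha> (- e)"
    unfolding x2_def e_def E_Suc_minus_unit[OF a] \<alpha>_def Ce_def by (simp only: diff_0_right) (simp add: algebra_simps)
  have x00: "x0 * x0 = E k 0 (e + e)" and x11: "x1 * x1 = E k (- e - e) 0"
    and x22: "x2 * x2 = E (Suc k) (- e - e) 0" and T11: "T1 * T1 = E k (\<alpha> + \<alpha>) 0"
    unfolding x0_def x1 x2_def T1 E_mult om_def lam_simps by simp_all
  have A: "Y * x1 = sc (s powi (2 * \<Lambda>)) * (x0 * x0) - sc (s powi (2 * \<Lambda>) * s powi (- D)) * (zz k * T0)"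
  proof -
    have "E k e (e + e) * x1 = sc (s powi (2 * \<Lambda>)) * E k 0 (e + e)"
      unfolding x1 by (rule E_mult_eq) (simp_all only: om_def lam_simps \<Lambda>_def, simp_all)
    moreover have "E k e (e + e - Ce) * x1 = sc (s powi (2 * \<Lambda> + - D)) * T0"
      unfolding x1 T0_def \<alpha>_def by (rule E_mult_eq) (simp_all only: om_def lam_simps \<Lambda>_def Ce_e, simp_all)
    ultimately show ?thesis
      unfolding Y_def x00 by (simp only: left_diff_distrib mult.assoc powi_add zz_sc)
  qed
  have B: "x1 * x2 = sc (s powi (2 * \<Lambda>)) * (x2 * x1)"
  proof -
    have "x1 * x2 = sc (s powi \<Lambda>) * E (Suc k) (- e) e"
      unfolding x1_def x2_def by (rule E_mult_eq) (simp_all only: om_def lam_simps \<Lambda>_def, simp_all)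
    moreover have "x2 * x1 = sc (s powi (- \<Lambda>)) * E (Suc k) (- e) e"
      unfolding x1_def x2_def by (rule E_mult_eq) (simp_all only: om_def lam_simps \<Lambda>_def, simp_all)
    ultimately show ?thesis by (simp only: sc_sc powi_add[symmetric]) simp
  qed
  have C: "x0 * x2 = sc (s powi (2 * \<Lambda>)) * (x1 * x1) - sc (s powi (2 * \<Lambda>) * s powi (- D)) * (zz (Suc k) * T1)"
  proof -
    have "x0 * E k (- e - e) (- e) = sc (s powi (2 * \<Lambda>)) * (x1 * x1)"
      unfolding x0_def x11 by (rule E_mult_eq) (simp_all only: om_def lam_simps \<Lambda>_def, simp_all)
    moreover have "x0 * E k \<alpha> (- e) = sc (s powi (2 * \<Lambda> + - D)) * T1"
      unfolding x0_def T1 by (rule E_mult_eq) (simp_all only: om_def lam_simps \<alpha>e, simp_all)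
    ultimately show ?thesis
      unfolding exp2 by (simp only: right_diff_distrib zz_left[of x0] powi_add zz_sc)
  qed
  have D: "T1 * x2 = sc (s powi (4 * \<Lambda> - 2 * D)) * (x2 * T1)"
  proof -
    have "T1 * x2 = sc (s powi (2 * \<Lambda> - D)) * E (Suc k) (- e) (- \<alpha>)"
      unfolding T1_def x2_def by (rule E_mult_eq) (simp_all only: om_def lam_simps \<alpha>e, simp_all)
    moreover have "x2 * T1 = sc (s powi (D - 2 * \<Lambda>)) * E (Suc k) (- e) (- \<alpha>)"
      unfolding T1_def x2_def by (rule E_mult_eq) (simp_all only: om_def lam_simps \<alpha>e, simp_all)
    ultimately show ?thesis by (simp only: sc_sc powi_add[symmetric]) simp
  qed
  have E: "x1 * T1 = T1 * x1"
    unfolding x1_def T1_def E_mult by (simp only: om_def lam_simps minus_zero add.commute)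
  \<comment> \<open>the terms of \<open>T0 * T2\<close> with \<open>m \<noteq> 0\<close> contain \<open>x1\<close> with positive exponent, split off here\<close>
  define G where "G = (\<lambda>m. sc (qbins m \<alpha> * s powi (2 * lam \<alpha> \<alpha> + lam \<alpha> (Cv m))) * E k (\<alpha> + \<alpha> + Cv m + e) 0)"
  define r where "r = msum I (Suc k) (\<lambda>m. if m = (\<lambda>_. 0) then 0 else G m)"
  have F: "T0 * T2 = sc (s powi (2 * lam \<alpha> \<alpha>)) * (T1 * T1) + r * x1"
  proof -
    have G_x1: "G m * x1 = sc (qbins m \<alpha> * s powi (2 * lam \<alpha> \<alpha> + lam \<alpha> (Cv m))) * E k (\<alpha> + \<alpha> + Cv m) 0" for m
    proof -
      have "E k (\<alpha> + \<alpha> + Cv m + e) 0 * x1 = sc (s powi 0) * E k (\<alpha> + \<alpha> + Cv m) 0"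
        unfolding x1 by (rule E_mult_eq) (simp_all only: om_def lam_simps, simp_all)
      then show ?thesis unfolding G_def mult.assoc by (simp only: power_int_0_right sc_1 mult_1_left)
    qed
    have "T0 * E k (\<alpha> + \<alpha> - 0 + Cv m) \<alpha> = sc (s powi (2 * lam \<alpha> \<alpha> + lam \<alpha> (Cv m))) * E k (\<alpha> + \<alpha> + Cv m) 0" for m
      unfolding T0_def by (rule E_mult_eq) (simp_all only: om_def lam_simps, simp_all)
    then have "T0 * (sc (qbins m \<alpha>) * E k (\<alpha> + \<alpha> - 0 + Cv m) \<alpha>) = G m * x1" for m
      unfolding G_x1 by (simp only: sc_left[of T0] sc_sc)
    then have "T0 * T2 = msum I (Suc k) (\<lambda>m. G m * x1)"
      unfolding T2_def E_Suc mult_msum[OF fin zero_less_Suc] by (simp only:)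
    also have "\<dots> = msum I (Suc k) G * x1"
      by (simp only: msum_mult[OF fin zero_less_Suc])
    also have "\<dots> = G (\<lambda>_. 0) * x1 + r * x1"
      unfolding r_def msum_split_zero[OF fin zero_less_Suc, of k G] by (simp only: distrib_right)
    also have "G (\<lambda>_. 0) * x1 = sc (s powi (2 * lam \<alpha> \<alpha>)) * (T1 * T1)"
      unfolding G_x1 T11 by (simp only: qbins_zero Cv_zero lam_zero_right add_0_right mult_1_left)
    finally show ?thesis .
  qed
  have scalars: "s powi D * s powi (2 * lam \<alpha> \<alpha>) = s powi (2 * \<Lambda>) * s powi (2 * \<Lambda>) * s powi (4 * \<Lambda> - 2 * D) * s powi (- D)"
    unfolding powi_add[symmetric] \<alpha>\<alpha> by (rule arg_cong[where f = "\<lambda>x. s powi x"]) simp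
  let ?l = "s powi (2 * \<Lambda>)" and ?c = "s powi (- D)" and ?g = "s powi (4 * \<Lambda> - 2 * D)"
  define y where "y = sc (?l ^ 4) * (x0 * (x2 * x1)) - sc (?l ^ 3 * ?g * ?c) * (zz (Suc k) * (T1 * x1))
      - sc (?l ^ 2) * (Y * (x2 * x2)) - sc (?l * ?c * s powi D) * (zz (k + Suc (Suc k)) * r)"
  have key: "sc (?l * ?c) * (zz k * (T0 * (x2 * x2 - sc (s powi D) * (zz (Suc (Suc k)) * T2)))) = y * x1"
    unfolding y_def by (rule exchange_step[OF A B C D E F scalars])

  define x3 where "x3 = E (Suc (Suc k)) (- e) 0"
  have x3_x1: "x3 * x1 = sc (s powi (- (2 * \<Lambda>))) * (x2 * x2 - sc (s powi D) * (zz (Suc (Suc k)) * T2))"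
  proof -
    have exp3: "x3 = E (Suc k) (- e - e) (- e) - zz (Suc (Suc k)) * E (Suc k) \<alpha> (- e)"
      unfolding x3_def e_def E_Suc_minus_unit[OF a] \<alpha>_def Ce_def by (simp only: diff_0_right) (simp add: algebra_simps)
    have "E (Suc k) (- e - e) (- e) * x1 = sc (s powi (- (2 * \<Lambda>))) * (x2 * x2)"
      unfolding x1_def x22 by (rule E_mult_eq) (simp_all only: om_def lam_simps \<Lambda>_def, simp_all)
    moreover have "E (Suc k) \<alpha> (- e) * x1 = sc (s powi (- (2 * \<Lambda>) + D)) * T2"
      unfolding x1_def T2_def by (rule E_mult_eq) (simp_all only: om_def lam_simps \<alpha>e, simp_all)
    ultimately show ?thesis
      unfolding exp3 by (simp only: left_diff_distrib right_diff_distrib mult.assoc powi_add zz_sc sc_mult)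
  qed
  have "sc (?l * ?c) * (zz k * (T0 * (sc ?l * (x3 * x1)))) = y * x1"
    unfolding x3_x1 key[symmetric] sc_sc powi_add[symmetric] by simp
  then have "sc (?l * ?c * ?l) * (zz k * (T0 * x3)) * x1 = y * x1"
    by (simp only: sc_left[of T0] zz_sc sc_sc mult.assoc)
  then have "sc (?l * ?c * ?l) * (zz k * (T0 * x3)) * (x1 * E (Suc k) 0 (- e)) = y * (x1 * E (Suc k) 0 (- e))"
    by (simp only: mult.assoc[symmetric])
  moreover have "x1 * E (Suc k) 0 (- e) = 1"
    using E_inverse[of "Suc k" 0 e] unfolding x1_def by simp
  ultimately have x3_y: "sc (?l * ?c * ?l) * (zz k * (T0 * x3)) = y" by simp

  have "x0 \<in> preserving a" "x1 \<in> preserving a" "x2 \<in> preserving a" "T1 \<in> preserving a" "Y \<in> preserving a"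
    using P P' \<alpha>_a by (simp_all add: seed_polynomial_def x0_def x1_def x2_def T1_def Y_def e_def Ce_def)
  moreover have "r \<in> preserving a"
    unfolding r_def
  proof (rule preserving_msum)
    fix m :: "nat \<Rightarrow> nat" assume m: "\<And>b. b \<notin> I \<Longrightarrow> m b = 0"
    show "(if m = (\<lambda>_. 0) then 0 else G m) \<in> preserving a"
    proof (cases "m = (\<lambda>_. 0) \<or> qbins m \<alpha> = 0")
      case True
      then show ?thesis by (auto simp: G_def zero_preserving)
    next
      case False
      then obtain b where b: "m b \<noteq> 0" by (auto simp: fun_eq_iff)
      have bI: "b \<in> I" using m[of b] b by metis
      have nz: "\<not> (c \<in> I \<and> \<alpha> c = 0 \<and> m c \<noteq> 0)" for c
        using False qbins_eq_0[of c \<alpha> m] by auto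
      have ma: "m a = 0" using nz[of a] \<alpha>_a a by auto
      \<comment> \<open>a neighbour \<open>b\<close> of \<open>a\<close> occurs in \<open>m\<close>, which provides the factor \<open>x1\<close>\<close>
      have "b \<noteq> a" using b ma by auto
      moreover have "\<alpha> b \<noteq> 0" using nz[of b] b bI by auto
      ultimately have "C b a \<noteq> 0" by (simp add: \<alpha>_def Ce_def e_def Cv_unit[OF a])
      then have "C a b < 0" using C_zero[of a b] C_nonpos[of a b] \<open>b \<noteq> a\<close> by force
      then have "C a b * int (m b) \<le> -1" using b mult_le_mono1 by (smt (verit) mult_less_0_iff of_nat_0_less_iff neq0_conv)
      moreover have "(\<Sum>c\<in>I - {b}. C a c * int (m c)) \<le> 0"
      proof (rule sum_nonpos)
        fix c assume "c \<in> I - {b}"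
        show "C a c * int (m c) \<le> 0"
          using ma C_nonpos[of a c] by (cases "c = a") (auto simp: mult_nonpos_nonneg)
      qed
      ultimately have "Cv m a \<le> - 1"
        unfolding Cv_def using sum.remove[OF fin bI, of "\<lambda>c. C a c * int (m c)"] by simp
      then have "E k (\<alpha> + \<alpha> + Cv m + e) 0 \<in> preserving a"
        using \<alpha>_a e_a by (intro E_preserving[OF P]) simp_all
      then show ?thesis using False by (simp add: G_def preserving_sc)
    qed
  qed
  ultimately have "y \<in> preserving a"
    unfolding y_def by (intro preserving_diff preserving_sc preserving_mult preserving_zz[THEN iffD2])
  then have "sc (inverse (?l * ?c * ?l)) * (sc (?l * ?c * ?l) * (zz k * (T0 * x3))) \<in> preserving a"
    unfolding x3_y by (rule preserving_sc)
  moreover have "inverse (?l * ?c * ?l) * (?l * ?c * ?l) = 1"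
    by (rule left_inverse) (use s_nonzero in simp)
  ultimately have "zz k * (T0 * x3) \<in> preserving a" by (simp only: sc_sc sc_1 mult_1_left)
  then have "T0 * x3 \<in> preserving a" by (simp only: preserving_zz)
  moreover have "E k 0 \<alpha> \<in> preserving a" using P \<alpha>_a by (simp add: seed_polynomial_def)
  ultimately have "E k 0 \<alpha> * (T0 * x3) \<in> preserving a" by (rule preserving_mult[rotated])
  moreover have "E k 0 \<alpha> * (T0 * x3) = x3"
  proof -
    have "E k 0 \<alpha> * T0 = 1" using E_inverse[of k 0 \<alpha>] unfolding T0_def by simp
    then show ?thesis by (simp only: mult.assoc[symmetric] mult_1_left)
  qed
  ultimately show ?thesis by (simp only: x3_def e_def)
qed

theorem polynomiality:
  assumes a: "a \<in> I"
  shows "seed_polynomial a i"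
proof -
  have "seed_polynomial a i \<and> seed_polynomial a (Suc i)"
  proof (induction i)
    case 0
    then show ?case using seed_polynomial_0[OF a] seed_polynomial_1[OF a] by simp
  next
    case (Suc i)
    then show ?case using seed_polynomial_Suc[OF a] new_variable_preserving[OF a] by blast
  qed
  then show ?thesis ..
qed

section \<open>Partial fermionic sums as vacuum coefficients\<close>

text \<open>
  The product \<open>Q\<^bsub>i\<^esub>\<^bsup>\<nu>(i)\<^esup> \<dots> Q\<^bsub>1\<^esub>\<^bsup>\<nu>(1)\<^esup>\<close>, where \<open>\<nu>(j)\<close> counts the Kirillov--Reshetikhin modules
  of level \<open>j\<close>.
\<close>

primrec KR_word :: "(nat \<Rightarrow> wt) \<Rightarrow> nat \<Rightarrow> 'k linop fps" where
  "KR_word \<nu> 0 = 1"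
| "KR_word \<nu> (Suc i) = E (Suc i) 0 (\<nu> (Suc i)) * KR_word \<nu> i"

text \<open>
  The partial fermionic sum over the solutions of \<open>q\<^bsub>a,0\<^esub> = 0\<close> on the levels \<open>1, \<dots>, i\<close> of total weight
  \<open>N\<close>, with prescribed vacancy numbers \<open>\<alpha>\<close> at level \<open>i\<close> and \<open>\<beta>\<close> at level \<open>i + 1\<close>. The vacuum is the delta function at
  \<open>0\<close>, and the coefficient is read off at exponent \<open>-1\<close> of every \<open>Q\<^bsub>a,1\<^esub>\<close>. The shifts by \<open>1\<close> account for
  the binomial coefficient of \<open>m + p\<close> over \<open>m\<close> belonging to \<open>(1 - X)\<^bsup>-p-1\<^esup>\<close>.
\<close>

definition vacuum_coeff :: "(nat \<Rightarrow> wt) \<Rightarrow> nat \<Rightarrow> wt \<Rightarrow> wt \<Rightarrow> nat \<Rightarrow> 'k" where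
  "vacuum_coeff \<nu> i \<alpha> \<beta> N = app ((E i (\<alpha> + 1) (\<beta> + 1) * KR_word \<nu> i) $ N) (\<lambda>\<gamma>. of_bool (\<gamma> = 0)) (- 1)"

lemma vacuum_coeff_0: "vacuum_coeff \<nu> 0 \<alpha> \<beta> N = of_bool (N = 0 \<and> \<alpha> = 0)"
proof -
  let ?v = "\<lambda>\<gamma>::wt. of_bool (\<gamma> = 0) :: 'k"
  have "- 1 + (\<alpha> + 1) = \<alpha>" by (simp add: fun_eq_iff)
  moreover have "- 1 + - 1 + (\<alpha> + 1) + 1 = \<alpha>"
    by (simp add: fun_eq_iff)
  ultimately have "app (wshift (\<lambda>\<gamma>. s powi lam (\<beta> + 1) (\<gamma> + \<gamma> + (\<alpha> + 1) + 1)) (\<alpha> + 1)) ?v (- 1) =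
      s powi lam (\<beta> + 1) \<alpha> * ?v \<alpha>"
    by (simp only: wshift.rep_eq)
  also have "\<dots> = of_bool (\<alpha> = 0)"
    by (cases "\<alpha> = 0") (simp_all only: lam_zero_right power_int_0_right simp_thms of_bool_eq mult_1_right mult_zero_right)
  finally show ?thesis
    unfolding vacuum_coeff_def E_0 KR_word.simps mult_1_right fps_nth_fps_const
    by (cases "N = 0") (simp_all only: if_True if_False simp_thms zero_linop.rep_eq zero_fun_apply of_bool_eq)
qed

lemma vacuum_coeff_Suc: "vacuum_coeff \<nu> (Suc i) \<alpha> \<beta> N = s powi lam (\<alpha> + 1) (\<nu> (Suc i)) *
  (\<Sum>m\<in>{m \<in> vecs I N. Suc i * sum m I \<le> N}. qbins m (\<alpha> + 1) * vacuum_coeff \<nu> i (\<alpha> + \<alpha> - \<beta> - \<nu> (Suc i) + Cv m) \<alpha> (N - Suc i * sum m I))"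
proof -
  let ?n = "\<nu> (Suc i)" and ?v = "\<lambda>\<gamma>::wt. of_bool (\<gamma> = 0) :: 'k"
  let ?F = "\<lambda>m. E i (\<alpha> + \<alpha> - \<beta> - ?n + Cv m + 1) (\<alpha> + 1) * KR_word \<nu> i"
  have "E (Suc i) (\<alpha> + 1) (\<beta> + 1) * E (Suc i) 0 ?n = sc (s powi lam (\<alpha> + 1) ?n) * E (Suc i) (\<alpha> + 1) (\<beta> + 1 + ?n)"
    by (rule E_mult_eq) (simp_all only: om_def lam_simps, simp_all)
  then have "E (Suc i) (\<alpha> + 1) (\<beta> + 1) * KR_word \<nu> (Suc i) =
      sc (s powi lam (\<alpha> + 1) ?n) * (E (Suc i) (\<alpha> + 1) (\<beta> + 1 + ?n) * KR_word \<nu> i)"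
    unfolding KR_word.simps by (simp only: mult.assoc[symmetric])
  also have "E (Suc i) (\<alpha> + 1) (\<beta> + 1 + ?n) * KR_word \<nu> i = msum I (Suc i) (\<lambda>m. sc (qbins m (\<alpha> + 1)) * ?F m)"
  proof -
    have "\<alpha> + 1 + (\<alpha> + 1) - (\<beta> + 1 + ?n) + Cv m = \<alpha> + \<alpha> - \<beta> - ?n + Cv m + 1" for m
      by (simp add: fun_eq_iff)
    then show ?thesis
      unfolding E_Suc msum_mult[OF fin zero_less_Suc] by (simp only: mult.assoc)
  qed
  finally have "vacuum_coeff \<nu> (Suc i) \<alpha> \<beta> N = s powi lam (\<alpha> + 1) ?n *
      app (msum I (Suc i) (\<lambda>m. sc (qbins m (\<alpha> + 1)) * ?F m) $ N) ?v (- 1)"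
    unfolding vacuum_coeff_def by (simp only: app_sc_mult_nth)
  also have "app (msum I (Suc i) (\<lambda>m. sc (qbins m (\<alpha> + 1)) * ?F m) $ N) ?v (- 1) =
      (\<Sum>m\<in>vecs I N. app ((zz (Suc i * sum m I) * (sc (qbins m (\<alpha> + 1)) * ?F m)) $ N) ?v (- 1))"
    unfolding msum_nth[OF fin zero_less_Suc order_refl] app_sum sum_fun_apply by (rule refl)
  also have "\<dots> = (\<Sum>m\<in>{m \<in> vecs I N. Suc i * sum m I \<le> N}. qbins m (\<alpha> + 1) * vacuum_coeff \<nu> i (\<alpha> + \<alpha> - \<beta> - ?n + Cv m) \<alpha> (N - Suc i * sum m I))"
  proof (rule sum.mono_neutral_cong_right[OF finite_vecs[OF fin]])
    show "\<forall>m\<in>vecs I N - {m \<in> vecs I N. Suc i * sum m I \<le> N}.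
        app ((zz (Suc i * sum m I) * (sc (qbins m (\<alpha> + 1)) * ?F m)) $ N) ?v (- 1) = 0"
    proof
      fix m assume "m \<in> vecs I N - {m \<in> vecs I N. Suc i * sum m I \<le> N}"
      then have "N < Suc i * sum m I" by auto
      then show "app ((zz (Suc i * sum m I) * (sc (qbins m (\<alpha> + 1)) * ?F m)) $ N) ?v (- 1) = 0"
        unfolding zz_nth by (simp only: if_True zero_linop.rep_eq zero_fun_apply)
    qed
  next
    fix m assume "m \<in> {m \<in> vecs I N. Suc i * sum m I \<le> N}"
    then have "\<not> N < Suc i * sum m I" by auto
    then show "app ((zz (Suc i * sum m I) * (sc (qbins m (\<alpha> + 1)) * ?F m)) $ N) ?v (- 1) =
      qbins m (\<alpha> + 1) * vacuum_coeff \<nu> i (\<alpha> + \<alpha> - \<beta> - ?n + Cv m) \<alpha> (N - Suc i * sum m I)"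
      unfolding zz_nth vacuum_coeff_def by (simp only: if_False app_sc_mult_nth)
  qed auto
  finally show ?thesis .
qed

text \<open>
  If \<open>\<alpha>\<^sub>a < 0 \<le> \<beta>\<^sub>a\<close>, the exponents \<open>-\<alpha>\<^sub>a - 1\<close> of \<open>Q\<^bsub>a,i+1\<^esub>\<close> and \<open>\<beta>\<^sub>a + 1\<close> of \<open>Q\<^bsub>a,i\<^esub>\<close> are nonnegative, so
  no negative power of \<open>Q\<^bsub>a,1\<^esub>\<close> can arise from the vacuum.
\<close>

theorem vacuum_coeff_vanishing:
  assumes a: "a \<in> I" and "\<alpha> a < 0" "\<beta> a \<ge> 0" and n: "\<And>j. \<nu> j a \<ge> 0"
  shows "vacuum_coeff \<nu> i \<alpha> \<beta> N = 0"
proof -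
  have KR_word: "KR_word \<nu> j \<in> preserving a" for j
  proof (induction j)
    case 0
    have "E 0 0 0 \<in> preserving a" by (rule E_0_preserving) simp
    then show ?case by (simp only: E_0_0 KR_word.simps)
  next
    case (Suc j)
    have "E (Suc j) 0 (\<nu> (Suc j)) \<in> preserving a"
      using n by (intro E_preserving[OF polynomiality[OF a]]) simp_all
    then show ?case using Suc by (simp only: KR_word.simps preserving_mult)
  qed
  have "E i (\<alpha> + 1) (\<beta> + 1) \<in> preserving a"
    using assms by (intro E_preserving[OF polynomiality[OF a]]) simp_all
  then have "E i (\<alpha> + 1) (\<beta> + 1) * KR_word \<nu> i \<in> preserving a" using KR_word by (rule preserving_mult)
  moreover have "(\<lambda>\<gamma>. of_bool (\<gamma> = 0)) \<in> supported a" by (auto simp: supported_def)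
  ultimately have "app ((E i (\<alpha> + 1) (\<beta> + 1) * KR_word \<nu> i) $ N) (\<lambda>\<gamma>. of_bool (\<gamma> = 0)) \<in> supported a"
    by (rule preservingD)
  then show ?thesis by (simp add: vacuum_coeff_def supported_def)
qed


text \<open>
  In this part vectors are indexed by the level first. \<open>configs i N\<close> collects those living on the
  levels \<open>1, \<dots>, i\<close> with total weight \<open>N\<close>, the exponent of \<open>z\<close>.
\<close>

definition configs :: "nat \<Rightarrow> nat \<Rightarrow> (nat \<Rightarrow> nat \<Rightarrow> nat) set" where
  "configs i N = {m. (\<forall>j b. m j b \<noteq> 0 \<longrightarrow> 1 \<le> j \<and> j \<le> i \<and> b \<in> I) \<and> (\<Sum>j=1..i. j * sum (m j) I) = N}"

text \<open>
  The solution of \<open>p\<^bsub>j-1\<^esub> = 2 p\<^bsub>j\<^esub> - p\<^bsub>j+1\<^esub> - \<nu>\<^bsub>j\<^esub> + C m\<^bsub>j\<^esub>\<close> with \<open>p\<^bsub>i\<^esub> = \<alpha>\<close> and \<open>p\<^bsub>i+1\<^esub> = \<beta>\<close>.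
\<close>

definition vac :: "(nat \<Rightarrow> wt) \<Rightarrow> nat \<Rightarrow> wt \<Rightarrow> wt \<Rightarrow> (nat \<Rightarrow> nat \<Rightarrow> nat) \<Rightarrow> nat \<Rightarrow> wt" where
  "vac \<nu> i \<alpha> \<beta> m j = (\<lambda>a. \<alpha> a + (int i - int j) * (\<alpha> a - \<beta> a) +
    (\<Sum>l=Suc j..i. (int l - int j) * (Cv (m l) a - \<nu> l a)))"

definition weight :: "(nat \<Rightarrow> wt) \<Rightarrow> nat \<Rightarrow> wt \<Rightarrow> wt \<Rightarrow> (nat \<Rightarrow> nat \<Rightarrow> nat) \<Rightarrow> 'k" where
  "weight \<nu> i \<alpha> \<beta> m = (\<Prod>j=1..i. s powi lam (vac \<nu> i \<alpha> \<beta> m j + 1) (\<nu> j) * qbins (m j) (vac \<nu> i \<alpha> \<beta> m j + 1))"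

text \<open>
  The flag \<open>r\<close> selects the restricted sum. Level \<open>0\<close> of the recursion gives the vector of the
  \<open>q\<^bsub>a,0\<^esub>\<close>, which has to vanish.
\<close>

definition admissible :: "bool \<Rightarrow> (nat \<Rightarrow> wt) \<Rightarrow> nat \<Rightarrow> wt \<Rightarrow> wt \<Rightarrow> nat \<Rightarrow> (nat \<Rightarrow> nat \<Rightarrow> nat) set" where
  "admissible r \<nu> i \<alpha> \<beta> N = {m \<in> configs i N. vac \<nu> i \<alpha> \<beta> m 0 = 0 \<and>
    (r \<longrightarrow> (\<forall>j\<in>{1..i}. \<forall>a\<in>I. vac \<nu> i \<alpha> \<beta> m j a \<ge> 0))}"

lemma finite_configs: "finite (configs i N)"
proof (rule finite_subset)
  show "configs i N \<subseteq> {m. \<forall>j. (j \<in> {1..i} \<longrightarrow> m j \<in> vecs I N) \<and> (j \<notin> {1..i} \<longrightarrow> m j = (\<lambda>_. 0))}"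
  proof (intro subsetI CollectI allI conjI impI)
    fix m j assume m: "m \<in> configs i N"
    show "m j = (\<lambda>_. 0)" if "j \<notin> {1..i}"
      using m that by (auto simp: configs_def fun_eq_iff)
    show "m j \<in> vecs I N" if j: "j \<in> {1..i}"
    proof -
      have "1 * sum (m j) I \<le> j * sum (m j) I" using j by (intro mult_le_mono1) simp
      also have "\<dots> \<le> (\<Sum>j=1..i. j * sum (m j) I)" using j by (intro member_le_sum) auto
      finally show ?thesis using m by (auto simp: configs_def vecs_def)
    qed
  qed
  show "finite {m :: nat \<Rightarrow> nat \<Rightarrow> nat. \<forall>j. (j \<in> {1..i} \<longrightarrow> m j \<in> vecs I N) \<and> (j \<notin> {1..i} \<longrightarrow> m j = (\<lambda>_. 0))}"
    by (intro finite_set_of_finite_funs finite_vecs fin) auto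
qed

lemma finite_admissible: "finite (admissible r \<nu> i \<alpha> \<beta> N)"
  by (rule finite_subset[OF _ finite_configs]) (auto simp: admissible_def)

lemma vac_cong: "(\<And>l. 1 \<le> l \<Longrightarrow> l \<le> i \<Longrightarrow> m l = m' l) \<Longrightarrow> vac \<nu> i \<alpha> \<beta> m j = vac \<nu> i \<alpha> \<beta> m' j"
  unfolding vac_def by (intro ext arg_cong2[where f = "(+)"] refl sum.cong) auto

lemma vac_top: "vac \<nu> i \<alpha> \<beta> m i = \<alpha>"
  by (simp add: vac_def)

lemma vac_Suc:
  assumes "j \<le> i"
  shows "vac \<nu> (Suc i) \<alpha> \<beta> m j = vac \<nu> i (\<alpha> + \<alpha> - \<beta> - \<nu> (Suc i) + Cv (m (Suc i))) \<alpha> m j"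
  using assms by (simp add: vac_def fun_eq_iff algebra_simps)

text \<open>
  The restricted and the unrestricted sum have the same value, because both unroll the same
  recursion. In the restricted case, terms of \<open>vacuum_coeff_Suc\<close> that lead to a vector with a
  negative entry at level \<open>i\<close> are missing, and they vanish since the vector at level \<open>i + 1\<close> is
  nonnegative. That is also why the restricted case needs \<open>\<alpha> \<ge> 0\<close>.
\<close>

theorem vacuum_coeff_unroll:
  assumes n: "\<And>j a. a \<in> I \<Longrightarrow> \<nu> j a \<ge> 0" and pos: "r \<Longrightarrow> \<forall>a\<in>I. \<alpha> a \<ge> 0"
  shows "vacuum_coeff \<nu> i \<alpha> \<beta> N = (\<Sum>m\<in>admissible r \<nu> i \<alpha> \<beta> N. weight \<nu> i \<alpha> \<beta> m)"
  using pos
proof (induction i arbitrary: \<alpha> \<beta> N)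
  case 0
  have "configs 0 N = (if N = 0 then {\<lambda>_ _. 0} else {})"
    by (auto simp: configs_def fun_eq_iff)
  moreover have "vac \<nu> 0 \<alpha> \<beta> m 0 = \<alpha>" for m by (rule vac_top)
  ultimately have "admissible r \<nu> 0 \<alpha> \<beta> N = (if N = 0 \<and> \<alpha> = 0 then {\<lambda>_ _. 0} else {})"
    by (auto simp: admissible_def)
  then show ?case by (simp add: vacuum_coeff_0 weight_def)
next
  case (Suc i)
  let ?n = "\<nu> (Suc i)"
  let ?M = "{u \<in> vecs I N. Suc i * sum u I \<le> N}"
  define \<alpha>' where "\<alpha>' u = \<alpha> + \<alpha> - \<beta> - ?n + Cv u" for u
  let ?A = "\<lambda>u. admissible r \<nu> i (\<alpha>' u) \<alpha> (N - Suc i * sum u I)"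
  have IH: "vacuum_coeff \<nu> i (\<alpha>' u) \<alpha> K = (\<Sum>m\<in>admissible r \<nu> i (\<alpha>' u) \<alpha> K. weight \<nu> i (\<alpha>' u) \<alpha> m)" for u K
  proof (cases "r \<longrightarrow> (\<forall>a\<in>I. \<alpha>' u a \<ge> 0)")
    case True
    then show ?thesis using Suc.IH[of "\<alpha>' u" \<alpha> K] by simp
  next
    case False
    then obtain a where a: "a \<in> I" "\<alpha>' u a < 0" and r by force
    then have "vacuum_coeff \<nu> i (\<alpha>' u) \<alpha> K = 0"
      using Suc.prems n by (intro vacuum_coeff_vanishing[of a]) auto
    moreover have "admissible r \<nu> i (\<alpha>' u) \<alpha> K = {}"
    proof (cases "i = 0")
      case True
      then have "vac \<nu> i (\<alpha>' u) \<alpha> m 0 \<noteq> 0" for m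
        using a(2) vac_top[of \<nu> i "\<alpha>' u" \<alpha> m] by auto
      then show ?thesis by (simp add: admissible_def)
    next
      case False
      then have "i \<in> {1..i}" by simp
      moreover have "vac \<nu> i (\<alpha>' u) \<alpha> m i a < 0" for m using a vac_top by simp
      ultimately have "\<not> (\<forall>j\<in>{1..i}. \<forall>a\<in>I. vac \<nu> i (\<alpha>' u) \<alpha> m j a \<ge> 0)" for m
        using a(1) by (metis linorder_not_le)
      then show ?thesis using \<open>r\<close> by (simp add: admissible_def)
    qed
    ultimately show ?thesis by simp
  qed
  have vac': "vac \<nu> (Suc i) \<alpha> \<beta> (m(Suc i := u)) j = vac \<nu> i (\<alpha>' u) \<alpha> m j" if "j \<le> i" for m u j
  proof -
    have "vac \<nu> (Suc i) \<alpha> \<beta> (m(Suc i := u)) j = vac \<nu> i (\<alpha>' u) \<alpha> (m(Suc i := u)) j"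
      unfolding vac_Suc[OF that] \<alpha>'_def by simp
    also have "\<dots> = vac \<nu> i (\<alpha>' u) \<alpha> m j" by (rule vac_cong) simp
    finally show ?thesis .
  qed
  have weight': "weight \<nu> (Suc i) \<alpha> \<beta> (m(Suc i := u)) =
      s powi lam (\<alpha> + 1) ?n * (qbins u (\<alpha> + 1) * weight \<nu> i (\<alpha>' u) \<alpha> m)" for m u
  proof -
    have "weight \<nu> i (\<alpha>' u) \<alpha> m =
      (\<Prod>j=1..i. s powi lam (vac \<nu> (Suc i) \<alpha> \<beta> (m(Suc i := u)) j + 1) (\<nu> j) *
        qbins ((m(Suc i := u)) j) (vac \<nu> (Suc i) \<alpha> \<beta> (m(Suc i := u)) j + 1))"
      unfolding weight_def by (rule prod.cong[OF refl]) (simp add: vac')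
    then show ?thesis
      by (simp add: weight_def vac_top mult_ac)
  qed
  have mem: "m(Suc i := u) \<in> admissible r \<nu> (Suc i) \<alpha> \<beta> N \<longleftrightarrow> u \<in> ?M \<and> m \<in> ?A u"
    if m: "m (Suc i) = (\<lambda>_. 0)" for m u
  proof -
    have eq: "(\<Sum>j=1..Suc i. j * sum ((m(Suc i := u)) j) I) = (\<Sum>j=1..i. j * sum (m j) I) + Suc i * sum u I"
    proof -
      have "(\<Sum>j=1..i. j * sum ((m(Suc i := u)) j) I) = (\<Sum>j=1..i. j * sum (m j) I)"
        by (rule sum.cong) auto
      then show ?thesis by simp
    qed
    have supp: "(\<forall>j b. (m(Suc i := u)) j b \<noteq> 0 \<longrightarrow> 1 \<le> j \<and> j \<le> Suc i \<and> b \<in> I) \<longleftrightarrow>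
        (\<forall>b. b \<notin> I \<longrightarrow> u b = 0) \<and> (\<forall>j b. m j b \<noteq> 0 \<longrightarrow> 1 \<le> j \<and> j \<le> i \<and> b \<in> I)" (is "?L \<longleftrightarrow> ?R1 \<and> ?R2")
    proof safe
      fix b assume L: ?L and "b \<notin> I"
      then show "u b = 0" using L[rule_format, of "Suc i" b] by auto
    next
      fix j b assume L: ?L and mj: "m j b > 0"
      then have "j \<noteq> Suc i" using m by auto
      then show "1 \<le> j" "j \<le> i" "b \<in> I" using L[rule_format, of j b] mj by auto
    next
      fix j b assume R: ?R1 ?R2 and nz: "(m(Suc i := u)) j b > 0"
      show "1 \<le> j" "j \<le> Suc i" "b \<in> I"
        using R(1)[rule_format, of b] R(2)[rule_format, of j b] nz by (auto split: if_splits)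
    qed
    have conf: "m(Suc i := u) \<in> configs (Suc i) N \<longleftrightarrow> u \<in> ?M \<and> m \<in> configs i (N - Suc i * sum u I)"
    proof -
      have "sum u I \<le> Suc i * sum u I" by simp
      then have "(\<Sum>j=1..i. j * sum (m j) I) + Suc i * sum u I = N \<longleftrightarrow>
          sum u I \<le> N \<and> Suc i * sum u I \<le> N \<and> (\<Sum>j=1..i. j * sum (m j) I) = N - Suc i * sum u I"
        by linarith
      then show ?thesis unfolding configs_def mem_Collect_eq supp eq vecs_def by blast
    qed
    have "(\<forall>j\<in>{1..Suc i}. \<forall>a\<in>I. vac \<nu> (Suc i) \<alpha> \<beta> (m(Suc i := u)) j a \<ge> 0) \<longleftrightarrow>
        (\<forall>j\<in>{1..i}. \<forall>a\<in>I. vac \<nu> i (\<alpha>' u) \<alpha> m j a \<ge> 0)" if r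
    proof -
      have "{1..Suc i} = insert (Suc i) {1..i}" by auto
      then show ?thesis using Suc.prems[OF that] by (simp add: vac_top vac')
    qed
    then show ?thesis
      unfolding admissible_def mem_Collect_eq conf by (auto simp: vac')
  qed
  have "vacuum_coeff \<nu> (Suc i) \<alpha> \<beta> N = s powi lam (\<alpha> + 1) ?n * (\<Sum>u\<in>?M. qbins u (\<alpha> + 1) * vacuum_coeff \<nu> i (\<alpha>' u) \<alpha> (N - Suc i * sum u I))"
    unfolding vacuum_coeff_Suc \<alpha>'_def by (rule refl)
  also have "\<dots> = (\<Sum>u\<in>?M. \<Sum>m\<in>?A u. weight \<nu> (Suc i) \<alpha> \<beta> (m(Suc i := u)))"
    unfolding IH weight' sum_distrib_left by (rule refl)
  also have "\<dots> = (\<Sum>x\<in>Sigma ?M ?A. weight \<nu> (Suc i) \<alpha> \<beta> ((snd x)(Suc i := fst x)))"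
    by (subst sum.Sigma) (simp_all add: finite_vecs[OF fin] finite_admissible case_prod_beta)
  also have "\<dots> = (\<Sum>m\<in>admissible r \<nu> (Suc i) \<alpha> \<beta> N. weight \<nu> (Suc i) \<alpha> \<beta> m)"
  proof (rule sum.reindex_bij_witness[of _ "\<lambda>m. (m (Suc i), m(Suc i := (\<lambda>_. 0)))" "\<lambda>x. (snd x)(Suc i := fst x)"])
    fix x assume x: "x \<in> Sigma ?M ?A"
    have "snd x \<in> configs i (N - Suc i * sum (fst x) I)" using x by (auto simp: admissible_def)
    then have "snd x (Suc i) b \<noteq> 0 \<Longrightarrow> Suc i \<le> i" for b by (simp add: configs_def)
    then have "snd x (Suc i) = (\<lambda>_. 0)" by (metis Suc_n_not_le_n)
    then show "(((snd x)(Suc i := fst x)) (Suc i), ((snd x)(Suc i := fst x))(Suc i := \<lambda>_. 0)) = x"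
      by (simp add: prod_eq_iff fun_upd_idem)
    show "(snd x)(Suc i := fst x) \<in> admissible r \<nu> (Suc i) \<alpha> \<beta> N"
      using x mem[of "snd x" "fst x"] \<open>snd x (Suc i) = _\<close> by auto
  next
    fix m assume m: "m \<in> admissible r \<nu> (Suc i) \<alpha> \<beta> N"
    have up: "(m(Suc i := (\<lambda>_. 0)))(Suc i := m (Suc i)) = m" by simp
    show "(snd (m (Suc i), m(Suc i := \<lambda>_. 0)))(Suc i := fst (m (Suc i), m(Suc i := \<lambda>_. 0))) = m"
      by simp
    show "(m (Suc i), m(Suc i := \<lambda>_. 0)) \<in> Sigma ?M ?A"
      using mem[of "m(Suc i := (\<lambda>_. 0))" "m (Suc i)"] m unfolding up by simp
  qed auto
  finally show ?case .
qed

corollary restricted_eq_unrestricted: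
  assumes "\<And>j a. a \<in> I \<Longrightarrow> \<nu> j a \<ge> 0" "\<And>a. a \<in> I \<Longrightarrow> \<alpha> a \<ge> 0"
  shows "(\<Sum>m\<in>admissible True \<nu> i \<alpha> \<beta> N. weight \<nu> i \<alpha> \<beta> m) = (\<Sum>m\<in>admissible False \<nu> i \<alpha> \<beta> N. weight \<nu> i \<alpha> \<beta> m)"
  using vacuum_coeff_unroll[of \<nu> True \<alpha> i \<beta> N] vacuum_coeff_unroll[of \<nu> False \<alpha> i \<beta> N] assms by simp

end

section \<open>Comparison with the fermionic sums\<close>

lemma v_binom_qbin:
  assumes "generic_element v"
  shows "v_binom (v ^ 2) m p = v powi (int m * p) * qbin v m (p + 1)"
proof (induction m)
  case (Suc m)
  interpret generic_element v by (rule assms)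
  have qint: "qint v k = - (v powi (- k)) * (1 - (v ^ 2) powi k)" for k
  proof -
    have "(v ^ 2) powi k = v powi k * v powi k"
      by (simp add: power2_eq_square power_int_mult_distrib)
    moreover have "v powi (- k) * v powi k = 1"
      using nonzero by (simp add: power_int_minus)
    ultimately show ?thesis by (simp add: qint_def algebra_simps)
  qed
  let ?j = "int (Suc m)"
  have A: "v powi p * (qint v (p + 1 + int m) / qint v ?j) = (1 - (v ^ 2) powi (p + ?j)) / (1 - (v ^ 2) powi ?j)"
  proof -
    have "v powi p * v powi (- (p + ?j)) = v powi (- ?j)"
      using nonzero by (simp add: power_int_add[symmetric])
    then have "v powi p * qint v (p + ?j) = - (v powi (- ?j)) * (1 - (v ^ 2) powi (p + ?j))"
      unfolding qint by (simp add: mult.assoc[symmetric])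
    moreover have "v powi (- ?j) \<noteq> 0" using nonzero by simp
    ultimately show ?thesis
      unfolding times_divide_eq_right qint[of ?j] by (simp add: add.assoc add.commute[of 1])
  qed
  have "v_binom (v ^ 2) (Suc m) p = v_binom (v ^ 2) m p * ((1 - (v ^ 2) powi (p + ?j)) / (1 - (v ^ 2) ^ Suc m))"
    unfolding v_binom_def by (simp only: prod.atLeast_Suc_atMost_Suc_shift prod.cl_ivl_Suc) simp
  also have "\<dots> = (v powi (int m * p) * qbin v m (p + 1)) * (v powi p * (qint v (p + 1 + int m) / qint v ?j))"
    unfolding A by (simp only: Suc.IH power_int_of_nat)
  also have "\<dots> = (v powi (int m * p) * v powi p) * qbin v (Suc m) (p + 1)"
    by (simp only: qbin_Suc mult_ac)
  also have "v powi (int m * p) * v powi p = v powi (?j * p)"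
    using nonzero by (simp add: algebra_simps power_int_add)
  finally show ?case .
qed (simp add: v_binom_def)

context qsystem
begin

lemma lam_sum_left: "lam (\<lambda>a. \<Sum>i\<in>S. c i * f i a) \<beta> = (\<Sum>i\<in>S. c i * lam (f i) \<beta>)"
proof (induction S rule: infinite_finite_induct)
  case (insert x S)
  have "(\<lambda>a. \<Sum>i\<in>insert x S. c i * f i a) = (\<lambda>a. c x * f x a) + (\<lambda>a. \<Sum>i\<in>S. c i * f i a)"
    using insert by (simp add: fun_eq_iff)
  moreover have "lam (\<lambda>a. c x * f x a) \<beta> = c x * lam (f x) \<beta>"
    by (simp add: lam_def sum_distrib_left mult_ac)
  ultimately show ?case using insert by (simp only: lam_add_left sum.insert not_False_eq_True)
qed (simp_all add: lam_def)

lemma powi_sum: "s powi (\<Sum>i\<in>S. f i) = (\<Prod>i\<in>S. s powi f i)"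
  by (induction S rule: infinite_finite_induct) (simp_all add: powi_add)

end

definition cartan_on :: "twisted_type \<Rightarrow> nat \<Rightarrow> nat \<Rightarrow> int" where
  "cartan_on X a b = (if a \<in> I_r X \<and> b \<in> I_r X then cartan X a b else 0)"

locale twisted_qsystem = qsystem "I_r X" "cartan_on X" L "\<lambda>a. 2 * t_expl X a" s
  for X :: twisted_type and L :: "nat \<Rightarrow> nat \<Rightarrow> int" and s :: "'k::field" +
  fixes l :: "nat \<Rightarrow> nat" and n :: "nat \<Rightarrow> nat \<Rightarrow> nat" and k :: nat
  assumes X: "is_twisted_type X" and n: "n \<in> fin_vecs X"
    and n_bound: "\<And>a i. n a i \<noteq> 0 \<Longrightarrow> i \<le> k"
begin

abbreviation "I \<equiv> I_r X"

definition nw :: "nat \<Rightarrow> wt" where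
  "nw j = (\<lambda>a. int (n a j))"

definition lw :: wt where
  "lw = (\<lambda>a. if a \<in> I then int (l a) else 0)"

definition solutions :: "(nat \<Rightarrow> nat \<Rightarrow> nat) set" where
  "solutions = {m \<in> fin_vecs X. \<forall>a\<in>I. q_zero X l m n a = 0}"

definition levels :: "(nat \<Rightarrow> nat \<Rightarrow> nat) \<Rightarrow> nat \<Rightarrow> nat \<Rightarrow> nat" where
  "levels m j = (\<lambda>a. m a j)"

text \<open>
  The vacancy numbers \<open>p\<^bsub>a,i\<^esub>\<close>, extended by zero outside of the rank.
\<close>

definition vacancy :: "(nat \<Rightarrow> nat \<Rightarrow> nat) \<Rightarrow> nat \<Rightarrow> wt" where
  "vacancy m i = (\<lambda>a. \<Sum>j=1..k. int (min i j) * (nw j - Cv (levels m j)) a)"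

text \<open>
  The part of the exponent of \<open>s\<close> that depends on \<open>n\<close> alone; it is common to all terms of the sums.
\<close>

definition const_exp :: int where
  "const_exp = (\<Sum>j=1..k. lam 1 (nw j) + (\<Sum>i=1..k. int (min j i) * lam (nw i) (nw j)))"

context
  fixes m :: "nat \<Rightarrow> nat \<Rightarrow> nat"
  assumes m: "m \<in> fin_vecs X" and m_bound: "\<And>a i. m a i \<noteq> 0 \<Longrightarrow> i \<le> k"
begin

abbreviation "mt \<equiv> levels m"
abbreviation "pw \<equiv> vacancy m"

lemma zero_beyond: "i > k \<Longrightarrow> m a i = 0" "i > k \<Longrightarrow> n a i = 0"
  using m_bound n_bound by (metis not_le)+

lemma m_zero: "m a 0 = 0" "a \<notin> I \<Longrightarrow> m a i = 0" "a \<notin> I \<Longrightarrow> n a i = 0"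
  using m n by (auto simp: fin_vecs_def)

lemma Cv_mt: "a \<in> I \<Longrightarrow> Cv (mt j) a = (\<Sum>b\<in>I. cartan X a b * int (m b j))"
  by (simp add: Cv_def cartan_on_def levels_def)

lemma outside: "a \<notin> I \<Longrightarrow> Cv u a = 0" "a \<notin> I \<Longrightarrow> nw j a = 0"
  using m_zero by (simp_all add: Cv_def cartan_on_def nw_def)

lemma Sum_any_upto:
  fixes f :: "nat \<Rightarrow> 'b::comm_monoid_add"
  assumes "f 0 = 0" "\<And>j. j > k \<Longrightarrow> f j = 0"
  shows "Sum_any f = (\<Sum>j=1..k. f j)"
proof (rule Sum_any.expand_superset)
  show "{j. f j \<noteq> 0} \<subseteq> {1..k}"
  proof
    fix j assume "j \<in> {j. f j \<noteq> 0}"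
    then have "j \<noteq> 0" "\<not> j > k" using assms by (auto intro: ccontr)
    then show "j \<in> {1..k}" by simp
  qed
qed simp

lemma inner_sum:
  assumes "a \<in> I"
  shows "(\<Sum>b\<in>I. x * (of_bool (a = b) * int (n b j) - cartan X a b * int (m b j))) = x * (nw j - Cv (mt j)) a"
proof -
  have "(\<Sum>b\<in>I. x * (of_bool (a = b) * int (n b j) - cartan X a b * int (m b j))) =
     x * ((\<Sum>b\<in>I. if a = b then int (n b j) else 0) - (\<Sum>b\<in>I. cartan X a b * int (m b j)))"
    unfolding sum_subtractf[symmetric] sum_distrib_left by (rule sum.cong) auto
  then show ?thesis using assms by (simp add: Cv_mt nw_def)
qed

lemma p_vac_eq:
  assumes "a \<in> I"
  shows "p_vac X m n a i = pw i a"
  unfolding p_vac_def inner_sum[OF assms] vacancy_def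
  using assms by (intro Sum_any_upto) (simp_all add: Cv_mt nw_def zero_beyond)

lemma q_zero_sum:
  assumes "a \<in> I"
  shows "q_zero X l m n a = lw a + (\<Sum>j=1..k. int j * (Cv (mt j) a - nw j a))"
proof -
  have "(\<Sum>b\<in>I. int j * (cartan X a b * int (m b j) - of_bool (a = b) * int (n b j))) =
      int j * (Cv (mt j) a - nw j a)" for j
    using inner_sum[OF assms, of "- int j" j] by (simp add: sum_negf[symmetric] algebra_simps)
  then have "q_zero X l m n a = int (l a) + Sum_any (\<lambda>j. int j * (Cv (mt j) a - nw j a))"
    unfolding q_zero_def by (simp only:)
  also have "Sum_any (\<lambda>j. int j * (Cv (mt j) a - nw j a)) = (\<Sum>j=1..k. int j * (Cv (mt j) a - nw j a))"
    using assms by (intro Sum_any_upto) (simp_all add: Cv_mt nw_def zero_beyond)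
  finally show ?thesis using assms by (simp add: lw_def)
qed

lemma vac_0: "vac nw k lw lw mt 0 = 0 \<longleftrightarrow> (\<forall>a\<in>I. q_zero X l m n a = 0)"
proof -
  have "vac nw k lw lw mt 0 a = q_zero X l m n a" if "a \<in> I" for a
    using q_zero_sum[OF that] by (simp add: vac_def)
  moreover have "vac nw k lw lw mt 0 a = 0" if "a \<notin> I" for a
    using that by (simp add: vac_def outside lw_def)
  ultimately show ?thesis unfolding fun_eq_iff zero_fun_apply by metis
qed

text \<open>
  \<open>p\<^bsub>j\<^esub> - p\<^bsub>0\<^esub>\<close> in the recursion is \<open>\<Sum>\<^bsub>i\<^esub> min(j, i) (n\<^bsub>i\<^esub> - C m\<^bsub>i\<^esub>)\<close>, as \<open>i - min(j, i)\<close> is the positive part of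
  \<open>i - j\<close>.
\<close>

lemma vac_pw:
  assumes "vac nw k lw lw mt 0 = 0" "j \<le> k"
  shows "vac nw k lw lw mt j = pw j"
proof
  fix a
  have "vac nw k lw lw mt j a - vac nw k lw lw mt 0 a = pw j a"
  proof -
    let ?x = "\<lambda>i. (Cv (mt i) a - nw i a)"
    have "(\<Sum>i=Suc j..k. (int i - int j) * ?x i) = (\<Sum>i=1..k. (int i - int (min j i)) * ?x i)"
      by (rule sum.mono_neutral_cong_left) (auto simp: min_def)
    then have "vac nw k lw lw mt j a - vac nw k lw lw mt 0 a =
       (\<Sum>i=1..k. (int i - int (min j i)) * ?x i) - (\<Sum>i=1..k. int i * ?x i)"
      by (simp add: vac_def)
    also have "\<dots> = pw j a"
      unfolding vacancy_def sum_subtractf[symmetric] by (rule sum.cong) (simp_all add: algebra_simps)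
    finally show ?thesis .
  qed
  then show "vac nw k lw lw mt j a = pw j a" using assms(1) by simp
qed

lemma p_vac_nonneg_iff:
  assumes "vac nw k lw lw mt 0 = 0"
  shows "(\<forall>a\<in>I. \<forall>i\<ge>1. p_vac X m n a i \<ge> 0) \<longleftrightarrow> (\<forall>j\<in>{1..k}. \<forall>a\<in>I. vac nw k lw lw mt j a \<ge> 0)"
proof -
  have large: "pw i a = lw a" if "i \<ge> k" for i a
  proof -
    have "pw i a = pw k a" unfolding vacancy_def using that by (intro sum.cong) auto
    also have "pw k = lw" using vac_pw[OF assms, of k] by (simp add: vac_top)
    finally show ?thesis by simp
  qed
  have "lw a \<ge> 0" for a by (simp add: lw_def)
  then have *: "pw i a \<ge> 0" if "i \<ge> k" for i a using large[OF that] by simp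
  show ?thesis
  proof
    assume "\<forall>a\<in>I. \<forall>i\<ge>1. p_vac X m n a i \<ge> 0"
    then show "\<forall>j\<in>{1..k}. \<forall>a\<in>I. vac nw k lw lw mt j a \<ge> 0"
      using vac_pw[OF assms] by (simp add: p_vac_eq)
  next
    assume A: "\<forall>j\<in>{1..k}. \<forall>a\<in>I. vac nw k lw lw mt j a \<ge> 0"
    show "\<forall>a\<in>I. \<forall>i\<ge>1. p_vac X m n a i \<ge> 0"
    proof (intro ballI allI impI)
      fix a i assume "a \<in> I" "(1::nat) \<le> i"
      then show "p_vac X m n a i \<ge> 0"
        using A[rule_format, of i a] vac_pw[OF assms, of i] *[of i a] by (cases "i \<le> k") (simp_all add: p_vac_eq)
    qed
  qed
qed

lemma Q_dbl_eq:
  "Q_dbl X m n + (\<Sum>i=1..k. \<Sum>a\<in>I. t_expl X a * int (m a i) * pw i a) =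
    - (\<Sum>i=1..k. \<Sum>j=1..k. \<Sum>a\<in>I. t_expl X a * int (min i j) * int (m a i) * int (n a j))"
proof -
  have inner: "(\<Sum>a\<in>I. \<Sum>b\<in>I. t_vee X a * int (min i j) * int (m a i) *
         (cartan X a b * int (m b j) - 2 * of_bool (a = b) * int (n b j))) =
      (\<Sum>a\<in>I. t_expl X a * int (min i j) * int (m a i) * (Cv (mt j) a - 2 * nw j a))" for i j
  proof (rule sum.cong[OF refl])
    fix a assume a: "a \<in> I"
    have "(\<Sum>b\<in>I. cartan X a b * int (m b j) - 2 * of_bool (a = b) * int (n b j)) = Cv (mt j) a - 2 * nw j a"
    proof -
      have "(\<Sum>b\<in>I. 2 * of_bool (a = b) * int (n b j)) = (\<Sum>b\<in>I. if a = b then 2 * int (n b j) else 0)"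
        by (rule sum.cong) auto
      then show ?thesis using a by (simp add: sum_subtractf Cv_mt nw_def)
    qed
    then show "(\<Sum>b\<in>I. t_vee X a * int (min i j) * int (m a i) *
         (cartan X a b * int (m b j) - 2 * of_bool (a = b) * int (n b j))) =
      t_expl X a * int (min i j) * int (m a i) * (Cv (mt j) a - 2 * nw j a)"
      by (simp only: sum_distrib_left[symmetric] t_vee_eq[OF X])
  qed
  have "Q_dbl X m n = Sum_any (\<lambda>i. Sum_any (\<lambda>j. \<Sum>a\<in>I. t_expl X a * int (min i j) * int (m a i) * (Cv (mt j) a - 2 * nw j a)))"
    unfolding Q_dbl_def inner by (rule refl)
  also have "\<dots> = Sum_any (\<lambda>i. \<Sum>j=1..k. \<Sum>a\<in>I. t_expl X a * int (min i j) * int (m a i) * (Cv (mt j) a - 2 * nw j a))"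
    by (intro arg_cong[where f = Sum_any] ext Sum_any_upto) (simp_all add: Cv_mt nw_def zero_beyond)
  also have "\<dots> = (\<Sum>i=1..k. \<Sum>j=1..k. \<Sum>a\<in>I. t_expl X a * int (min i j) * int (m a i) * (Cv (mt j) a - 2 * nw j a))"
    by (intro Sum_any_upto) (simp_all add: zero_beyond)
  finally have Q: "Q_dbl X m n = \<dots>" .
  have R: "(\<Sum>i=1..k. \<Sum>j=1..k. \<Sum>a\<in>I. t_expl X a * int (min i j) * int (m a i) * (Cv (mt j) a - 2 * nw j a)) +
      (\<Sum>i=1..k. \<Sum>a\<in>I. t_expl X a * int (m a i) * pw i a) =
      (\<Sum>i=1..k. \<Sum>j=1..k. \<Sum>a\<in>I. - (t_expl X a * int (min i j) * int (m a i) * int (n a j)))"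
  proof -
    have "(\<Sum>a\<in>I. t_expl X a * int (m a i) * pw i a) =
        (\<Sum>j=1..k. \<Sum>a\<in>I. t_expl X a * int (m a i) * (int (min i j) * (nw j - Cv (mt j)) a))" for i
      unfolding vacancy_def sum_distrib_left by (rule sum.swap)
    moreover have "- (t_expl X a * int (min i j) * int (m a i) * int (n a j)) =
        t_expl X a * int (min i j) * int (m a i) * (Cv (mt j) a - 2 * nw j a) +
        t_expl X a * int (m a i) * (int (min i j) * (nw j - Cv (mt j)) a)" for i j a
      by (simp add: nw_def algebra_simps)
    ultimately show ?thesis by (simp only: sum.distrib)
  qed
  show ?thesis unfolding Q R by (simp only: sum_negf)
qed

text \<open>
  The quadratic form \<open>Q\<close> is absorbed by the symmetric normalization of the binomial coefficients: the
  terms quadratic in \<open>m\<close> cancel, and what is left is linear in \<open>m\<close> and equals the exponent produced by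
  the factors \<open>Q\<^bsub>j\<^esub>\<^bsup>n\<^sub>j\<^esup>\<close>.
\<close>

lemma exponent:
  "2 * Q_dbl X m n + (\<Sum>i=1..k. \<Sum>a\<in>I. 2 * t_expl X a * int (m a i) * pw i a) =
    (\<Sum>j=1..k. lam (pw j + 1) (nw j)) - const_exp"
proof -
  have "lam (pw j + 1) (nw j) = lam 1 (nw j) + (\<Sum>i=1..k. int (min j i) * lam (nw i) (nw j)) -
      (\<Sum>i=1..k. int (min j i) * (\<Sum>a\<in>I. 2 * t_expl X a * int (m a i) * int (n a j)))" for j
    unfolding lam_add_left vacancy_def lam_sum_left lam_diff_left lam_Cv
    by (simp add: right_diff_distrib sum_subtractf levels_def nw_def)
  then have "(\<Sum>j=1..k. lam (pw j + 1) (nw j)) - const_exp =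
      - (\<Sum>j=1..k. \<Sum>i=1..k. int (min j i) * (\<Sum>a\<in>I. 2 * t_expl X a * int (m a i) * int (n a j)))"
    by (simp add: const_exp_def sum.distrib sum_subtractf)
  also have "\<dots> = - (\<Sum>i=1..k. \<Sum>j=1..k. int (min j i) * (\<Sum>a\<in>I. 2 * t_expl X a * int (m a i) * int (n a j)))"
    by (rule arg_cong[where f = uminus], rule sum.swap)
  also have "\<dots> = - (2 * (\<Sum>i=1..k. \<Sum>j=1..k. \<Sum>a\<in>I. t_expl X a * int (min i j) * int (m a i) * int (n a j)))"
    unfolding sum_distrib_left by (intro arg_cong[where f = uminus] sum.cong refl) (simp add: min.commute)
  also have "\<dots> = 2 * (Q_dbl X m n + (\<Sum>i=1..k. \<Sum>a\<in>I. t_expl X a * int (m a i) * pw i a))"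
    unfolding Q_dbl_eq by simp
  finally show ?thesis by (simp add: sum_distrib_left mult_ac)
qed

lemma fermionic_term_weight:
  assumes "vac nw k lw lw mt 0 = 0"
  shows "fermionic_term X m n (s ^ 4) = s powi (- const_exp) * weight nw k lw lw mt"
proof -
  have q: "(s ^ 4) powi Q_form X m n = s powi (2 * Q_dbl X m n)"
  proof -
    have "(s ^ 4) powi Q_form X m n = (s powi 4) powi Q_form X m n" by simp
    also have "\<dots> = s powi (4 * Q_form X m n)" by (rule power_int_mult[symmetric])
    also have "4 * Q_form X m n = 2 * Q_dbl X m n"
      using even_Q_dbl[OF X m n] by (simp add: Q_form_def)
    finally show ?thesis .
  qed
  have b: "v_binom ((s ^ 4) powi t_vee X a) (m a i) (p_vac X m n a i) =
      s powi (2 * t_expl X a * int (m a i) * pw i a) * qbin (v a) (m a i) (pw i a + 1)" if "a \<in> I" for a i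
  proof -
    have "(s ^ 4) powi t_vee X a = s powi (4 * t_expl X a)"
      by (simp only: t_vee_eq[OF X] power_int_mult power_int_numeral)
    also have "4 * t_expl X a = (2 * t_expl X a) * int 2" by simp
    also have "s powi ((2 * t_expl X a) * int 2) = v a ^ 2" by (simp only: power_int_mult power_int_of_nat)
    finally show ?thesis
      unfolding p_vac_eq[OF that] by (simp only: v_binom_qbin[OF generic_v[OF that]] power_int_mult[symmetric] mult.assoc)
  qed
  have "Prod_any (\<lambda>i. \<Prod>a\<in>I. v_binom ((s ^ 4) powi t_vee X a) (m a i) (p_vac X m n a i)) =
      (\<Prod>i=1..k. \<Prod>a\<in>I. v_binom ((s ^ 4) powi t_vee X a) (m a i) (p_vac X m n a i))"
  proof (rule Prod_any.expand_superset)
    show "{i. (\<Prod>a\<in>I. v_binom ((s ^ 4) powi t_vee X a) (m a i) (p_vac X m n a i)) \<noteq> 1} \<subseteq> {1..k}"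
    proof (rule subsetI, rule ccontr)
      fix i assume i: "i \<in> {i. (\<Prod>a\<in>I. v_binom ((s ^ 4) powi t_vee X a) (m a i) (p_vac X m n a i)) \<noteq> 1}" "i \<notin> {1..k}"
      then have "m a i = 0" for a using m_zero zero_beyond by (cases "i = 0") auto
      then show False using i(1) by (simp add: v_binom_def)
    qed
  qed simp
  also have "\<dots> = (\<Prod>i=1..k. (\<Prod>a\<in>I. s powi (2 * t_expl X a * int (m a i) * pw i a)) * qbins (mt i) (pw i + 1))"
    by (rule prod.cong[OF refl]) (simp add: b prod.distrib levels_def)
  also have "\<dots> = s powi (\<Sum>i=1..k. \<Sum>a\<in>I. 2 * t_expl X a * int (m a i) * pw i a) * (\<Prod>i=1..k. qbins (mt i) (pw i + 1))"
    by (simp only: powi_sum prod.distrib)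
  finally have "fermionic_term X m n (s ^ 4) =
      s powi (2 * Q_dbl X m n + (\<Sum>i=1..k. \<Sum>a\<in>I. 2 * t_expl X a * int (m a i) * pw i a)) * (\<Prod>i=1..k. qbins (mt i) (pw i + 1))"
    unfolding fermionic_term_def q by (simp only: powi_add mult.assoc)
  also have "\<dots> = s powi (- const_exp) * (s powi (\<Sum>j=1..k. lam (pw j + 1) (nw j)) * (\<Prod>i=1..k. qbins (mt i) (pw i + 1)))"
    unfolding exponent diff_conv_add_uminus powi_add by (simp only: mult_ac)
  also have "s powi (\<Sum>j=1..k. lam (pw j + 1) (nw j)) * (\<Prod>i=1..k. qbins (mt i) (pw i + 1)) = weight nw k lw lw mt"
    unfolding powi_sum prod.distrib[symmetric] weight_def
    by (rule prod.cong[OF refl]) (simp only: vac_pw[OF assms] atLeastAtMost_iff)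
  finally show ?thesis .
qed

end


text \<open>
  Both sums are sorted by the total weight, which is the exponent of \<open>z\<close>. Each weight contributes the
  sum of \<open>restricted_eq_unrestricted\<close> with \<open>\<alpha> = \<beta> = \<ell>\<close>, the constant value of the vacancy numbers
  at and above the level \<open>k\<close>.
\<close>

lemma fermionic_sums_agree:
  assumes bound: "\<And>m a i. m \<in> solutions \<Longrightarrow> m a i \<noteq> 0 \<Longrightarrow> i \<le> k"
  shows "fermionic_M X l n (inverse (s ^ 4)) = fermionic_M_tilde X l n (inverse (s ^ 4))"
proof -
  define sol where "sol r = {m \<in> solutions. r \<longrightarrow> (\<forall>a\<in>I. \<forall>i\<ge>1. p_vac X m n a i \<ge> 0)}" for r
  define wgt where "wgt m = (\<Sum>j=1..k. j * sum (levels m j) I)" for m :: "nat \<Rightarrow> nat \<Rightarrow> nat"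
  let ?term = "\<lambda>m. fermionic_term X m n (s ^ 4)" and ?T = "wgt ` solutions"
  have fin_sol: "finite solutions"
    unfolding solutions_def by (rule finite_weight_set[OF X n])
  have fiber: "(\<Sum>m\<in>{m \<in> sol r. wgt m = N}. ?term m) =
      (\<Sum>M\<in>admissible r nw k lw lw N. s powi (- const_exp) * weight nw k lw lw M)" for r N
  proof (rule sum.reindex_bij_witness[of _ "\<lambda>M a j. M j a" levels])
    fix m assume m: "m \<in> {m \<in> sol r. wgt m = N}"
    then have sol: "m \<in> solutions" "m \<in> fin_vecs X" and b: "\<And>a i. m a i \<noteq> 0 \<Longrightarrow> i \<le> k"
      using bound by (auto simp: sol_def solutions_def)
    have v0: "vac nw k lw lw (levels m) 0 = 0"
      using vac_0[OF sol(2) b] sol(1) by (auto simp: solutions_def)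
    show "(\<lambda>a j. levels m j a) = m" by (simp add: levels_def)
    have "levels m \<in> configs k N"
    proof -
      have "levels m j a \<noteq> 0 \<longrightarrow> 1 \<le> j \<and> j \<le> k \<and> a \<in> I" for j a
        using sol(2) b by (simp add: levels_def fin_vecs_def)
      moreover have "(\<Sum>j=1..k. j * sum (levels m j) I) = N" using m by (simp add: wgt_def)
      ultimately show ?thesis by (simp add: configs_def)
    qed
    moreover have "r \<longrightarrow> (\<forall>j\<in>{1..k}. \<forall>a\<in>I. vac nw k lw lw (levels m) j a \<ge> 0)"
      using p_vac_nonneg_iff[OF sol(2) b v0] m by (simp add: sol_def)
    ultimately show "levels m \<in> admissible r nw k lw lw N"
      using v0 by (simp add: admissible_def)
    show "s powi (- const_exp) * weight nw k lw lw (levels m) = ?term m"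
      by (rule fermionic_term_weight[OF sol(2) b v0, symmetric])
  next
    fix M assume M: "M \<in> admissible r nw k lw lw N"
    let ?m = "\<lambda>a j. M j a"
    show mt: "levels ?m = M" by (simp add: levels_def fun_eq_iff)
    have conf: "M \<in> configs k N" and v0: "vac nw k lw lw (levels ?m) 0 = 0"
      using M mt by (simp_all add: admissible_def)
    have nz: "1 \<le> j" "j \<le> k" "a \<in> I" if "M j a \<noteq> 0" for j a
      using conf that by (simp_all add: configs_def)
    then have "{(a, j). M j a \<noteq> 0} \<subseteq> I \<times> {..k}" by auto
    then have "finite {(a, j). M j a \<noteq> 0}" by (rule finite_subset) simp
    then have fv: "?m \<in> fin_vecs X" using nz by (simp add: fin_vecs_def)
    have b: "\<And>a i. ?m a i \<noteq> 0 \<Longrightarrow> i \<le> k" using nz by simp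
    have "?m \<in> solutions"
      using vac_0[OF fv b] v0 fv by (simp add: solutions_def)
    moreover have "r \<longrightarrow> (\<forall>a\<in>I. \<forall>i\<ge>1. p_vac X ?m n a i \<ge> 0)"
      using p_vac_nonneg_iff[OF fv b v0] M mt by (simp add: admissible_def)
    moreover have "wgt ?m = N"
      using conf mt by (simp add: wgt_def configs_def)
    ultimately show "?m \<in> {m \<in> sol r. wgt m = N}" by (simp add: sol_def)
  qed
  have total: "(\<Sum>m\<in>sol r. ?term m) =
      (\<Sum>N\<in>?T. \<Sum>M\<in>admissible r nw k lw lw N. s powi (- const_exp) * weight nw k lw lw M)" for r
  proof -
    have "(\<Sum>m\<in>sol r. ?term m) = (\<Sum>N\<in>?T. \<Sum>m\<in>{m \<in> sol r. wgt m = N}. ?term m)"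
      by (rule sum.group[symmetric]) (use fin_sol in \<open>auto simp: sol_def\<close>)
    then show ?thesis by (simp only: fiber)
  qed
  have "(\<Sum>M\<in>admissible True nw k lw lw N. weight nw k lw lw M) =
      (\<Sum>M\<in>admissible False nw k lw lw N. weight nw k lw lw M)" for N
    by (rule restricted_eq_unrestricted) (simp_all add: nw_def lw_def)
  then have "(\<Sum>m\<in>sol True. ?term m) = (\<Sum>m\<in>sol False. ?term m)"
    unfolding total sum_distrib_left[symmetric] by (simp only:)
  moreover have "fermionic_M X l n (inverse (s ^ 4)) = (\<Sum>m\<in>sol True. ?term m)"
    unfolding fermionic_M_def sol_def solutions_def inverse_inverse_eq by (rule sum.cong) auto
  moreover have "fermionic_M_tilde X l n (inverse (s ^ 4)) = (\<Sum>m\<in>sol False. ?term m)"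
    unfolding fermionic_M_tilde_def sol_def solutions_def inverse_inverse_eq by (rule sum.cong) auto
  ultimately show ?thesis by simp
qed

end

section \<open>The inverse of the Cartan matrix\<close>

text \<open>
  Twice the inverse Cartan matrix, which is integral in all types; the factor \<open>2\<close> clears the
  denominators of \<open>B\<^sub>r\<close> and \<open>C\<^sub>r\<close>.
\<close>

fun inv_cartan :: "twisted_type \<Rightarrow> nat \<Rightarrow> nat \<Rightarrow> int" where
  "inv_cartan (A_odd_2 r) a b = (if a = r then int b else 2 * int (min a b))"
| "inv_cartan (D_2 r) a b = (if b = r then 1 else 2) * int (min a b)"
| "inv_cartan E6_2 a b = 2 * ([[2,3,2,1],[3,6,4,2],[4,8,6,3],[2,4,3,2]] ! (a - 1) ! (b - 1))"
| "inv_cartan D4_3 a b = 2 * ([[2,3],[1,2]] ! (a - 1) ! (b - 1))"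

lemma inv_cartan_sym:
  assumes "is_twisted_type X" "a \<in> I_r X" "b \<in> I_r X"
  shows "t_expl X a * inv_cartan X a b = t_expl X b * inv_cartan X b a"
proof (cases X)
  case E6_2
  then have "a \<in> {1,2,3,4}" "b \<in> {1,2,3,4}" using assms by (auto simp: I_r_def)
  then show ?thesis by (auto simp: E6_2 t_expl_def I_r_def)
next
  case D4_3
  then have "a \<in> {1,2}" "b \<in> {1,2}" using assms by (auto simp: I_r_def)
  then show ?thesis by (auto simp: D4_3 t_expl_def I_r_def)
qed (use assms in \<open>auto simp: t_expl_def I_r_def min_def\<close>)

lemma cartan_inv_cartan:
  assumes X: "is_twisted_type X" and a: "a \<in> I_r X" and b: "b \<in> I_r X"
  shows "(\<Sum>c\<in>I_r X. cartan X a c * inv_cartan X c b) = (if a = b then 2 else 0)"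
proof -
  have row: "(\<Sum>c\<in>I_r X. cartan X a c * inv_cartan X c b) = 2 * inv_cartan X a b +
      (if a > 1 then cartan X a (a - 1) * inv_cartan X (a - 1) b else 0) +
      (if a < rk X then cartan X a (Suc a) * inv_cartan X (Suc a) b else 0)"
    by (rule cartan_row[OF X a])
  obtain a' where a': "a = Suc a'" using a by (cases a) (auto simp: I_r_def)
  show ?thesis
  proof (cases X)
    case (A_odd_2 r)
    then have r: "r \<ge> 2" "Suc a' \<le> r" "b \<ge> 1" "b \<le> r" using X a b a' by (auto simp: I_r_def)
    consider "Suc a' = r" | "Suc (Suc a') = r" | "Suc (Suc a') < r" using r by linarith
    then show ?thesis
    proof cases
      case 1
      then show ?thesis unfolding row unfolding a' A_odd_2 using r by (simp add: cartan_def min_def) auto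
    next
      case 2
      then show ?thesis unfolding row unfolding a' A_odd_2 using r by (simp add: cartan_def min_def split del: if_split) (auto simp: cartan_def)
    next
      case 3
      then show ?thesis unfolding row unfolding a' A_odd_2 using r by (simp add: cartan_def min_def split del: if_split) (auto simp: cartan_def)
    qed
  next
    case (D_2 r)
    then show ?thesis
      unfolding row using X a b a' by (auto simp: cartan_def I_r_def min_def)
  next
    case E6_2
    then have "a \<in> {1,2,3,4}" "b \<in> {1,2,3,4}" using a b by (auto simp: I_r_def)
    then show ?thesis unfolding row by (elim insertE emptyE; simp add: E6_2 cartan_def)
  next
    case D4_3
    then have "a \<in> {1,2}" "b \<in> {1,2}" using a b by (auto simp: I_r_def)
    then show ?thesis unfolding row by (elim insertE emptyE; simp add: D4_3 cartan_def)
  qed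
qed

lemma qsystem_cartan:
  assumes X: "is_twisted_type X" and s: "s \<noteq> (0::'k::field)" "\<And>k. k > 0 \<Longrightarrow> s ^ k \<noteq> 1"
  shows "qsystem (I_r X) (cartan_on X)
    (\<lambda>a b. if a \<in> I_r X \<and> b \<in> I_r X then t_expl X a * inv_cartan X a b else 0) (\<lambda>a. 2 * t_expl X a) s"
proof (unfold_locales, goal_cases)
  case (2 a)
  then show ?case by (simp add: cartan_on_def)
next
  case (3 a b)
  then show ?case by (cases X) (auto simp: cartan_on_def cartan_def)
next
  case (4 a b)
  have "cartan X b a = 0" if "a \<in> I_r X" "b \<in> I_r X" "cartan X a b = 0"
  proof -
    have "t_expl X b \<noteq> 0" using that by (cases X) (auto simp: t_expl_def)
    then show ?thesis using t_expl_sym[OF X that(1,2)] that(3) by simp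
  qed
  then show ?case using 4 unfolding cartan_on_def by metis
next
  case (6 a b)
  then show ?case using inv_cartan_sym[OF X] by auto
next
  case (7 a b)
  have "(\<Sum>c\<in>I_r X. cartan_on X c a * (if c \<in> I_r X \<and> b \<in> I_r X then t_expl X c * inv_cartan X c b else 0)) =
      (\<Sum>c\<in>I_r X. t_expl X a * (cartan X a c * inv_cartan X c b))"
  proof (rule sum.cong[OF refl])
    fix c assume c: "c \<in> I_r X"
    then have "t_expl X c * cartan X c a = t_expl X a * cartan X a c" using t_expl_sym[OF X c 7(1)] by simp
    then have "(t_expl X c * cartan X c a) * inv_cartan X c b = (t_expl X a * cartan X a c) * inv_cartan X c b" by simp
    then show "cartan_on X c a * (if c \<in> I_r X \<and> b \<in> I_r X then t_expl X c * inv_cartan X c b else 0) =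
        t_expl X a * (cartan X a c * inv_cartan X c b)"
      using c 7 by (simp add: cartan_on_def mult_ac)
  qed
  then show ?case
    unfolding sum_distrib_left[symmetric] cartan_inv_cartan[OF X 7] by simp
next
  case (8 a)
  then show ?case by (cases X) (auto simp: t_expl_def)
qed (use s in \<open>auto simp: cartan_on_def\<close>)

section \<open>Adjoining a fourth root of q\<close>

text \<open>
  Everything in the definition of the fermionic sums commutes with a homomorphism of fields. The
  substitution of \<open>q\<^sup>4\<close> for \<open>q\<close> is such a homomorphism and maps the assertion for \<open>q\<close> to the one for
  \<open>s\<^sup>4\<close> with \<open>s = q\<close>.
\<close>

locale field_embedding =
  fixes h :: "'a::field \<Rightarrow> 'b::field"
  assumes add: "h (x + y) = h x + h y" and mult: "h (x * y) = h x * h y" and one: "h 1 = 1"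
begin

lemma zero: "h 0 = 0"
proof -
  have "h 0 + h 0 = h 0 + 0" using add[of 0 0] by simp
  then show ?thesis by (rule add_left_imp_eq)
qed

lemma minus: "h (x - y) = h x - h y"
  using add[of "x - y" y] by simp

lemma eq_0_iff: "h x = 0 \<longleftrightarrow> x = 0"
proof (cases "x = 0")
  case False
  then have "h x * h (inverse x) = 1" using mult[of x "inverse x"] one by simp
  then show ?thesis using False by auto
qed (simp add: zero)

lemma eq_iff: "h x = h y \<longleftrightarrow> x = y"
  using eq_0_iff[of "x - y"] by (simp add: minus)

lemma inverse: "h (inverse x) = inverse (h x)"
proof (cases "x = 0")
  case False
  then have "h (inverse x) * h x = 1" by (simp add: mult[symmetric] one)
  then show ?thesis using False eq_0_iff[of x] by (simp add: field_simps)
qed (simp add: zero)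

lemma power: "h (x ^ k) = h x ^ k"
  by (induction k) (simp_all add: one mult)

lemma powi: "h (x powi k) = h x powi k"
  by (simp add: power_int_def power inverse)

lemma sum: "h (sum f S) = (\<Sum>x\<in>S. h (f x))"
  by (induction S rule: infinite_finite_induct) (simp_all add: zero add)

lemma prod: "h (prod f S) = (\<Prod>x\<in>S. h (f x))"
  by (induction S rule: infinite_finite_induct) (simp_all add: one mult)

lemma Prod_any: "h (Prod_any f) = Prod_any (\<lambda>x. h (f x))"
proof -
  have "h (f x) = 1 \<longleftrightarrow> f x = 1" for x using eq_iff[of "f x" 1] by (simp add: one)
  then show ?thesis by (simp add: Prod_any.expand_set prod)
qed

lemma v_binom: "h (v_binom v m p) = v_binom (h v) m p"
  by (simp add: v_binom_def prod divide_inverse mult inverse minus one powi power)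

lemma fermionic_term: "h (fermionic_term X m n q) = fermionic_term X m n (h q)"
  by (simp add: fermionic_term_def mult powi Prod_any prod v_binom)

lemma fermionic_M: "h (fermionic_M X l n z) = fermionic_M X l n (h z)"
  and fermionic_M_tilde: "h (fermionic_M_tilde X l n z) = fermionic_M_tilde X l n (h z)"
  by (simp_all add: fermionic_M_def fermionic_M_tilde_def sum fermionic_term inverse)

end

lemma pcompose_monom_eq_0_iff: "pcompose p (monom 1 4) = 0 \<longleftrightarrow> p = (0 :: rat poly)"
  by (rule pcompose_eq_0_iff) (simp add: degree_monom_eq)

definition power4_subst :: "rat poly fract \<Rightarrow> rat poly fract" where
  "power4_subst x = (THE y. \<forall>a b. b \<noteq> 0 \<longrightarrow> x = Fract a b \<longrightarrow>
    y = Fract (pcompose a (monom 1 4)) (pcompose b (monom 1 4)))"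

lemma power4_subst_Fract:
  assumes "b \<noteq> 0"
  shows "power4_subst (Fract a b) = Fract (pcompose a (monom 1 4)) (pcompose b (monom 1 4))"
  unfolding power4_subst_def
proof (rule the_equality)
  let ?p = "\<lambda>a. pcompose a (monom 1 4) :: rat poly"
  show "\<forall>a' b'. b' \<noteq> 0 \<longrightarrow> Fract a b = Fract a' b' \<longrightarrow> Fract (?p a) (?p b) = Fract (?p a') (?p b')"
  proof (intro allI impI)
    fix a' b' :: "rat poly" assume "b' \<noteq> 0" "Fract a b = Fract a' b'"
    then have "a * b' = a' * b" using assms by (simp add: eq_fract)
    then have "?p a * ?p b' = ?p a' * ?p b" by (simp add: pcompose_mult[symmetric])
    then show "Fract (?p a) (?p b) = Fract (?p a') (?p b')"
      using assms \<open>b' \<noteq> 0\<close> by (simp add: eq_fract pcompose_monom_eq_0_iff)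
  qed
qed (use assms in blast)

interpretation power4: field_embedding power4_subst
proof
  fix x y :: "rat poly fract"
  obtain a b c d where x: "x = Fract a b" "b \<noteq> 0" and y: "y = Fract c d" "d \<noteq> 0"
    by (metis Fract_cases)
  show "power4_subst (x + y) = power4_subst x + power4_subst y"
    using x(2) y(2) by (simp add: x(1) y(1) power4_subst_Fract pcompose_monom_eq_0_iff pcompose_mult pcompose_add)
  show "power4_subst (x * y) = power4_subst x * power4_subst y"
    using x(2) y(2) by (simp add: x(1) y(1) power4_subst_Fract pcompose_mult)
next
  show "power4_subst 1 = 1"
    unfolding One_fract_def by (simp add: power4_subst_Fract pcompose_1)
qed

lemma q_var_power: "q_var ^ k = Fract (monom 1 k) 1"
proof (induction k)
  case (Suc k)
  have "monom 1 (Suc k) = [:0, 1:] * (monom 1 k :: rat poly)"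
    by (simp add: monom_Suc)
  then show ?case by (simp only: power_Suc Suc.IH) (simp add: q_var_def)
qed (simp add: One_fract_def)

lemma power4_q_var: "power4_subst q_var = q_var ^ 4"
  unfolding q_var_power unfolding q_var_def
  by (simp add: power4_subst_Fract pcompose_pCons pcompose_1)

lemma q_var_generic: "k > 0 \<Longrightarrow> q_var ^ k \<noteq> 1"
proof
  assume k: "k > 0" and "q_var ^ k = 1"
  then have "monom 1 k = (1 :: rat poly)"
    by (simp add: q_var_power One_fract_def eq_fract)
  then show False using k by (metis degree_1 degree_monom_eq less_irrefl zero_neq_one)
qed

theorem theorem1p1:
  fixes X :: twisted_type
    and l :: "nat \<Rightarrow> nat"
    and n :: "nat \<Rightarrow> nat \<Rightarrow> nat"
  assumes "is_twisted_type X"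
    and "n \<in> fin_vecs X"
  shows "fermionic_M X l n (inverse q_var) = fermionic_M_tilde X l n (inverse q_var)"
proof -
  let ?W = "{m \<in> fin_vecs X. \<forall>a\<in>I_r X. q_zero X l m n a = 0}"
  have "\<exists>N. \<forall>m\<in>insert n ?W. \<forall>a i. m a i \<noteq> 0 \<longrightarrow> i \<le> N"
  proof -
    have "\<forall>m\<in>insert n ?W. \<exists>N. \<forall>a i. m a i \<noteq> 0 \<longrightarrow> i \<le> N"
    proof
      fix m assume "m \<in> insert n ?W"
      then have "m \<in> fin_vecs X" using assms(2) by auto
      then show "\<exists>N. \<forall>a i. m a i \<noteq> 0 \<longrightarrow> i \<le> N" by (rule fin_vecs_bound) blast
    qed
    from bchoice[OF this] obtain f where f: "\<forall>m\<in>insert n ?W. \<forall>a i. m a i \<noteq> 0 \<longrightarrow> i \<le> f m" ..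
    have "finite (f ` insert n ?W)" using finite_weight_set[OF assms] by simp
    then obtain N where N: "\<forall>x\<in>f ` insert n ?W. x \<le> N"
      unfolding finite_nat_set_iff_bounded_le ..
    show ?thesis
    proof (intro exI ballI allI impI)
      fix m a i assume m: "m \<in> insert n ?W" and nz: "m a i \<noteq> 0"
      have "i \<le> f m" using bspec[OF f m] nz by simp
      also have "f m \<le> N" using bspec[OF N imageI[OF m]] .
      finally show "i \<le> N" .
    qed
  qed
  then obtain k where k: "\<And>m a i. m \<in> insert n ?W \<Longrightarrow> m a i \<noteq> 0 \<Longrightarrow> i \<le> k"
    by blast
  have q0: "q_var \<noteq> 0" using q_var_generic[of 1] by (auto simp: q_var_def Zero_fract_def eq_fract)
  interpret qsystem "I_r X" "cartan_on X"
    "\<lambda>a b. if a \<in> I_r X \<and> b \<in> I_r X then t_expl X a * inv_cartan X a b else 0" "\<lambda>a. 2 * t_expl X a" q_var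
    by (rule qsystem_cartan[OF assms(1) q0 q_var_generic])
  interpret twisted_qsystem X
    "\<lambda>a b. if a \<in> I_r X \<and> b \<in> I_r X then t_expl X a * inv_cartan X a b else 0" q_var l n k
    by unfold_locales (use assms k in auto)
  have "fermionic_M X l n (inverse (q_var ^ 4)) = fermionic_M_tilde X l n (inverse (q_var ^ 4))"
    by (rule fermionic_sums_agree) (use k in \<open>auto simp: solutions_def\<close>)
  then have "power4_subst (fermionic_M X l n (inverse q_var)) = power4_subst (fermionic_M_tilde X l n (inverse q_var))"
    by (simp only: power4.fermionic_M power4.fermionic_M_tilde power4.inverse power4_q_var)
  then show ?thesis by (simp only: power4.eq_iff)
qed

end
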